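(* Let $\mathcal H$ be a rooted hypertree. Then its edge ideal $I(\mathcal H)$ is bridge-friendly. In particular, it has a minimal Barile-Macchia resolution.
   Context: **Hypergraphs.** A *hypergraph* $\mathcal H=(V,\mathcal E)$ has a finite vertex set $V=\{x_1,\dots,x_d\}$ and an edge set $\mathcal E$ of subsets of $V$; all hypergraphs are assumed *simple*: there is no nontrivial containment between edges. Its *edge ideal* is $I(\mathcal H)=\langle\prod_{x\in e}x : e\in\mathcal E\rangle\subseteq S=\Bbbk[x_1,\dots,x_d]$, $\Bbbk$ a field. A *host graph* of $\mathcal H$ is a graph $H$ on the same vertex set $V$ such that for every $e\in\mathcal E$ the induced subgraph of $H$ on $e$ is connected. $\mathcal H$ is a *hypertree* if it has a host graph that is a tree. A hypertree $\mathcal H$ is *rooted at* $x\in V$ if there is a host graph $H$ of $\mathcal H$ that is a tree such that each edge of $\mathcal H$ consists of vertices of (pairwise) different distances from $x$ in $H$. A *rooted hypertree* is a hypertree rooted at some vertex. **Bridge-friendliness.** Let $I\subseteq S$ be a monomial ideal with finite set of minimal monomial generators $\mathrm{MinGens}(I)$, and fix a total order $\succ$ on it. If $m\succ m'$ we say $m$ *dominates* $m'$. For $\sigma\subseteq\mathrm{MinGens}(I)$, $\mathrm{lcm}(\sigma)$ is the least common multiple of its elements ($\mathrm{lcm}(\emptyset)=1$). - $m\in\sigma$ is a *bridge* of $\sigma$ if $\mathrm{lcm}(\sigma\setminus\{m\})=\mathrm{lcm}(\sigma)$. $\mathrm{sb}(\sigma)$ is the smallest bridge of $\sigma$ with respect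 to $\succ$ if $\sigma$ has one, and $\mathrm{sb}(\sigma)=\emptyset$ otherwise (then $\sigma\setminus\{\mathrm{sb}(\sigma)\}$ means $\sigma$). - $m\in\mathrm{MinGens}(I)\setminus\sigma$ is a *gap* of $\sigma$ if $\mathrm{lcm}(\sigma\cup\{m\})=\mathrm{lcm}(\sigma)$. - $m$ is a *true gap* of $\sigma$ if it is a gap of $\sigma$ and every bridge $m'$ of $\sigma\cup\{m\}$ with $m\succ m'$ is a bridge of $\sigma$. - $\sigma$ is *potentially-type-2* if it has a bridge not dominating any of its true gaps. - $\sigma$ is *type-2* if it is potentially-type-2 and whenever there is another potentially-type-2 subset $\sigma'\neq\sigma$ with $\sigma'\setminus\{\mathrm{sb}(\sigma')\}=\sigma\setminus\{\mathrm{sb}(\sigma)\}$, we have $\mathrm{sb}(\sigma')\succ\mathrm{sb}(\sigma)$. $I$ is *bridge-friendly* if there is a total order $\succ$ on $\mathrm{MinGens}(I)$ such that all potentially-type-2 subsets are type-2. **Barile-Macchia resolutions.** Let $G_I$ be the directed graph whose vertices are all $\sigma\subseteq\mathrm{MinGens}(I)$ and whose edges are $\sigma\to\tau$ with $\tau\subset\sigma$, $|\tau|=|\sigma|-1$. A set $A$ of edges is an ($\mathrm{lcm}$-)*homogeneous acyclic matching* if each vertex lies in at most one edge of $A$, $\mathrm{lcm}(\sigma)=\mathrm{lcm}(\tau)$ for all $\sigma\to\tau$ in $A$, and reversing the edges of $A$ in $G_I$ gives a graph with no directed cycle. Subsets in no edge of $A$ are *$A$-critical*. By discrete Morse theory (Batzies–Welker),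 $A$ induces from the Taylor resolution a $\mathbb Z^d$-graded free resolution $\mathcal F_A$ of $S/I$ (the *Morse resolution* ) in which $(\mathcal F_A)_i$ has a basis identified with the $A$-critical subsets with exactly $i$ elements; in particular $\mathcal F_A$ is minimal iff for every $i$ the number of $A$-critical subsets of cardinality $i$ equals $\dim_\Bbbk\mathrm{Tor}^S_i(S/I,\Bbbk)$. Given a total order $\succ$ on $\mathrm{MinGens}(I)$, run the following algorithm for each monomial $p$, with $\Omega$ the set of subsets of $\mathrm{MinGens}(I)$ with lcm $p$ and cardinality at least $3$, starting with $A_p=\emptyset$. (1) Pick $\sigma\in\Omega$ of maximal cardinality. (2) Replace $\Omega$ by $\Omega\setminus\{\sigma,\sigma\setminus\{\mathrm{sb}(\sigma)\}\}$; if $\mathrm{sb}(\sigma)\neq\emptyset$ add the edge $\sigma\to\sigma\setminus\{\mathrm{sb}(\sigma)\}$ to $A_p$; if $\Omega\ne\emptyset$ return to (1). (3) Whenever $A_p$ contains distinct edges $\sigma\to\sigma\setminus\{\mathrm{sb}(\sigma)\}$ and $\sigma'\to\sigma'\setminus\{\mathrm{sb}(\sigma')\}$ with the same target: if $\mathrm{sb}(\sigma')\succ\mathrm{sb}(\sigma)$ remove the edge starting at $\sigma'$, otherwise remove the edge starting at $\sigma$. (4) Return $A_p$. Then $A=\bigcup_pA_p$ is a homogeneous acyclic matching, and $\mathcal F_A$ is the *Barile-Macchia resolution* of $S/I$ with respect to $\succ$. "$I$ (or $S/I$) has a minimal Barile-Macchia resolution" means that $\mathcal F_A$ is minimal for some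 total order $\succ$. *)

theory Defs
  imports Complex_Main "HOL-Library.Poly_Mapping" "HOL-Library.Function_Algebras"
begin

section \<open>Monomials, polynomials and ideals\<close>

text \<open>
  The variables are the elements of a finite type \<open>'v\<close>.  A monomial is identified with its
  exponent vector; multiplication is pointwise addition, divisibility is the pointwise order
  \<open>\<le>\<close>, and the quotient of a monomial by a divisor is pointwise subtraction.
  The polynomial ring is the monoid algebra of exponent vectors, with the convolution product
  of \<^theory>\<open>HOL-Library.Poly_Mapping\<close>.
\<close>

type_synonym 'v mon = "'v \<Rightarrow> nat"
type_synonym ('v, 'k) mpoly = "('v \<Rightarrow> nat) \<Rightarrow>\<^sub>0 'k"

definition monomial :: "'v mon \<Rightarrow> ('v, 'k::comm_ring_1) mpoly" where
  "monomial m = Poly_Mapping.single m 1"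

definition var :: "'v \<Rightarrow> ('v, 'k::comm_ring_1) mpoly" where
  "var x = monomial (\<lambda>y. if y = x then 1 else 0)"

text \<open>The ideal generated by a set, as a submodule of the ring over itself.\<close>

definition ideal_gen :: "'a::comm_ring_1 set \<Rightarrow> 'a set" where
  "ideal_gen B = module.span (*) B"

lemma module_mult: "module ((*) :: 'a::comm_ring_1 \<Rightarrow> 'a \<Rightarrow> 'a)"
  by unfold_locales (simp_all add: algebra_simps)

definition max_ideal :: "('v, 'k::comm_ring_1) mpoly set" where
  "max_ideal = ideal_gen (range var)"

text \<open>Minimal monomial generators of a monomial ideal: the monomials of the ideal that are
  minimal with respect to divisibility.\<close>

definition min_gens :: "('v, 'k::comm_ring_1) mpoly set \<Rightarrow> 'v mon set" where
  "min_gens I = {m. monomial m \<in> I \<and> (\<forall>m'. monomial m' \<in> I \<and> m' \<le> m \<longrightarrow> m' = m)}"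

definition lcm_mon :: "'v mon set \<Rightarrow> 'v mon" where
  "lcm_mon \<sigma> = (\<lambda>x. Max (insert 0 ((\<lambda>m. m x) ` \<sigma>)))"


section \<open>Rooted hypertrees\<close>

text \<open>
  The vertex set is the universe of the finite type \<open>'v\<close>, so a hypergraph is given by its
  edge set.  A simple graph on \<open>'v\<close> is an irreflexive symmetric relation.
\<close>

definition simple_hypergraph :: "'v set set \<Rightarrow> bool" where
  "simple_hypergraph E \<longleftrightarrow> (\<forall>e\<in>E. \<forall>f\<in>E. e \<subseteq> f \<longrightarrow> e = f)"

definition edge_ideal :: "'v set set \<Rightarrow> ('v, 'k::comm_ring_1) mpoly set" where
  "edge_ideal E = ideal_gen ((\<lambda>e. \<Prod>x\<in>e. var x) ` E)"

definition graph :: "('v \<times> 'v) set \<Rightarrow> bool" where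
  "graph H \<longleftrightarrow> sym H \<and> irrefl H"

text \<open>A connected graph is nonempty; hence a hypergraph with a host graph has no empty edge.\<close>

definition induced_connected :: "('v \<times> 'v) set \<Rightarrow> 'v set \<Rightarrow> bool" where
  "induced_connected H U \<longleftrightarrow>
     U \<noteq> {} \<and> (\<forall>u\<in>U. \<forall>v\<in>U. (u, v) \<in> (H \<inter> U \<times> U)\<^sup>*)"

definition is_cycle :: "('v \<times> 'v) set \<Rightarrow> 'v list \<Rightarrow> bool" where
  "is_cycle H vs \<longleftrightarrow> 3 \<le> length vs \<and> distinct vs \<and>
     successively (\<lambda>u v. (u, v) \<in> H) vs \<and> (last vs, hd vs) \<in> H"

definition tree :: "('v \<times> 'v) set \<Rightarrow> bool" where
  "tree H \<longleftrightarrow> graph H \<and> induced_connected H UNIV \<and> (\<nexists>vs. is_cycle H vs)"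

definition host_graph :: "'v set set \<Rightarrow> ('v \<times> 'v) set \<Rightarrow> bool" where
  "host_graph E H \<longleftrightarrow> graph H \<and> (\<forall>e\<in>E. induced_connected H e)"

definition graph_dist :: "('v \<times> 'v) set \<Rightarrow> 'v \<Rightarrow> 'v \<Rightarrow> nat" where
  "graph_dist H x y = (LEAST n. (x, y) \<in> H ^^ n)"

definition hypertree_rooted_at :: "'v set set \<Rightarrow> 'v \<Rightarrow> bool" where
  "hypertree_rooted_at E x \<longleftrightarrow> simple_hypergraph E \<and>
     (\<exists>H. host_graph E H \<and> tree H \<and> (\<forall>e\<in>E. inj_on (graph_dist H x) e))"

definition rooted_hypertree :: "'v set set \<Rightarrow> bool" where
  "rooted_hypertree E \<longleftrightarrow> (\<exists>x. hypertree_rooted_at E x)"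


section \<open>Bridge-friendliness\<close>

text \<open>
  Throughout, \<open>G\<close> is the set of minimal generators and \<open>(m, m') \<in> r\<close> means \<open>m \<succ> m'\<close>
  (that is, \<open>m\<close> dominates \<open>m'\<close>), where \<open>r\<close> is a strict linear order on \<open>G\<close>.
\<close>

definition bridges :: "'v mon set \<Rightarrow> 'v mon set" where
  "bridges \<sigma> = {m\<in>\<sigma>. lcm_mon (\<sigma> - {m}) = lcm_mon \<sigma>}"

definition sb :: "('v mon \<times> 'v mon) set \<Rightarrow> 'v mon set \<Rightarrow> 'v mon option" where
  "sb r \<sigma> = (if bridges \<sigma> = {} then None
     else Some (THE m. m \<in> bridges \<sigma> \<and> (\<forall>m'\<in>bridges \<sigma>. m' \<noteq> m \<longrightarrow> (m', m) \<in> r)))"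

definition remove_sb :: "('v mon \<times> 'v mon) set \<Rightarrow> 'v mon set \<Rightarrow> 'v mon set" where
  "remove_sb r \<sigma> = \<sigma> - set_option (sb r \<sigma>)"

definition sb_succ :: "('v mon \<times> 'v mon) set \<Rightarrow> 'v mon set \<Rightarrow> 'v mon set \<Rightarrow> bool" where
  "sb_succ r \<sigma>' \<sigma> \<longleftrightarrow> (\<exists>m' m. sb r \<sigma>' = Some m' \<and> sb r \<sigma> = Some m \<and> (m', m) \<in> r)"

definition gaps :: "'v mon set \<Rightarrow> 'v mon set \<Rightarrow> 'v mon set" where
  "gaps G \<sigma> = {m \<in> G - \<sigma>. lcm_mon (\<sigma> \<union> {m}) = lcm_mon \<sigma>}"

definition true_gaps ::
    "('v mon \<times> 'v mon) set \<Rightarrow> 'v mon set \<Rightarrow> 'v mon set \<Rightarrow> 'v mon set" where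
  "true_gaps r G \<sigma> =
     {m \<in> gaps G \<sigma>. \<forall>m' \<in> bridges (\<sigma> \<union> {m}). (m, m') \<in> r \<longrightarrow> m' \<in> bridges \<sigma>}"

definition potentially_type2 ::
    "('v mon \<times> 'v mon) set \<Rightarrow> 'v mon set \<Rightarrow> 'v mon set \<Rightarrow> bool" where
  "potentially_type2 r G \<sigma> \<longleftrightarrow> (\<exists>m\<in>bridges \<sigma>. \<forall>g\<in>true_gaps r G \<sigma>. (m, g) \<notin> r)"

definition type2 ::
    "('v mon \<times> 'v mon) set \<Rightarrow> 'v mon set \<Rightarrow> 'v mon set \<Rightarrow> bool" where
  "type2 r G \<sigma> \<longleftrightarrow> potentially_type2 r G \<sigma> \<and>
     (\<forall>\<sigma>'\<subseteq>G. potentially_type2 r G \<sigma>' \<and> \<sigma>' \<noteq> \<sigma> \<and> remove_sb r \<sigma>' = remove_sb r \<sigma>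
        \<longrightarrow> sb_succ r \<sigma>' \<sigma>)"

definition bridge_friendly :: "('v, 'k::comm_ring_1) mpoly set \<Rightarrow> bool" where
  "bridge_friendly I \<longleftrightarrow> (\<exists>r. strict_linear_order_on (min_gens I) r \<and>
     (\<forall>\<sigma>\<subseteq>min_gens I. potentially_type2 r (min_gens I) \<sigma> \<longrightarrow> type2 r (min_gens I) \<sigma>))"


section \<open>The Barile-Macchia matching\<close>

type_synonym 'v edges = "('v mon set \<times> 'v mon set) set"

text \<open>Steps (1) and (2), acting on the pair of \<open>\<Omega>\<close> and the edges collected so far.\<close>

inductive bm_collect ::
    "('v mon \<times> 'v mon) set \<Rightarrow> 'v mon set set \<times> 'v edges \<Rightarrow> 'v mon set set \<times> 'v edges \<Rightarrow> bool"
  for r where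
  "\<sigma> \<in> \<Omega> \<Longrightarrow> (\<forall>\<tau>\<in>\<Omega>. card \<tau> \<le> card \<sigma>) \<Longrightarrow>
   bm_collect r (\<Omega>, A)
     (\<Omega> - {\<sigma>, remove_sb r \<sigma>},
      if sb r \<sigma> = None then A else insert (\<sigma>, remove_sb r \<sigma>) A)"

text \<open>Step (3): resolving one pair of edges with the same target.\<close>

inductive bm_prune :: "('v mon \<times> 'v mon) set \<Rightarrow> 'v edges \<Rightarrow> 'v edges \<Rightarrow> bool" for r where
  "(\<sigma>, \<tau>) \<in> A \<Longrightarrow> (\<sigma>', \<tau>) \<in> A \<Longrightarrow> \<sigma> \<noteq> \<sigma>' \<Longrightarrow>
   bm_prune r A (A - {(if sb_succ r \<sigma>' \<sigma> then \<sigma>' else \<sigma>, \<tau>)})"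

text \<open>The choices left open by the algorithm do not affect its output: larger subsets are always
  treated first, subsets of equal cardinality do not interfere in steps (1) and (2), and step (3)
  keeps for each target the edge with the smallest bridge.\<close>

definition bm_output ::
    "('v mon \<times> 'v mon) set \<Rightarrow> 'v mon set \<Rightarrow> 'v mon \<Rightarrow> 'v edges \<Rightarrow> bool" where
  "bm_output r G p A \<longleftrightarrow>
     (\<exists>A0. (bm_collect r)\<^sup>*\<^sup>* ({\<sigma>. \<sigma> \<subseteq> G \<and> lcm_mon \<sigma> = p \<and> 3 \<le> card \<sigma>}, {}) ({}, A0) \<and>
           (bm_prune r)\<^sup>*\<^sup>* A0 A \<and> (\<nexists>A'. bm_prune r A A'))"

definition bm_matching ::
    "('v mon \<times> 'v mon) set \<Rightarrow> 'v mon set \<Rightarrow> 'v edges \<Rightarrow> bool" where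
  "bm_matching r G A \<longleftrightarrow> (\<exists>Ap. (\<forall>p. bm_output r G p (Ap p)) \<and> A = (\<Union>p. Ap p))"


section \<open>The Morse resolution\<close>

definition taylor_edges :: "'v mon set \<Rightarrow> 'v edges" where
  "taylor_edges G = {(\<sigma>, \<tau>). \<sigma> \<subseteq> G \<and> \<tau> \<subset> \<sigma> \<and> card \<sigma> = Suc (card \<tau>)}"

definition critical :: "'v mon set \<Rightarrow> 'v edges \<Rightarrow> 'v mon set set" where
  "critical G A = {\<sigma>. \<sigma> \<subseteq> G \<and> (\<forall>\<tau>. (\<sigma>, \<tau>) \<notin> A \<and> (\<tau>, \<sigma>) \<notin> A)}"

text \<open>The incidence number of \<open>\<sigma>\<close> and \<open>\<tau> = \<sigma> - {m}\<close> in the Taylor resolution, up to the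
  monomial factor: \<open>-1\<close> to the number of elements of \<open>\<sigma>\<close> preceding \<open>m\<close>.\<close>

definition incidence ::
    "('v mon \<times> 'v mon) set \<Rightarrow> 'v mon set \<Rightarrow> 'v mon set \<Rightarrow> 'k::comm_ring_1" where
  "incidence r \<sigma> \<tau> = (-1) ^ card {m'\<in>\<sigma>. \<exists>m\<in>\<sigma> - \<tau>. (m', m) \<in> r}"

text \<open>Gradient paths are the directed paths (listed by their vertices) in the graph obtained
  from \<open>G_I\<close> by reversing the edges of \<open>A\<close>.\<close>

definition reversed_edges :: "'v mon set \<Rightarrow> 'v edges \<Rightarrow> 'v edges" where
  "reversed_edges G A = (taylor_edges G - A) \<union> A\<inverse>"

definition gradient_paths ::
    "'v mon set \<Rightarrow> 'v edges \<Rightarrow> 'v mon set \<Rightarrow> 'v mon set \<Rightarrow> 'v mon set list set" where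
  "gradient_paths G A \<sigma> \<tau> =
     {P. P \<noteq> [] \<and> hd P = \<sigma> \<and> last P = \<tau> \<and>
         successively (\<lambda>a b. (a, b) \<in> reversed_edges G A) P}"

definition step_weight ::
    "('v mon \<times> 'v mon) set \<Rightarrow> 'v edges \<Rightarrow> 'v mon set \<Rightarrow> 'v mon set \<Rightarrow> 'k::comm_ring_1" where
  "step_weight r A \<sigma> \<tau> = (if (\<tau>, \<sigma>) \<in> A then - incidence r \<tau> \<sigma> else incidence r \<sigma> \<tau>)"

definition path_weight ::
    "('v mon \<times> 'v mon) set \<Rightarrow> 'v edges \<Rightarrow> 'v mon set list \<Rightarrow> 'k::comm_ring_1" where
  "path_weight r A P = prod_list (map2 (step_weight r A) P (tl P))"

definition morse_coeff ::
    "('v mon \<times> 'v mon) set \<Rightarrow> 'v mon set \<Rightarrow> 'v edges \<Rightarrow> 'v mon set \<Rightarrow> 'v mon set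
       \<Rightarrow> 'k::comm_ring_1" where
  "morse_coeff r G A \<sigma> \<tau> =
     (\<Sum>\<sigma>' | (\<sigma>, \<sigma>') \<in> taylor_edges G.
        incidence r \<sigma> \<sigma>' * (\<Sum>P\<in>gradient_paths G A \<sigma>' \<tau>. path_weight r A P))"

text \<open>
  The module in homological degree \<open>i\<close> is free on the critical subsets with \<open>i\<close> elements;
  its elements are represented by their coordinate functions.  The basis element \<open>\<sigma>\<close> is sent by
  the differential to the sum of \<open>morse_coeff \<sigma> \<tau> * (lcm \<sigma> / lcm \<tau>)\<close> times \<open>\<tau>\<close> over the critical
  \<open>\<tau>\<close> with \<open>i - 1\<close> elements.
\<close>

definition morse_module ::
    "'v mon set \<Rightarrow> 'v edges \<Rightarrow> nat \<Rightarrow> ('v mon set \<Rightarrow> ('v, 'k::comm_ring_1) mpoly) set" where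
  "morse_module G A i = {f. \<forall>\<sigma>. f \<sigma> \<noteq> 0 \<longrightarrow> \<sigma> \<in> critical G A \<and> card \<sigma> = i}"

definition morse_diff ::
    "('v mon \<times> 'v mon) set \<Rightarrow> 'v mon set \<Rightarrow> 'v edges
       \<Rightarrow> ('v mon set \<Rightarrow> ('v, 'k::comm_ring_1) mpoly) \<Rightarrow> 'v mon set \<Rightarrow> ('v, 'k) mpoly" where
  "morse_diff r G A f = (\<lambda>\<tau>. if \<tau> \<in> critical G A
     then \<Sum>\<sigma> | \<sigma> \<in> critical G A \<and> card \<sigma> = Suc (card \<tau>).
            f \<sigma> * Poly_Mapping.single (lcm_mon \<sigma> - lcm_mon \<tau>) (morse_coeff r G A \<sigma> \<tau>)
     else 0)"

text \<open>Exactness of \<open>\<cdots> \<rightarrow> F 1 \<rightarrow> F 0 \<rightarrow> S/I \<rightarrow> 0\<close>, where the augmentation maps \<open>f\<close> to the class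
  of the coordinate of \<open>f\<close> at the empty subset.\<close>

definition resolves_quotient ::
    "('v, 'k::comm_ring_1) mpoly set
       \<Rightarrow> (nat \<Rightarrow> ('v mon set \<Rightarrow> ('v, 'k) mpoly) set)
       \<Rightarrow> (('v mon set \<Rightarrow> ('v, 'k) mpoly) \<Rightarrow> 'v mon set \<Rightarrow> ('v, 'k) mpoly) \<Rightarrow> bool" where
  "resolves_quotient I F d \<longleftrightarrow>
     (\<forall>s. \<exists>f\<in>F 0. f {} - s \<in> I) \<and>
     (\<forall>f\<in>F 0. f {} \<in> I \<longleftrightarrow> f \<in> d ` F 1) \<and>
     (\<forall>i. \<forall>f\<in>F (Suc i). d f = (\<lambda>_. 0) \<longleftrightarrow> f \<in> d ` F (Suc (Suc i)))"

text \<open>Minimality: the differential maps each \<open>F (i + 1)\<close> into \<open>\<mm> F i\<close>.\<close>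

definition minimal_complex ::
    "(nat \<Rightarrow> ('v mon set \<Rightarrow> ('v, 'k::comm_ring_1) mpoly) set)
       \<Rightarrow> (('v mon set \<Rightarrow> ('v, 'k) mpoly) \<Rightarrow> 'v mon set \<Rightarrow> ('v, 'k) mpoly) \<Rightarrow> bool" where
  "minimal_complex F d \<longleftrightarrow> (\<forall>i. \<forall>f\<in>F (Suc i). \<forall>\<tau>. d f \<tau> \<in> max_ideal)"

definition has_minimal_barile_macchia_resolution ::
    "('v, 'k::comm_ring_1) mpoly set \<Rightarrow> bool" where
  "has_minimal_barile_macchia_resolution I \<longleftrightarrow>
     (\<exists>r A. strict_linear_order_on (min_gens I) r \<and> bm_matching r (min_gens I) A \<and>
        resolves_quotient I (morse_module (min_gens I) A) (morse_diff r (min_gens I) A) \<and>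
        minimal_complex
          (morse_module (min_gens I) A :: nat \<Rightarrow> ('v mon set \<Rightarrow> ('v, 'k) mpoly) set)
          (morse_diff r (min_gens I) A))"

end

theory Submission
  imports Defs
begin

text \<open>
  Why the edge ideal is bridge-friendly.  In the rooted host tree every hyperedge is a path
  descending away from the root.  Order the generators so that an edge reaching closer to the root
  dominates an edge starting deeper, breaking ties arbitrarily.  Suppose two different
  potentially-type-2 sets \<open>\<tau> \<union> {a}\<close> and \<open>\<tau> \<union> {b}\<close> lose their smallest bridges \<open>a \<succ> b\<close> and become the
  same set \<open>\<tau>\<close>.  Then \<open>b\<close> is a gap, but not a true gap, of \<open>\<tau> \<union> {a}\<close>, so adding \<open>b\<close> creates a new
  bridge \<open>c \<prec> b\<close> in \<open>\<tau>\<close>: the edge \<open>c\<close> is covered with the help of both \<open>a\<close> and \<open>b\<close>, but not with the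
  help of only one of them (\<open>bridge_friendly_criterion\<close>).  Hence \<open>c\<close> has a vertex lying in \<open>b\<close> but not
  in \<open>a\<close> and a vertex lying in \<open>a\<close> but not in \<open>b\<close>.  The one of \<open>a\<close>, \<open>b\<close> that contains the lower of
  these two vertices starts at least as close to the root as \<open>c\<close>, and it is a descending path, so it
  also contains the upper one (\<open>hyperedges_meet_in_path\<close>): a contradiction.

  Why bridge-friendliness gives a minimal Barile-Macchia resolution.  A set with a bridge is either
  potentially-type-2 or the target of an edge from a potentially-type-2 set
  (\<open>target_of_potentially_type2\<close>).  For a bridge-friendly order different potentially-type-2 sets
  have different targets, so the pruning step discards nothing and the algorithm returns all edges
  \<open>\<sigma> \<rightarrow> \<sigma> - {sb \<sigma>}\<close> with \<open>\<sigma>\<close> potentially-type-2; the critical sets have no bridges.  A gradient path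
  between critical sets with equal lcm would have to start by removing a bridge, so all entries
  of the Morse differential lie in the maximal ideal (\<open>morse_minimal\<close>).

  Why the Morse complex is a resolution.  The matching preserves the lcm and is acyclic, because each
  step of a gradient path lowers the lcm or else a numerical potential
  (\<open>reversed_edge_decreases\<close>).  In multidegree \<open>u\<close> the Morse complex is the Morse complex, over
  the coefficient ring, of the full simplex on the generators dividing \<open>u\<close>.  The simplex
  is a cone, hence exact.  Summing over gradient paths is a chain map from the simplex onto the
  critical sets, which kills the sources of the matching and their boundaries; a cycle of critical
  sets lifts along it to a cycle of the simplex, which bounds, and the image of the bounding chain
  is the required preimage (\<open>morse_strand_exact\<close>).  Only finitely many multidegrees
  occur in an element, so the solutions in the separate degrees can be glued (\<open>morse_exact\<close>).
\<close>


section \<open>Hyperedges of a rooted hypertree as descending paths\<close>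

lemma distinct_walk_exists:
  assumes "(a, b) \<in> R\<^sup>*"
  shows "\<exists>xs. xs \<noteq> [] \<and> hd xs = a \<and> last xs = b \<and> distinct xs \<and>
           successively (\<lambda>u v. (u, v) \<in> R) xs"
  using assms
proof (induction rule: rtrancl_induct)
  case base
  then show ?case by (intro exI[of _ "[a]"]) auto
next
  case (step y z)
  then obtain xs where xs: "xs \<noteq> []" "hd xs = a" "last xs = y" "distinct xs"
    "successively (\<lambda>u v. (u, v) \<in> R) xs" by blast
  show ?case
  proof (cases "z \<in> set xs")
    case True
    then obtain us vs where "xs = us @ z # vs" by (meson split_list)
    then show ?thesis using xs
      by (intro exI[of _ "us @ [z]"]) (auto simp: successively_append_iff hd_append split: if_splits)
  next
    case False
    then show ?thesis using xs step.hyps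
      by (intro exI[of _ "xs @ [z]"]) (auto simp: successively_append_iff)
  qed
qed

lemma graph_dist_le: "(x, y) \<in> H ^^ n \<Longrightarrow> graph_dist H x y \<le> n"
  unfolding graph_dist_def by (rule Least_le)

lemma tree_walk_of_dist:
  assumes "tree H"
  shows "(x, y) \<in> H ^^ graph_dist H x y"
proof -
  have "(x, y) \<in> H\<^sup>*"
    using assms unfolding tree_def induced_connected_def by auto
  then obtain n where "(x, y) \<in> H ^^ n" using rtrancl_imp_relpow by blast
  then show ?thesis unfolding graph_dist_def by (rule LeastI)
qed

lemma graph_dist_step:
  assumes "tree H" "(y, z) \<in> H"
  shows "graph_dist H x z \<le> Suc (graph_dist H x y)"
  by (rule graph_dist_le) (use tree_walk_of_dist[OF assms(1)] assms(2) in auto)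

text \<open>
  A shortest walk from \<open>x\<close> never gets farther from \<open>x\<close> than its endpoint. This is what keeps the
  walks between two parents of a vertex \<open>v\<close> away from \<open>v\<close> below.
\<close>

lemma reachable_within_dist:
  assumes "tree H" "graph_dist H x y = n"
  shows "(x, y) \<in> (H \<inter> {z. graph_dist H x z \<le> n} \<times> {z. graph_dist H x z \<le> n})\<^sup>*"
  using assms(2)
proof (induction n arbitrary: y)
  case 0
  then have "x = y" using tree_walk_of_dist[OF assms(1), of x y] by simp
  then show ?case by simp
next
  case (Suc n)
  obtain z where z: "(x, z) \<in> H ^^ n" "(z, y) \<in> H"
    using tree_walk_of_dist[OF assms(1), of x y] Suc.prems by auto
  have "graph_dist H x z \<le> n" using z(1) by (rule graph_dist_le)
  moreover have "n \<le> graph_dist H x z"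
    using graph_dist_step[OF assms(1) z(2), of x] Suc.prems by simp
  ultimately have dz: "graph_dist H x z = n" by simp
  have "(x, z) \<in> (H \<inter> {z. graph_dist H x z \<le> Suc n} \<times> {z. graph_dist H x z \<le> Suc n})\<^sup>*"
    by (rule subsetD[OF rtrancl_mono Suc.IH[OF dz]]) auto
  moreover have "(z, y) \<in> H \<inter> {z. graph_dist H x z \<le> Suc n} \<times> {z. graph_dist H x z \<le> Suc n}"
    using z dz Suc.prems by simp
  ultimately show ?case by (rule rtrancl_into_rtrancl)
qed

text \<open>
  Two different parents of \<open>v\<close> are joined by a walk through vertices closer to the root than \<open>v\<close>;
  closing it up at \<open>v\<close> gives a cycle.
\<close>

lemma tree_parent_unique:
  assumes "tree H" "(v, u) \<in> H" "(v, w) \<in> H"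
    and "graph_dist H x v = Suc n" "graph_dist H x u = n" "graph_dist H x w = n"
  shows "u = w"
proof (rule ccontr)
  assume "u \<noteq> w"
  define R where "R = H \<inter> {z. graph_dist H x z \<le> n} \<times> {z. graph_dist H x z \<le> n}"
  have symH: "sym H" using assms(1) unfolding tree_def graph_def by blast
  have "sym R" using symH unfolding R_def sym_def by auto
  then have "sym (R\<^sup>*)" by (rule sym_rtrancl)
  moreover have "(x, u) \<in> R\<^sup>*" "(x, w) \<in> R\<^sup>*"
    unfolding R_def using assms(5,6) by (auto intro: reachable_within_dist[OF assms(1)])
  ultimately have "(u, x) \<in> R\<^sup>*" "(x, w) \<in> R\<^sup>*" by (auto dest: symD)
  then have "(u, w) \<in> R\<^sup>*" by (rule rtrancl_trans)
  then obtain xs where xs: "xs \<noteq> []" "hd xs = u" "last xs = w" "distinct xs"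
    "successively (\<lambda>a b. (a, b) \<in> R) xs" using distinct_walk_exists[of u w R] by blast
  have low: "graph_dist H x z \<le> n" if "z \<in> set xs" for z
  proof -
    have "\<forall>z\<in>set ys. graph_dist H x z \<le> n"
      if "ys \<noteq> []" "graph_dist H x (hd ys) \<le> n" "successively (\<lambda>a b. (a, b) \<in> R) ys" for ys
      using that
    proof (induction ys)
      case (Cons y ys)
      then show ?case by (cases ys) (auto simp: R_def)
    qed simp
    from this[of xs] show ?thesis using xs assms(5) that by simp
  qed
  obtain y ys where ys: "xs = u # y # ys"
    using xs \<open>u \<noteq> w\<close> by (cases xs; cases "tl xs") auto
  have "v \<notin> set xs" using low assms(4) by fastforce
  moreover have "successively (\<lambda>a b. (a, b) \<in> H) xs"
    using xs(5) by (rule successively_mono) (auto simp: R_def)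
  moreover have "(w, v) \<in> H" using assms(3) symH by (auto dest: symD)
  ultimately have "is_cycle H (v # xs)"
    using xs assms(2) unfolding is_cycle_def ys by (auto simp: successively_Cons)
  then show False using assms(1) unfolding tree_def by blast
qed

text \<open>
  A walk inside \<open>e\<close> from \<open>v\<close> to the higher vertex \<open>p\<close> has to pass from distance \<open>n + 1\<close> to
  distance \<open>n\<close>, since distances change by at most one along an edge of \<open>H\<close>. The only vertex of \<open>e\<close>
  at distance \<open>n + 1\<close> is \<open>v\<close>, so this step is taken from \<open>v\<close>.
\<close>

lemma hyperedge_parent:
  assumes "tree H" "induced_connected H e" "inj_on (graph_dist H x) e"
    and "v \<in> e" "graph_dist H x v = Suc n" "p \<in> e" "graph_dist H x p \<le> n"
  shows "\<exists>w\<in>e. (v, w) \<in> H \<and> graph_dist H x w = n"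
proof -
  have "(v, p) \<in> (H \<inter> e \<times> e)\<^sup>*"
    using assms(2,4,6) unfolding induced_connected_def by blast
  then have "graph_dist H x p \<le> n \<Longrightarrow> ?thesis"
  proof (induction rule: rtrancl_induct)
    case base
    then show ?case using assms(5) by simp
  next
    case (step y z)
    show ?case
    proof (cases "graph_dist H x y \<le> n")
      case True
      then show ?thesis by (rule step.IH)
    next
      case False
      have "(z, y) \<in> H" using step.hyps(2) assms(1)
        unfolding tree_def graph_def by (auto dest: symD)
      then have *: "graph_dist H x y = Suc n" "graph_dist H x z = n"
        using graph_dist_step[OF assms(1), of z y x] False step.prems by auto
      then have "y = v" using inj_onD[OF assms(3), of y v] assms(4,5) step.hyps(2) by simp
      then show ?thesis using * step.hyps(2) by blast
    qed
  qed
  then show ?thesis using assms(7) by blast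
qed

text \<open>
  Follow \<open>c\<close> and \<open>f\<close> upwards from the common vertex \<open>q\<close>: as long as both continue, they pass
  through the same parents. The vertex \<open>t\<close> guarantees that \<open>f\<close> continues at least up to the level
  of \<open>p\<close>.
\<close>

lemma hyperedges_meet_in_path:
  assumes "tree H"
    and "induced_connected H c" "inj_on (graph_dist H x) c"
    and "induced_connected H f" "inj_on (graph_dist H x) f"
    and "q \<in> c" "q \<in> f" "p \<in> c" "graph_dist H x p \<le> graph_dist H x q"
    and "t \<in> f" "graph_dist H x t \<le> graph_dist H x p"
  shows "p \<in> f"
proof -
  have "\<exists>w\<in>c \<inter> f. graph_dist H x w = graph_dist H x p"
    using assms(9)
  proof (induction rule: inc_induct)
    case base
    then show ?case using assms(6,7) by blast
  next
    case (step n)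
    then obtain w where w: "w \<in> c" "w \<in> f" "graph_dist H x w = Suc n" by blast
    obtain v1 where "v1 \<in> c" "(w, v1) \<in> H" "graph_dist H x v1 = n"
      using hyperedge_parent[OF assms(1-3) w(1,3) assms(8) step.hyps(1)] by blast
    moreover obtain v2 where "v2 \<in> f" "(w, v2) \<in> H" "graph_dist H x v2 = n"
      using hyperedge_parent[OF assms(1,4,5) w(2,3) assms(10)] step.hyps(1) assms(11)
      by auto
    ultimately show ?case using tree_parent_unique[OF assms(1) _ _ w(3), of v1 v2] by auto
  qed
  then obtain w where "w \<in> c" "w \<in> f" "graph_dist H x w = graph_dist H x p" by blast
  then show ?thesis using inj_onD[OF assms(3), of w p] assms(8) by simp
qed


section \<open>Monomial ideals and their minimal generators\<close>

lemma poly_mapping_eq_sum_single: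
  "p = (\<Sum>u\<in>Poly_Mapping.keys p. Poly_Mapping.single u (Poly_Mapping.lookup p u))"
  by (rule poly_mapping_eqI)
    (auto simp: lookup_sum lookup_single when_def in_keys_iff)

lemma lookup_mult_single:
  fixes p :: "('v \<Rightarrow> nat) \<Rightarrow>\<^sub>0 'k::comm_ring_1"
  shows "Poly_Mapping.lookup (p * Poly_Mapping.single t c) w =
    (if t \<le> w then Poly_Mapping.lookup p (w - t) * c else 0)"
proof -
  have iff: "u + t = w \<longleftrightarrow> t \<le> w \<and> u = w - t" for u
  proof
    assume "u + t = w"
    then have "w z = u z + t z" for z by auto
    then show "t \<le> w \<and> u = w - t" by (simp add: le_fun_def fun_eq_iff)
  qed (auto simp: le_fun_def fun_eq_iff)
  have "p * Poly_Mapping.single t c =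
    (\<Sum>u\<in>Poly_Mapping.keys p. Poly_Mapping.single (u + t) (Poly_Mapping.lookup p u * c))"
    by (subst (1) poly_mapping_eq_sum_single[of p])
      (simp only: sum_distrib_right mult_single)
  then show ?thesis
    by (auto simp: lookup_sum lookup_single when_def iff in_keys_iff)
qed

lemma mem_monomial_ideal_iff:
  fixes p :: "('v, 'k::comm_ring_1) mpoly"
  shows "p \<in> ideal_gen (monomial ` B) \<longleftrightarrow> (\<forall>u\<in>Poly_Mapping.keys p. \<exists>b\<in>B. b \<le> u)"
proof -
  interpret module "(*) :: ('v, 'k) mpoly \<Rightarrow> ('v, 'k) mpoly \<Rightarrow> ('v, 'k) mpoly"
    by (rule module_mult)
  show ?thesis unfolding ideal_gen_def
  proof
    assume "p \<in> span (monomial ` B)"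
    then show "\<forall>u\<in>Poly_Mapping.keys p. \<exists>b\<in>B. b \<le> u"
    proof (induction rule: span_induct_alt)
      case (step c x y)
      then obtain b where b: "b \<in> B" "x = monomial b" by auto
      have "b \<le> u" if "u \<in> Poly_Mapping.keys (c * x)" for u
        using that unfolding b(2) monomial_def
        by (auto simp: in_keys_iff lookup_mult_single split: if_splits)
      then show ?case using step.IH b(1) keys_add[of "c * x" y] by blast
    qed simp
  next
    assume *: "\<forall>u\<in>Poly_Mapping.keys p. \<exists>b\<in>B. b \<le> u"
    have "Poly_Mapping.single u (Poly_Mapping.lookup p u) \<in> span (monomial ` B)"
      if u: "u \<in> Poly_Mapping.keys p" for u
    proof -
      obtain b where b: "b \<in> B" "b \<le> u" using * u by blast
      have "Poly_Mapping.single (u - b) (Poly_Mapping.lookup p u) * monomial b \<in> span (monomial ` B)"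
        using b by (intro span_scale span_base) auto
      moreover have "u - b + b = u" using b(2) by (auto simp: le_fun_def fun_eq_iff)
      ultimately show ?thesis by (simp add: monomial_def mult_single)
    qed
    then show "p \<in> span (monomial ` B)"
      by (subst poly_mapping_eq_sum_single[of p]) (rule span_sum)
  qed
qed

lemma monomial_mem_monomial_ideal_iff:
  "(monomial m :: ('v, 'k::comm_ring_1) mpoly) \<in> ideal_gen (monomial ` B) \<longleftrightarrow> (\<exists>b\<in>B. b \<le> m)"
  unfolding mem_monomial_ideal_iff by (simp add: monomial_def)

lemma min_gens_monomial_ideal:
  "min_gens (ideal_gen (monomial ` B) :: ('v, 'k::comm_ring_1) mpoly set) =
     {b\<in>B. \<forall>b'\<in>B. b' \<le> b \<longrightarrow> b' = b}"
proof (intro set_eqI iffI)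
  fix m assume "m \<in> min_gens (ideal_gen (monomial ` B) :: ('v, 'k) mpoly set)"
  then obtain b where b: "b \<in> B" "b \<le> m"
    and min: "\<And>m' b'. b' \<in> B \<Longrightarrow> b' \<le> m' \<Longrightarrow> m' \<le> m \<Longrightarrow> m' = m"
    unfolding min_gens_def monomial_mem_monomial_ideal_iff by blast
  have "b = m" using min[OF b(1)] b(2) by simp
  then show "m \<in> {b\<in>B. \<forall>b'\<in>B. b' \<le> b \<longrightarrow> b' = b}" using b(1) min by simp
next
  fix m assume m: "m \<in> {b\<in>B. \<forall>b'\<in>B. b' \<le> b \<longrightarrow> b' = b}"
  have "m' = m" if "b' \<in> B" "b' \<le> m'" "m' \<le> m" for m' b'
  proof -
    have "b' = m" using m that order_trans[OF that(2,3)] by blast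
    then show ?thesis using that by (intro order_antisym) simp_all
  qed
  then show "m \<in> min_gens (ideal_gen (monomial ` B) :: ('v, 'k) mpoly set)"
    using m unfolding min_gens_def monomial_mem_monomial_ideal_iff by blast
qed

lemma exists_min_gen_le:
  fixes I :: "('v, 'k::comm_ring_1) mpoly set"
  assumes "finite B" "I = ideal_gen (monomial ` B)" "b \<in> B"
  shows "\<exists>g\<in>min_gens I. g \<le> b"
proof -
  obtain g where g: "g \<in> {x\<in>B. x \<le> b}" "\<And>y. y \<in> {x\<in>B. x \<le> b} \<Longrightarrow> y \<le> g \<Longrightarrow> g = y"
    using finite_has_minimal[of "{x\<in>B. x \<le> b}"] assms by auto
  then have "g \<in> min_gens I" unfolding assms(2) min_gens_monomial_ideal
    by (auto dest: order_trans)
  then show ?thesis using g by auto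
qed

lemma mem_ideal_iff_min_gens:
  fixes I :: "('v, 'k::comm_ring_1) mpoly set"
  assumes "finite B" "I = ideal_gen (monomial ` B)"
  shows "p \<in> I \<longleftrightarrow> (\<forall>u\<in>Poly_Mapping.keys p. \<exists>g\<in>min_gens I. g \<le> u)"
proof -
  have "(\<exists>b\<in>B. b \<le> u) \<longleftrightarrow> (\<exists>g\<in>min_gens I. g \<le> u)" for u
  proof
    assume "\<exists>b\<in>B. b \<le> u"
    then show "\<exists>g\<in>min_gens I. g \<le> u"
      using exists_min_gen_le[OF assms] order_trans by metis
  next
    assume "\<exists>g\<in>min_gens I. g \<le> u"
    then show "\<exists>b\<in>B. b \<le> u" unfolding assms(2) min_gens_monomial_ideal by blast
  qed
  then show ?thesis using mem_monomial_ideal_iff[of p B] assms(2) by simp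
qed

definition edge_mon :: "'v set \<Rightarrow> 'v mon" where
  "edge_mon e = (\<lambda>x. if x \<in> e then 1 else 0)"

lemma edge_mon_le_iff: "edge_mon e \<le> edge_mon f \<longleftrightarrow> e \<subseteq> f"
  by (auto simp: edge_mon_def le_fun_def split: if_splits)

lemma edge_mon_eq_iff: "edge_mon e = edge_mon f \<longleftrightarrow> e = f"
  using edge_mon_le_iff[of e f] edge_mon_le_iff[of f e] by auto

lemma prod_var_eq_monomial:
  assumes "finite e"
  shows "(\<Prod>x\<in>e. var x) = (monomial (edge_mon e) :: ('v, 'k::comm_ring_1) mpoly)"
  using assms
proof induction
  case empty
  then show ?case by (simp add: monomial_def edge_mon_def flip: zero_fun_def)
next
  case (insert y e)
  have "(\<lambda>z. if z = y then 1 else 0) + edge_mon e = edge_mon (insert y e)"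
    using insert.hyps by (auto simp: edge_mon_def fun_eq_iff)
  then show ?case using insert by (simp add: var_def monomial_def mult_single)
qed

lemma edge_ideal_eq:
  fixes E :: "'v::finite set set"
  shows "edge_ideal E = (ideal_gen (monomial ` edge_mon ` E) :: ('v, 'k::comm_ring_1) mpoly set)"
  unfolding edge_ideal_def by (simp add: prod_var_eq_monomial image_image)

lemma min_gens_edge_ideal:
  fixes E :: "'v::finite set set"
  assumes "simple_hypergraph E"
  shows "min_gens (edge_ideal E :: ('v, 'k::comm_ring_1) mpoly set) = edge_mon ` E"
  unfolding edge_ideal_eq min_gens_monomial_ideal
  using assms unfolding simple_hypergraph_def by (auto simp: edge_mon_le_iff edge_mon_eq_iff)

lemma single_mem_max_ideal:
  assumes "t \<noteq> 0"
  shows "(Poly_Mapping.single t c :: ('v, 'k::comm_ring_1) mpoly) \<in> max_ideal"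
proof -
  obtain x where x: "t x \<noteq> 0" using assms by (auto simp: fun_eq_iff)
  define B :: "'v mon set" where "B = range (\<lambda>x y. if y = x then 1 else 0)"
  have "range var = (monomial ` B :: ('v, 'k) mpoly set)"
    unfolding B_def image_image var_def ..
  then have "max_ideal = (ideal_gen (monomial ` B) :: ('v, 'k) mpoly set)"
    unfolding max_ideal_def by simp
  moreover have "\<exists>b\<in>B. b \<le> t"
    unfolding B_def using x by (intro bexI[of _ "\<lambda>y. if y = x then 1 else 0"]) (auto simp: le_fun_def)
  then have "Poly_Mapping.single t c \<in> (ideal_gen (monomial ` B) :: ('v, 'k) mpoly set)"
    unfolding mem_monomial_ideal_iff by simp
  ultimately show ?thesis by (simp only:)
qed

text \<open>
  The shape in which the Morse differential presents its coordinates.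
\<close>

lemma max_ideal_sum_mult:
  assumes "\<And>i. i \<in> J \<Longrightarrow> b i \<in> max_ideal"
  shows "(\<Sum>i\<in>J. a i * b i) \<in> (max_ideal :: ('v, 'k::comm_ring_1) mpoly set)"
proof -
  interpret module "(*) :: ('v, 'k) mpoly \<Rightarrow> ('v, 'k) mpoly \<Rightarrow> ('v, 'k) mpoly"
    by (rule module_mult)
  show ?thesis using assms unfolding max_ideal_def ideal_gen_def
    by (intro span_sum span_scale) auto
qed


section \<open>Bridges, gaps and potentially-type-2 sets\<close>

lemma le_lcm_mon_apply_iff:
  assumes "finite \<sigma>"
  shows "n \<le> lcm_mon \<sigma> x \<longleftrightarrow> n = 0 \<or> (\<exists>m\<in>\<sigma>. n \<le> m x)"
  using assms by (auto simp: lcm_mon_def Max_ge_iff)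

lemma lcm_mon_le_iff:
  assumes "finite \<sigma>"
  shows "lcm_mon \<sigma> \<le> u \<longleftrightarrow> (\<forall>m\<in>\<sigma>. m \<le> u)"
  using assms by (auto simp: lcm_mon_def le_fun_def)

lemma le_lcm_mon: "finite \<sigma> \<Longrightarrow> m \<in> \<sigma> \<Longrightarrow> m \<le> lcm_mon \<sigma>"
  using lcm_mon_le_iff by blast

lemma lcm_mon_mono: "finite \<sigma>' \<Longrightarrow> \<sigma> \<subseteq> \<sigma>' \<Longrightarrow> lcm_mon \<sigma> \<le> lcm_mon \<sigma>'"
  using lcm_mon_le_iff[of \<sigma>] le_lcm_mon[of \<sigma>'] finite_subset by blast

lemma lcm_mon_insert_eq_iff:
  assumes "finite \<sigma>"
  shows "lcm_mon (insert m \<sigma>) = lcm_mon \<sigma> \<longleftrightarrow> m \<le> lcm_mon \<sigma>"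
proof
  assume "m \<le> lcm_mon \<sigma>"
  then have "lcm_mon (insert m \<sigma>) \<le> lcm_mon \<sigma>"
    using assms le_lcm_mon[of \<sigma>] by (subst lcm_mon_le_iff) auto
  moreover have "lcm_mon \<sigma> \<le> lcm_mon (insert m \<sigma>)"
    using assms by (intro lcm_mon_mono) auto
  ultimately show "lcm_mon (insert m \<sigma>) = lcm_mon \<sigma>" by (rule order_antisym)
qed (use assms le_lcm_mon[of "insert m \<sigma>" m] in auto)

lemma mem_bridges_iff:
  assumes "finite \<sigma>"
  shows "m \<in> bridges \<sigma> \<longleftrightarrow> m \<in> \<sigma> \<and> m \<le> lcm_mon (\<sigma> - {m})"
  using lcm_mon_insert_eq_iff[of "\<sigma> - {m}" m] assms
  by (auto simp: bridges_def insert_absorb)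

lemma bridges_mono:
  assumes "finite \<sigma>'" "\<sigma> \<subseteq> \<sigma>'"
  shows "bridges \<sigma> \<subseteq> bridges \<sigma>'"
proof
  fix m assume "m \<in> bridges \<sigma>"
  moreover have "lcm_mon (\<sigma> - {m}) \<le> lcm_mon (\<sigma>' - {m})"
    using assms by (intro lcm_mon_mono) auto
  ultimately show "m \<in> bridges \<sigma>'"
    using assms finite_subset[OF assms(2,1)] by (auto simp: mem_bridges_iff)
qed

lemma mem_gaps_iff:
  assumes "finite \<sigma>"
  shows "m \<in> gaps G \<sigma> \<longleftrightarrow> m \<in> G \<and> m \<notin> \<sigma> \<and> m \<le> lcm_mon \<sigma>"
  using lcm_mon_insert_eq_iff[of \<sigma> m] assms by (auto simp: gaps_def)

locale ordered_gens =
  fixes G :: "'v mon set" and r :: "('v mon \<times> 'v mon) set"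
  assumes finite_gens: "finite G" and dom_linear: "strict_linear_order_on G r"
begin

lemma finite_gens_subset: "\<sigma> \<subseteq> G \<Longrightarrow> finite \<sigma>"
  using finite_gens finite_subset by blast

lemma dom_trans: "(a, b) \<in> r \<Longrightarrow> (b, c) \<in> r \<Longrightarrow> (a, c) \<in> r"
  using dom_linear unfolding strict_linear_order_on_def by (blast dest: transD)

lemma dom_irrefl: "(a, a) \<notin> r"
  using dom_linear unfolding strict_linear_order_on_def irrefl_def by blast

lemma dom_asym: "(a, b) \<in> r \<Longrightarrow> (b, a) \<notin> r"
  using dom_trans dom_irrefl by blast

lemma dom_total: "a \<in> G \<Longrightarrow> b \<in> G \<Longrightarrow> a = b \<or> (a, b) \<in> r \<or> (b, a) \<in> r"
  using dom_linear unfolding strict_linear_order_on_def total_on_def by blast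

lemma ex_smallest:
  assumes "S \<subseteq> G" "S \<noteq> {}"
  shows "\<exists>m\<in>S. \<forall>m'\<in>S. m' \<noteq> m \<longrightarrow> (m', m) \<in> r"
  using finite_gens_subset[OF assms(1)] assms(2,1)
proof (induction rule: finite_ne_induct)
  case (insert a S)
  then obtain m where m: "m \<in> S" "\<forall>m'\<in>S. m' \<noteq> m \<longrightarrow> (m', m) \<in> r" by auto
  then consider "(a, m) \<in> r" | "(m, a) \<in> r"
    using dom_total[of a m] insert by blast
  then show ?case
  proof cases
    case 2
    then have "\<forall>m'\<in>S. (m', a) \<in> r" using m dom_trans by metis
    then show ?thesis by blast
  qed (use m in blast)
qed simp

lemma bridges_subset_gens: "\<sigma> \<subseteq> G \<Longrightarrow> bridges \<sigma> \<subseteq> G"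
  unfolding bridges_def by blast

lemma sb_eq_Some_iff:
  assumes "\<sigma> \<subseteq> G"
  shows "sb r \<sigma> = Some m \<longleftrightarrow> m \<in> bridges \<sigma> \<and> (\<forall>m'\<in>bridges \<sigma>. m' \<noteq> m \<longrightarrow> (m', m) \<in> r)"
proof -
  let ?P = "\<lambda>m. m \<in> bridges \<sigma> \<and> (\<forall>m'\<in>bridges \<sigma>. m' \<noteq> m \<longrightarrow> (m', m) \<in> r)"
  have uniq: "m = m'" if "?P m" "?P m'" for m m' using that dom_asym by metis
  show ?thesis
  proof (cases "bridges \<sigma> = {}")
    case False
    then obtain s where s: "?P s" using ex_smallest[OF bridges_subset_gens[OF assms]] by blast
    then have "(THE m. ?P m) = s" using uniq by (intro the_equality) blast+
    then show ?thesis using False s uniq unfolding sb_def by auto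
  qed (simp add: sb_def)
qed

lemma sb_eq_None_iff: "sb r \<sigma> = None \<longleftrightarrow> bridges \<sigma> = {}"
  by (simp add: sb_def)

text \<open>
  The sets that collapse onto \<open>\<sigma>\<close> by losing their smallest bridge are described by the true gaps
  of \<open>\<sigma>\<close>: a bridge of \<open>\<sigma> \<union> {g}\<close> below \<open>g\<close> would be an old bridge if \<open>g\<close> is a true gap, and old
  bridges stay bridges when \<open>g\<close> is added.
\<close>

lemma sb_insert_eq_iff:
  assumes "\<sigma> \<subseteq> G" "g \<in> G" "g \<notin> \<sigma>"
  shows "sb r (insert g \<sigma>) = Some g \<longleftrightarrow>
    g \<in> true_gaps r G \<sigma> \<and> (\<forall>m\<in>bridges \<sigma>. (m, g) \<in> r)"
proof -
  have fin: "finite \<sigma>" "finite (insert g \<sigma>)" using assms(1) finite_gens_subset by auto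
  have sub: "insert g \<sigma> \<subseteq> G" using assms by blast
  have gap: "g \<in> bridges (insert g \<sigma>) \<longleftrightarrow> g \<in> gaps G \<sigma>"
    using assms fin by (auto simp: mem_bridges_iff mem_gaps_iff)
  have "m \<in> bridges (insert g \<sigma>)" "m \<noteq> g" if "m \<in> bridges \<sigma>" for m
    using that bridges_mono[OF fin(2)] assms(3) by (auto simp: bridges_def)
  then show ?thesis
    unfolding sb_eq_Some_iff[OF sub] gap true_gaps_def
    using dom_total[OF assms(2)] dom_asym bridges_subset_gens[OF sub]
    by simp (metis dom_irrefl subsetD)
qed

text \<open>
  Potentially-type-2 sets are the sets with a bridge that are not the target \<open>\<sigma>' - {sb \<sigma>'}\<close> of a
  larger set. If every bridge dominates some true gap, then a true gap \<open>g\<close> dominated by the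
  smallest bridge is dominated by all of them, and \<open>\<sigma> \<union> {g}\<close> collapses onto \<open>\<sigma>\<close>.
\<close>

lemma potentially_type2_iff:
  assumes "\<sigma> \<subseteq> G"
  shows "potentially_type2 r G \<sigma> \<longleftrightarrow>
    bridges \<sigma> \<noteq> {} \<and> (\<forall>g\<in>G - \<sigma>. sb r (insert g \<sigma>) \<noteq> Some g)"
proof
  assume "potentially_type2 r G \<sigma>"
  then show "bridges \<sigma> \<noteq> {} \<and> (\<forall>g\<in>G - \<sigma>. sb r (insert g \<sigma>) \<noteq> Some g)"
    using sb_insert_eq_iff[OF assms] unfolding potentially_type2_def by blast
next
  assume R: "bridges \<sigma> \<noteq> {} \<and> (\<forall>g\<in>G - \<sigma>. sb r (insert g \<sigma>) \<noteq> Some g)"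
  then obtain s where s: "s \<in> bridges \<sigma>" "\<forall>m\<in>bridges \<sigma>. m \<noteq> s \<longrightarrow> (m, s) \<in> r"
    using ex_smallest[OF bridges_subset_gens[OF assms]] by blast
  have "(s, g) \<notin> r" if g: "g \<in> true_gaps r G \<sigma>" for g
  proof
    assume "(s, g) \<in> r"
    then have "\<forall>m\<in>bridges \<sigma>. (m, g) \<in> r" using s dom_trans by metis
    moreover have "g \<in> G - \<sigma>" using g unfolding true_gaps_def gaps_def by blast
    ultimately show False using R g sb_insert_eq_iff[OF assms] by blast
  qed
  then show "potentially_type2 r G \<sigma>" using s(1) unfolding potentially_type2_def by blast
qed

text \<open>
  Among all \<open>g\<close> for which \<open>\<sigma> \<union> {g}\<close> collapses onto \<open>\<sigma>\<close> take the smallest. If \<open>\<sigma> \<union> {g}\<close> were itself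
  the target of some \<open>\<sigma> \<union> {g, h}\<close>, then \<open>h\<close> would be smaller than the bridge \<open>g\<close>, and \<open>\<sigma> \<union> {h}\<close>
  would collapse onto \<open>\<sigma>\<close> as well.
\<close>

lemma target_of_potentially_type2:
  assumes "\<sigma> \<subseteq> G" "bridges \<sigma> \<noteq> {}" "\<not> potentially_type2 r G \<sigma>"
  shows "\<exists>\<sigma>'\<subseteq>G. potentially_type2 r G \<sigma>' \<and> remove_sb r \<sigma>' = \<sigma>"
proof -
  have fin: "finite \<sigma>" by (rule finite_gens_subset[OF assms(1)])
  define S where "S = {g\<in>G - \<sigma>. sb r (insert g \<sigma>) = Some g}"
  have "S \<noteq> {}" using assms potentially_type2_iff unfolding S_def by blast
  then obtain g where g: "g \<in> S" "\<forall>h\<in>S. h \<noteq> g \<longrightarrow> (h, g) \<in> r"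
    using ex_smallest[of S] unfolding S_def by blast
  then have gG: "g \<in> G" "g \<notin> \<sigma>" "sb r (insert g \<sigma>) = Some g" unfolding S_def by auto
  have sub: "insert g \<sigma> \<subseteq> G" using assms(1) gG by blast
  have bg: "g \<in> bridges (insert g \<sigma>)" using gG(3) sb_eq_Some_iff[OF sub] by blast
  then have leg: "g \<le> lcm_mon \<sigma>" using fin gG(2) by (auto simp: mem_bridges_iff)
  have "sb r (insert h (insert g \<sigma>)) \<noteq> Some h" if h: "h \<in> G - insert g \<sigma>" for h
  proof
    assume sbh: "sb r (insert h (insert g \<sigma>)) = Some h"
    have subh: "insert h (insert g \<sigma>) \<subseteq> G" "insert h \<sigma> \<subseteq> G" using h sub by auto
    have least: "m = h \<or> (m, h) \<in> r" if "m \<in> bridges (insert h (insert g \<sigma>))" for m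
      using sbh that sb_eq_Some_iff[OF subh(1)] by blast
    have "h \<in> bridges (insert h (insert g \<sigma>))" using sbh sb_eq_Some_iff[OF subh(1)] by blast
    then have "h \<le> lcm_mon (insert g \<sigma>)" using h fin by (auto simp: mem_bridges_iff)
    then have "h \<le> lcm_mon \<sigma>" using leg lcm_mon_insert_eq_iff[OF fin, of g] by simp
    then have "h \<in> bridges (insert h \<sigma>)" using h fin by (auto simp: mem_bridges_iff)
    moreover have mono: "bridges (insert h \<sigma>) \<subseteq> bridges (insert h (insert g \<sigma>))"
      using fin by (intro bridges_mono) auto
    ultimately have "sb r (insert h \<sigma>) = Some h"
      unfolding sb_eq_Some_iff[OF subh(2)] using least by blast
    then have "h \<in> S" using h unfolding S_def by blast
    then have "(h, g) \<in> r" using g(2) h by blast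
    moreover have "g \<in> bridges (insert h (insert g \<sigma>))"
      using bg bridges_mono[of "insert h (insert g \<sigma>)" "insert g \<sigma>"] fin by blast
    then have "(g, h) \<in> r" using least h by blast
    ultimately show False using dom_asym by blast
  qed
  then have "potentially_type2 r G (insert g \<sigma>)"
    unfolding potentially_type2_iff[OF sub] using bg by blast
  moreover have "remove_sb r (insert g \<sigma>) = \<sigma>" using gG by (simp add: remove_sb_def)
  ultimately show ?thesis using sub by blast
qed

lemma potentially_type2_not_target:
  assumes "\<sigma> \<subseteq> G" "\<sigma>' \<subseteq> G" "potentially_type2 r G \<sigma>" "remove_sb r \<sigma>' = \<sigma>"
  shows "bridges \<sigma>' = {}"
proof (rule ccontr)
  assume "bridges \<sigma>' \<noteq> {}"
  then obtain s where s: "sb r \<sigma>' = Some s" using sb_eq_None_iff by (cases "sb r \<sigma>'") auto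
  then have "s \<in> \<sigma>'" using sb_eq_Some_iff[OF assms(2)] unfolding bridges_def by blast
  moreover have "\<sigma> = \<sigma>' - {s}" using assms(4) s by (simp add: remove_sb_def)
  ultimately have "s \<in> G - \<sigma>" "insert s \<sigma> = \<sigma>'" using assms(2) by auto
  then show False using s assms(3) potentially_type2_iff[OF assms(1)] by blast
qed

text \<open>
  The hypothesis forbids a generator \<open>c\<close>, smaller than \<open>b\<close> and \<open>a\<close>, to divide the lcm of
  \<open>\<rho> \<union> {a, b}\<close> without dividing that of \<open>\<rho> \<union> {a}\<close> or of \<open>\<rho> \<union> {b}\<close>. Such a \<open>c\<close> is what two
  potentially-type-2 sets \<open>\<tau> \<union> {a}\<close> and \<open>\<tau> \<union> {b}\<close> with smallest bridges \<open>a \<succ> b\<close> produce: it is the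
  bridge that prevents the gap \<open>b\<close> of \<open>\<tau> \<union> {a}\<close> from being a true gap, and it is not a bridge of
  \<open>\<tau> \<union> {b}\<close>, whose smallest bridge is \<open>b\<close>.
\<close>

lemma bridge_friendly_criterion:
  assumes separated: "\<And>a b c \<rho>. a \<in> G \<Longrightarrow> b \<in> G \<Longrightarrow> c \<in> G \<Longrightarrow> \<rho> \<subseteq> G \<Longrightarrow>
      (a, b) \<in> r \<Longrightarrow> (b, c) \<in> r \<Longrightarrow> c \<le> lcm_mon (insert a (insert b \<rho>)) \<Longrightarrow>
      c \<le> lcm_mon (insert a \<rho>) \<or> c \<le> lcm_mon (insert b \<rho>)"
    and "\<sigma> \<subseteq> G" "potentially_type2 r G \<sigma>"
  shows "type2 r G \<sigma>"
proof -
  have no_pair: False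
    if sub: "insert a \<tau> \<subseteq> G" "insert b \<tau> \<subseteq> G" and new: "a \<notin> \<tau>" "b \<notin> \<tau>"
      and sba: "sb r (insert a \<tau>) = Some a" and sbb: "sb r (insert b \<tau>) = Some b"
      and pt: "potentially_type2 r G (insert a \<tau>)" and ab: "(a, b) \<in> r" for a b \<tau>
  proof -
    have fin: "finite \<tau>" using sub(1) finite_gens_subset by auto
    have "a \<noteq> b" using ab dom_irrefl by blast
    have "b \<in> bridges (insert b \<tau>)" using sbb sb_eq_Some_iff[OF sub(2)] by blast
    then have "b \<le> lcm_mon \<tau>" using fin new(2) by (auto simp: mem_bridges_iff)
    also have "\<dots> \<le> lcm_mon (insert a \<tau>)" using fin by (intro lcm_mon_mono) auto
    finally have gap: "b \<in> gaps G (insert a \<tau>)"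
      using sub new \<open>a \<noteq> b\<close> fin by (auto simp: mem_gaps_iff)
    obtain m where m: "m \<in> bridges (insert a \<tau>)"
      "\<forall>g\<in>true_gaps r G (insert a \<tau>). (m, g) \<notin> r"
      using pt unfolding potentially_type2_def by blast
    have "m = a \<or> (m, a) \<in> r" using m(1) sba sb_eq_Some_iff[OF sub(1)] by blast
    then have "(m, b) \<in> r" using ab dom_trans by blast
    then have "b \<notin> true_gaps r G (insert a \<tau>)" using m(2) by blast
    then obtain c where c: "c \<in> bridges (insert b (insert a \<tau>))" "(b, c) \<in> r"
      "c \<notin> bridges (insert a \<tau>)"
      using gap unfolding true_gaps_def by auto
    have ne: "c \<noteq> a" "c \<noteq> b" using c(2) ab dom_asym dom_irrefl by blast+
    then have "c \<in> \<tau>" using c(1) unfolding bridges_def by blast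
    have "c \<notin> bridges (insert b \<tau>)"
      using c(2) ne sbb sb_eq_Some_iff[OF sub(2)] dom_asym by blast
    moreover have rem: "insert b (insert a \<tau>) - {c} = insert a (insert b (\<tau> - {c}))"
      "insert a \<tau> - {c} = insert a (\<tau> - {c})" "insert b \<tau> - {c} = insert b (\<tau> - {c})"
      using ne by auto
    ultimately show False
      using separated[of a b c "\<tau> - {c}"] c ab sub \<open>c \<in> \<tau>\<close> fin
      by (auto simp: mem_bridges_iff rem)
  qed
  have "\<sigma>' = \<sigma>" if \<sigma>': "\<sigma>' \<subseteq> G" "potentially_type2 r G \<sigma>'" "remove_sb r \<sigma>' = remove_sb r \<sigma>" for \<sigma>'
  proof (rule ccontr)
    assume ne: "\<sigma>' \<noteq> \<sigma>"
    have split: "\<exists>a \<tau>. a \<notin> \<tau> \<and> \<rho> = insert a \<tau> \<and> sb r \<rho> = Some a \<and> remove_sb r \<rho> = \<tau>"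
      if \<rho>: "\<rho> \<subseteq> G" "potentially_type2 r G \<rho>" for \<rho>
    proof -
      obtain s where s: "sb r \<rho> = Some s"
        using \<rho>(2) sb_eq_None_iff unfolding potentially_type2_def by (cases "sb r \<rho>") auto
      then have "s \<in> \<rho>" using sb_eq_Some_iff[OF \<rho>(1)] unfolding bridges_def by blast
      then show ?thesis using s by (intro exI[of _ s] exI[of _ "\<rho> - {s}"]) (auto simp: remove_sb_def)
    qed
    obtain a \<tau> where a: "a \<notin> \<tau>" "\<sigma> = insert a \<tau>" "sb r \<sigma> = Some a" "remove_sb r \<sigma> = \<tau>"
      using split[OF assms(2,3)] by blast
    obtain b where b: "b \<notin> \<tau>" "\<sigma>' = insert b \<tau>" "sb r \<sigma>' = Some b"
      using split[OF \<sigma>'(1,2)] \<sigma>'(3) a(4) by blast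
    have "a \<noteq> b" using ne a(2) b(2) by blast
    then consider "(a, b) \<in> r" | "(b, a) \<in> r"
      using dom_total[of a b] assms(2) \<sigma>'(1) a(2) b(2) by blast
    then show False
      using no_pair[of a \<tau> b] no_pair[of b \<tau> a] assms(2,3) \<sigma>'(1,2) a b by cases auto
  qed
  then show ?thesis using assms(3) unfolding type2_def by blast
qed

end


section \<open>Bridge-friendliness of edge ideals of rooted hypertrees\<close>

text \<open>
  The order compares the distances from the root to the nearest vertex of an edge; a smaller
  distance dominates.
\<close>

lemma bridge_friendly_edge_ideal:
  fixes E :: "'v::finite set set"
  assumes "rooted_hypertree E"
  shows "bridge_friendly (edge_ideal E :: ('v, 'k::comm_ring_1) mpoly set)"
proof -
  obtain x H where simple: "simple_hypergraph E" and host: "host_graph E H" and "tree H"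
    and inj: "\<And>e. e \<in> E \<Longrightarrow> inj_on (graph_dist H x) e"
    using assms unfolding rooted_hypertree_def hypertree_rooted_at_def by blast
  have conn: "induced_connected H e" if "e \<in> E" for e
    using host that unfolding host_graph_def by blast
  define G where "G = edge_mon ` E"
  define top where "top m = Min (graph_dist H x ` {y. m y \<noteq> (0::nat)})" for m
  have finG: "finite G" unfolding G_def by simp
  obtain idx :: "'v mon \<Rightarrow> nat" where idx: "inj_on idx G"
    using finite_imp_inj_to_nat_seg[OF finG] by blast
  \<comment> \<open>The injection \<open>idx\<close> only serves to break ties between edges with equally high tops.\<close>
  define r where "r = {(a, b). top a < top b \<or> top a = top b \<and> idx a < idx b}"
  have "strict_linear_order_on G r"
    unfolding strict_linear_order_on_def trans_def irrefl_def total_on_def r_def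
    using inj_onD[OF idx] by auto (metis linorder_neqE_nat)
  then interpret ordered_gens G r using finG by unfold_locales
  have top_le: "top (edge_mon e) \<le> graph_dist H x y" if "y \<in> e" for e y
    unfolding top_def using that by (intro Min_le) (auto simp: edge_mon_def)
  have top_attained: "\<exists>t\<in>e. graph_dist H x t = top (edge_mon e)" if "e \<in> E" for e
  proof -
    have "e \<noteq> {}" using conn[OF that] unfolding induced_connected_def by blast
    then have "Min (graph_dist H x ` e) \<in> graph_dist H x ` e" by (intro Min_in) auto
    moreover have "{y. edge_mon e y \<noteq> 0} = e" by (auto simp: edge_mon_def)
    ultimately show ?thesis unfolding top_def by auto
  qed
  have absorb: "p \<in> f"
    if cf: "c \<in> E" "f \<in> E" "(edge_mon f, edge_mon c) \<in> r" "q \<in> c" "q \<in> f" "p \<in> c"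
      "graph_dist H x p \<le> graph_dist H x q" for c f p q
  proof -
    obtain t where t: "t \<in> f" "graph_dist H x t = top (edge_mon f)"
      using top_attained cf(2) by blast
    have "top (edge_mon f) \<le> top (edge_mon c)" using cf(3) unfolding r_def by auto
    then have "graph_dist H x t \<le> graph_dist H x p" using t(2) top_le[OF cf(6)] by simp
    then show ?thesis
      using hyperedges_meet_in_path[OF \<open>tree H\<close> conn inj conn inj, of c f q p t] cf t(1) by blast
  qed
  have separated: "c \<le> lcm_mon (insert a \<rho>) \<or> c \<le> lcm_mon (insert b \<rho>)"
    if "a \<in> G" "b \<in> G" "c \<in> G" "\<rho> \<subseteq> G" and ab: "(a, b) \<in> r" and bc: "(b, c) \<in> r"
      and cov: "c \<le> lcm_mon (insert a (insert b \<rho>))" for a b c \<rho>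
  proof (rule ccontr)
    assume "\<not> ?thesis"
    then obtain p q where p: "\<not> c p \<le> lcm_mon (insert a \<rho>) p"
      and q: "\<not> c q \<le> lcm_mon (insert b \<rho>) q" by (auto simp: le_fun_def)
    have fin: "finite \<rho>" using finite_gens_subset \<open>\<rho> \<subseteq> G\<close> by blast
    obtain e f g where efg: "e \<in> E" "f \<in> E" "g \<in> E" "a = edge_mon e" "b = edge_mon f"
      "c = edge_mon g" using \<open>a \<in> G\<close> \<open>b \<in> G\<close> \<open>c \<in> G\<close> unfolding G_def by blast
    have "c p \<le> lcm_mon (insert a (insert b \<rho>)) p" "c q \<le> lcm_mon (insert a (insert b \<rho>)) q"
      using cov by (auto simp: le_fun_def)
    \<comment> \<open>The vertex \<open>p\<close> of \<open>c\<close> is covered by \<open>b\<close> alone, the vertex \<open>q\<close> by \<open>a\<close> alone.\<close>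
    then have "\<not> c p \<le> a p" "0 < c p" "c p \<le> b p" "\<not> c q \<le> b q" "0 < c q" "c q \<le> a q"
      using p q fin by (auto simp: le_lcm_mon_apply_iff)
    then have mem: "p \<in> g" "p \<in> f" "p \<notin> e" "q \<in> g" "q \<in> e" "q \<notin> f"
      unfolding efg by (auto simp: edge_mon_def split: if_splits)
    have "(a, c) \<in> r" using dom_trans ab bc by blast
    then show False
      using absorb[of g e q p] absorb[of g f p q] bc mem efg(1-3)
      unfolding efg(4-6)
      by (cases "graph_dist H x p \<le> graph_dist H x q") auto
  qed
  have "type2 r G \<sigma>" if "\<sigma> \<subseteq> G" "potentially_type2 r G \<sigma>" for \<sigma>
    by (rule bridge_friendly_criterion[OF _ that]) (rule separated)
  then show ?thesis
    unfolding bridge_friendly_def min_gens_edge_ideal[OF simple] G_def[symmetric]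
    using dom_linear by blast
qed


section \<open>The Barile-Macchia matching of a bridge-friendly ideal\<close>

lemma (in ordered_gens) taylor_edges_iff:
  "(\<sigma>, \<tau>) \<in> taylor_edges G \<longleftrightarrow> \<sigma> \<subseteq> G \<and> (\<exists>m\<in>\<sigma>. \<tau> = \<sigma> - {m})"
proof
  assume "(\<sigma>, \<tau>) \<in> taylor_edges G"
  then have \<sigma>: "\<sigma> \<subseteq> G" "\<tau> \<subset> \<sigma>" "card \<sigma> = Suc (card \<tau>)" unfolding taylor_edges_def by auto
  then have "card (\<sigma> - \<tau>) = 1"
    using card_Diff_subset[of \<tau> \<sigma>] finite_subset[OF _ finite_gens_subset[of \<sigma>]] by auto
  then obtain m where "\<sigma> - \<tau> = {m}" by (auto simp: card_1_singleton_iff)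
  then have "m \<in> \<sigma>" "\<tau> = \<sigma> - {m}" using \<sigma>(2) by auto
  then show "\<sigma> \<subseteq> G \<and> (\<exists>m\<in>\<sigma>. \<tau> = \<sigma> - {m})" using \<sigma>(1) by blast
next
  assume "\<sigma> \<subseteq> G \<and> (\<exists>m\<in>\<sigma>. \<tau> = \<sigma> - {m})"
  then obtain m where "\<sigma> \<subseteq> G" "m \<in> \<sigma>" "\<tau> = \<sigma> - {m}" by blast
  then show "(\<sigma>, \<tau>) \<in> taylor_edges G"
    using card.remove[OF finite_gens_subset, of \<sigma> m] unfolding taylor_edges_def by auto
qed

text \<open>
  The generators of a proper monomial ideal together with an order witnessing bridge-friendliness.
\<close>

locale bridge_friendly_gens = ordered_gens G r for G :: "'v mon set" and r +
  assumes nonunit: "0 \<notin> G"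
    and antichain: "\<And>a b. a \<in> G \<Longrightarrow> b \<in> G \<Longrightarrow> a \<le> b \<Longrightarrow> a = b"
    and friendly: "\<And>\<sigma>. \<sigma> \<subseteq> G \<Longrightarrow> potentially_type2 r G \<sigma> \<Longrightarrow> type2 r G \<sigma>"
begin

definition bm_edges :: "'v edges" where
  "bm_edges = {(\<sigma>, remove_sb r \<sigma>) | \<sigma>. \<sigma> \<subseteq> G \<and> potentially_type2 r G \<sigma>}"

text \<open>
  Sets with a bridge always take part in the algorithm, which looks only at sets of cardinality at
  least three: one further element cannot cover all of a bridge, because different minimal
  generators do not divide each other, and the empty set could cover only the monomial 1.
\<close>

lemma three_le_card:
  assumes "\<sigma> \<subseteq> G" "bridges \<sigma> \<noteq> {}"
  shows "3 \<le> card \<sigma>"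
proof -
  have fin: "finite \<sigma>" by (rule finite_gens_subset[OF assms(1)])
  obtain m where "m \<in> bridges \<sigma>" using assms(2) by blast
  then have m: "m \<in> \<sigma>" "m \<le> lcm_mon (\<sigma> - {m})" using fin by (auto simp: mem_bridges_iff)
  have "m \<noteq> 0" using m(1) assms(1) nonunit by blast
  then obtain x where "m x \<noteq> 0" by (auto simp: fun_eq_iff)
  moreover have "m x \<le> lcm_mon (\<sigma> - {m}) x" using m(2) by (rule le_funD)
  ultimately obtain n where n: "n \<in> \<sigma> - {m}" using fin by (auto simp: le_lcm_mon_apply_iff)
  have "\<sigma> - {m} \<noteq> {n}"
  proof
    assume eq: "\<sigma> - {m} = {n}"
    have "lcm_mon {n} \<le> n" by (simp add: lcm_mon_le_iff)
    then have "m \<le> n" using m(2) eq by auto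
    then show False using antichain[of m n] m(1) n assms(1) by blast
  qed
  then obtain n' where "n' \<in> \<sigma>" "n' \<noteq> m" "n' \<noteq> n" using n by blast
  then have "card {m, n, n'} = 3" "{m, n, n'} \<subseteq> \<sigma>" using n m(1) by auto
  then show ?thesis using card_mono[OF fin] by metis
qed

lemma potentially_type2_sb:
  assumes "\<sigma> \<subseteq> G" "potentially_type2 r G \<sigma>"
  obtains s where "sb r \<sigma> = Some s" "s \<in> \<sigma>" "remove_sb r \<sigma> = \<sigma> - {s}"
    "lcm_mon (\<sigma> - {s}) = lcm_mon \<sigma>"
    "\<And>m. m \<in> bridges \<sigma> \<Longrightarrow> m \<noteq> s \<Longrightarrow> (m, s) \<in> r"
proof -
  obtain s where s: "sb r \<sigma> = Some s"
    using assms(2) sb_eq_None_iff unfolding potentially_type2_def by (cases "sb r \<sigma>") auto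
  then have "s \<in> bridges \<sigma>" "\<forall>m\<in>bridges \<sigma>. m \<noteq> s \<longrightarrow> (m, s) \<in> r"
    unfolding sb_eq_Some_iff[OF assms(1)] by auto
  then show ?thesis using s by (intro that[of s]) (auto simp: bridges_def remove_sb_def)
qed

lemma bm_edges_inj:
  assumes "(\<sigma>, \<tau>) \<in> bm_edges" "(\<sigma>', \<tau>) \<in> bm_edges"
  shows "\<sigma> = \<sigma>'"
proof (rule ccontr)
  assume "\<sigma> \<noteq> \<sigma>'"
  moreover have *: "\<sigma> \<subseteq> G" "\<sigma>' \<subseteq> G" "type2 r G \<sigma>" "type2 r G \<sigma>'" "remove_sb r \<sigma> = remove_sb r \<sigma>'"
    using assms friendly unfolding bm_edges_def by auto
  ultimately have "sb_succ r \<sigma> \<sigma>'" "sb_succ r \<sigma>' \<sigma>" unfolding type2_def by metis+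
  then show False unfolding sb_succ_def using dom_asym by auto
qed

lemma bm_edges_not_source_and_target:
  assumes "(\<sigma>, \<tau>) \<in> bm_edges" "(\<tau>, \<rho>) \<in> bm_edges"
  shows False
  using assms potentially_type2_not_target[of \<tau> \<sigma>]
  unfolding bm_edges_def potentially_type2_def by blast

lemma bm_edgesE:
  assumes "(\<sigma>, \<tau>) \<in> bm_edges"
  obtains s where "\<sigma> \<subseteq> G" "s \<in> \<sigma>" "\<tau> = \<sigma> - {s}" "lcm_mon \<tau> = lcm_mon \<sigma>" "3 \<le> card \<sigma>"
    "\<And>m. m \<in> bridges \<sigma> \<Longrightarrow> m \<noteq> s \<Longrightarrow> (m, s) \<in> r"
proof -
  have s: "\<sigma> \<subseteq> G" "potentially_type2 r G \<sigma>" "remove_sb r \<sigma> = \<tau>"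
    using assms unfolding bm_edges_def by auto
  moreover have "3 \<le> card \<sigma>"
    using three_le_card[OF s(1)] s(2) unfolding potentially_type2_def by blast
  ultimately show ?thesis using potentially_type2_sb[OF s(1,2)] that by metis
qed

lemma bm_edges_subset_taylor: "bm_edges \<subseteq> taylor_edges G"
proof
  fix e assume "e \<in> bm_edges"
  moreover obtain \<sigma> \<tau> where e: "e = (\<sigma>, \<tau>)" by (cases e)
  ultimately obtain s where "\<sigma> \<subseteq> G" "s \<in> \<sigma>" "\<tau> = \<sigma> - {s}" by (auto elim: bm_edgesE)
  then show "e \<in> taylor_edges G"
    using card.remove[OF finite_gens_subset, of \<sigma> s] unfolding taylor_edges_def e by auto
qed

definition lcm_class :: "'v mon \<Rightarrow> 'v mon set set" where
  "lcm_class p = {\<sigma>. \<sigma> \<subseteq> G \<and> lcm_mon \<sigma> = p \<and> 3 \<le> card \<sigma>}"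

text \<open>
  The edges that a run of the collecting phase has accumulated when the sets in \<open>\<Omega>\<close> are still
  left.
\<close>

definition collected :: "'v mon \<Rightarrow> 'v mon set set \<Rightarrow> 'v edges" where
  "collected p \<Omega> = {(\<sigma>, remove_sb r \<sigma>) | \<sigma>. \<sigma> \<in> lcm_class p - \<Omega> \<and> potentially_type2 r G \<sigma>}"

text \<open>
  The second hypothesis is the invariant of the run: targets of processed potentially-type-2 sets
  have been removed. A set \<open>\<sigma>\<close> of maximal cardinality in \<open>\<Omega>\<close> with a bridge is therefore
  potentially-type-2, since otherwise it would be the target of a larger and hence already
  processed set.
\<close>

lemma bm_collect_run:
  assumes "\<Omega> \<subseteq> lcm_class p"
    and "\<forall>\<sigma>\<in>lcm_class p - \<Omega>. potentially_type2 r G \<sigma> \<longrightarrow> remove_sb r \<sigma> \<notin> \<Omega>"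
  shows "(bm_collect r)\<^sup>*\<^sup>* (\<Omega>, collected p \<Omega>) ({}, collected p {})"
  using assms
proof (induction "card \<Omega>" arbitrary: \<Omega> rule: less_induct)
  case less
  have "lcm_class p \<subseteq> Pow G" unfolding lcm_class_def by blast
  then have fin: "finite \<Omega>" using less.prems(1) finite_gens
    by (meson finite_Pow_iff finite_subset)
  show ?case
  proof (cases "\<Omega> = {}")
    case False
    have "Max (card ` \<Omega>) \<in> card ` \<Omega>" using fin False by (intro Max_in) auto
    then obtain \<sigma> where \<sigma>: "\<sigma> \<in> \<Omega>" "card \<sigma> = Max (card ` \<Omega>)" by auto
    then have maximal: "\<forall>\<tau>\<in>\<Omega>. card \<tau> \<le> card \<sigma>" using fin by simp
    define \<Omega>' where "\<Omega>' = \<Omega> - {\<sigma>, remove_sb r \<sigma>}"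
    have \<sigma>G: "\<sigma> \<in> lcm_class p" "\<sigma> \<subseteq> G" using \<sigma> less.prems(1) unfolding lcm_class_def by auto
    have pt2: "potentially_type2 r G \<sigma>" if br: "bridges \<sigma> \<noteq> {}"
    proof (rule ccontr)
      assume "\<not> potentially_type2 r G \<sigma>"
      then obtain \<sigma>' where \<sigma>': "\<sigma>' \<subseteq> G" "potentially_type2 r G \<sigma>'" "remove_sb r \<sigma>' = \<sigma>"
        using target_of_potentially_type2[OF \<sigma>G(2) br] by blast
      obtain s where "s \<in> \<sigma>'" "remove_sb r \<sigma>' = \<sigma>' - {s}" "lcm_mon (\<sigma>' - {s}) = lcm_mon \<sigma>'"
        using potentially_type2_sb[OF \<sigma>'(1,2)] by metis
      then have "card \<sigma>' = Suc (card \<sigma>)" "lcm_mon \<sigma>' = lcm_mon \<sigma>"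
        using \<sigma>'(3) card.remove[OF finite_gens_subset[OF \<sigma>'(1)], of s] by simp_all
      then have "\<sigma>' \<in> lcm_class p" "\<sigma>' \<notin> \<Omega>"
        using \<sigma>G(1) \<sigma>'(1) maximal unfolding lcm_class_def by auto
      then show False using less.prems(2) \<sigma>' \<sigma>(1) by blast
    qed
    \<comment> \<open>The removed target contributes no edge of its own, so the edges collected stay as described.\<close>
    have no_pt2: "\<not> potentially_type2 r G (remove_sb r \<sigma>)" if br: "bridges \<sigma> \<noteq> {}"
      using potentially_type2_not_target[of "remove_sb r \<sigma>" \<sigma>] br \<sigma>G(2)
      unfolding remove_sb_def by blast
    have none: "remove_sb r \<sigma> = \<sigma> \<and> \<not> potentially_type2 r G \<sigma>" if "bridges \<sigma> = {}"
      using that unfolding potentially_type2_def remove_sb_def sb_def by simp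
    have "bm_collect r (\<Omega>, collected p \<Omega>) (\<Omega>', collected p \<Omega>')"
    proof -
      have "collected p \<Omega>' = (if sb r \<sigma> = None then collected p \<Omega>
        else insert (\<sigma>, remove_sb r \<sigma>) (collected p \<Omega>))"
      proof (cases "bridges \<sigma> = {}")
        case True
        then show ?thesis using none unfolding collected_def \<Omega>'_def sb_eq_None_iff by auto
      next
        case False
        then show ?thesis
          using pt2 no_pt2 \<sigma>G(1) unfolding collected_def \<Omega>'_def sb_eq_None_iff by auto
      qed
      then show ?thesis using bm_collect.intros[OF \<sigma>(1) maximal, of r "collected p \<Omega>"]
        unfolding \<Omega>'_def by simp
    qed
    moreover have "(bm_collect r)\<^sup>*\<^sup>* (\<Omega>', collected p \<Omega>') ({}, collected p {})"
    proof (rule less.hyps)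
      show "card \<Omega>' < card \<Omega>" unfolding \<Omega>'_def using \<sigma>(1) fin by (intro psubset_card_mono) auto
      show "\<Omega>' \<subseteq> lcm_class p" using less.prems(1) unfolding \<Omega>'_def by blast
      show "\<forall>\<rho>\<in>lcm_class p - \<Omega>'. potentially_type2 r G \<rho> \<longrightarrow> remove_sb r \<rho> \<notin> \<Omega>'"
      proof (intro ballI impI)
        fix \<rho> assume \<rho>: "\<rho> \<in> lcm_class p - \<Omega>'" "potentially_type2 r G \<rho>"
        consider "\<rho> \<notin> \<Omega>" | "\<rho> = \<sigma>" | "\<rho> = remove_sb r \<sigma>" "bridges \<sigma> \<noteq> {}"
          using \<rho>(1) none unfolding \<Omega>'_def by blast
        then show "remove_sb r \<rho> \<notin> \<Omega>'"
        proof cases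
          case 1
          then show ?thesis using less.prems(2) \<rho> unfolding \<Omega>'_def by blast
        qed (use \<rho>(2) no_pt2 in \<open>auto simp: \<Omega>'_def\<close>)
      qed
    qed
    ultimately show ?thesis by (rule converse_rtranclp_into_rtranclp)
  qed simp
qed

lemma collected_subset: "collected p \<Omega> \<subseteq> bm_edges"
  unfolding collected_def lcm_class_def bm_edges_def by blast

lemma bm_output_collected: "bm_output r G p (collected p {})"
proof -
  have "collected p (lcm_class p) = {}" unfolding collected_def by blast
  then have "(bm_collect r)\<^sup>*\<^sup>* (lcm_class p, {}) ({}, collected p {})"
    using bm_collect_run[of "lcm_class p" p] by simp
  moreover have "\<nexists>A'. bm_prune r (collected p {}) A'"
    using bm_edges_inj collected_subset[of p "{}"] by (auto elim!: bm_prune.cases)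
  ultimately show ?thesis unfolding bm_output_def lcm_class_def by blast
qed

lemma bm_matching_bm_edges: "bm_matching r G bm_edges"
proof -
  have "bm_edges = (\<Union>p. collected p {})"
  proof
    show "bm_edges \<subseteq> (\<Union>p. collected p {})"
    proof
      fix e assume "e \<in> bm_edges"
      then obtain \<sigma> where \<sigma>: "e = (\<sigma>, remove_sb r \<sigma>)" "\<sigma> \<subseteq> G" "potentially_type2 r G \<sigma>"
        unfolding bm_edges_def by blast
      moreover have "3 \<le> card \<sigma>"
        using \<sigma> three_le_card unfolding potentially_type2_def by blast
      ultimately have "e \<in> collected (lcm_mon \<sigma>) {}" unfolding collected_def lcm_class_def by blast
      then show "e \<in> (\<Union>p. collected p {})" by blast
    qed
  qed (use collected_subset in blast)
  then show ?thesis using bm_output_collected unfolding bm_matching_def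
    by (intro exI[of _ "\<lambda>p. collected p {}"]) auto
qed

lemma critical_no_bridges:
  assumes "\<sigma> \<in> critical G bm_edges"
  shows "bridges \<sigma> = {}"
proof (rule ccontr)
  assume br: "bridges \<sigma> \<noteq> {}"
  have \<sigma>: "\<sigma> \<subseteq> G" "\<And>\<tau>. (\<sigma>, \<tau>) \<notin> bm_edges" "\<And>\<tau>. (\<tau>, \<sigma>) \<notin> bm_edges"
    using assms unfolding critical_def by auto
  then have "\<not> potentially_type2 r G \<sigma>" unfolding bm_edges_def by blast
  then show False using target_of_potentially_type2[OF \<sigma>(1) br] \<sigma>(3) unfolding bm_edges_def by blast
qed

lemma empty_critical: "{} \<in> critical G bm_edges"
proof -
  have "card \<tau> \<ge> 2 \<and> card \<sigma> \<ge> 3" if "(\<sigma>, \<tau>) \<in> bm_edges" for \<sigma> \<tau>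
    using that by (auto elim!: bm_edgesE simp: card_Diff_singleton_if)
  then show ?thesis unfolding critical_def by force
qed

text \<open>
  Each element counts with its rank in the order, the smallest generator having rank one.
\<close>

definition weight :: "'v mon set \<Rightarrow> nat" where
  "weight \<sigma> = (\<Sum>m\<in>\<sigma>. Suc (card {m'\<in>G. (m, m') \<in> r}))"

lemma weight_remove:
  assumes "\<sigma> \<subseteq> G" "m \<in> \<sigma>"
  shows "weight \<sigma> = Suc (card {m'\<in>G. (m, m') \<in> r}) + weight (\<sigma> - {m})"
  unfolding weight_def using assms finite_gens_subset by (simp add: sum.remove)

lemma weight_remove_dominating:
  assumes "\<sigma> \<subseteq> G" "s \<in> \<sigma>" "b \<in> \<sigma>" "(b, s) \<in> r"
  shows "weight (\<sigma> - {b}) < weight (\<sigma> - {s})"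
proof -
  have "s \<in> {m'\<in>G. (b, m') \<in> r} - {m'\<in>G. (s, m') \<in> r}"
    using assms dom_irrefl by auto
  moreover have "{m'\<in>G. (s, m') \<in> r} \<subseteq> {m'\<in>G. (b, m') \<in> r}"
    using dom_trans[OF assms(4)] by blast
  ultimately have "card {m'\<in>G. (s, m') \<in> r} < card {m'\<in>G. (b, m') \<in> r}"
    using finite_gens by (intro psubset_card_mono) auto
  then show ?thesis using weight_remove[OF assms(1,2)] weight_remove[OF assms(1,3)] by linarith
qed

text \<open>
  Going up from a target \<open>\<tau>\<close> to its source \<open>\<sigma>\<close> increases the weight, so a source is given the
  weight of its target. Doubling makes room for the extra unit by which a target exceeds its
  source.
\<close>

definition potential :: "'v mon set \<Rightarrow> nat" where
  "potential \<sigma> = (if \<exists>\<tau>. (\<sigma>, \<tau>) \<in> bm_edges then 2 * weight (remove_sb r \<sigma>) else Suc (2 * weight \<sigma>))"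

lemma potential_le:
  assumes "\<sigma> \<subseteq> G"
  shows "potential \<sigma> \<le> Suc (2 * weight \<sigma>)"
proof -
  have "weight (remove_sb r \<sigma>) \<le> weight \<sigma>"
    unfolding weight_def remove_sb_def using finite_gens_subset[OF assms] by (intro sum_mono2) auto
  then show ?thesis unfolding potential_def by auto
qed

text \<open>
  If an unmatched edge removes \<open>b\<close> from a source \<open>\<sigma>\<close> without changing the lcm, then \<open>b\<close> is a
  bridge dominating \<open>sb \<sigma>\<close>, so more weight is lost than on the matched edge.
\<close>

lemma reversed_edge_decreases:
  assumes "(\<sigma>, \<tau>) \<in> reversed_edges G bm_edges"
  shows "lcm_mon \<tau> < lcm_mon \<sigma> \<or> lcm_mon \<tau> = lcm_mon \<sigma> \<and> potential \<tau> < potential \<sigma>"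
proof (cases "(\<tau>, \<sigma>) \<in> bm_edges")
  case True
  then have "\<nexists>\<rho>. (\<sigma>, \<rho>) \<in> bm_edges" "remove_sb r \<tau> = \<sigma>"
    using bm_edges_not_source_and_target unfolding bm_edges_def by blast+
  then have "potential \<tau> < potential \<sigma>" using True unfolding potential_def by auto
  then show ?thesis using True by (auto elim: bm_edgesE)
next
  case False
  then have e: "(\<sigma>, \<tau>) \<in> taylor_edges G" "(\<sigma>, \<tau>) \<notin> bm_edges"
    using assms unfolding reversed_edges_def by auto
  then obtain b where \<sigma>: "\<sigma> \<subseteq> G" and b: "b \<in> \<sigma>" "\<tau> = \<sigma> - {b}"
    unfolding taylor_edges_iff by blast
  have le: "lcm_mon \<tau> \<le> lcm_mon \<sigma>"
    using b finite_gens_subset[OF \<sigma>] by (intro lcm_mon_mono) auto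
  show ?thesis
  proof (cases "lcm_mon \<tau> = lcm_mon \<sigma>")
    case True
    then have bb: "b \<in> bridges \<sigma>" using b unfolding bridges_def by simp
    have "potential \<tau> \<le> Suc (2 * weight \<tau>)" using \<sigma> b(2) by (intro potential_le) auto
    also have "\<dots> < potential \<sigma>"
    proof (cases "\<exists>\<rho>. (\<sigma>, \<rho>) \<in> bm_edges")
      case src: True
      then obtain \<rho> where \<rho>: "(\<sigma>, \<rho>) \<in> bm_edges" by blast
      then have "remove_sb r \<sigma> = \<rho>" unfolding bm_edges_def by blast
      moreover obtain s where s: "s \<in> \<sigma>" "\<rho> = \<sigma> - {s}" "b \<noteq> s \<Longrightarrow> (b, s) \<in> r"
        using \<rho> bb by (auto elim!: bm_edgesE)
      moreover have "b \<noteq> s" using \<rho> e(2) b s by blast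
      ultimately have "weight \<tau> < weight (remove_sb r \<sigma>)"
        using weight_remove_dominating[OF \<sigma> s(1) b(1)] b(2) by simp
      then show ?thesis using src unfolding potential_def by simp
    next
      case False
      then show ?thesis unfolding potential_def using weight_remove[OF \<sigma> b(1)] b(2) by simp
    qed
    finally show ?thesis using True by blast
  qed (use le in auto)
qed

lemma reversed_edges_decrease_trancl:
  assumes "(\<sigma>, \<tau>) \<in> (reversed_edges G bm_edges)\<^sup>+"
  shows "lcm_mon \<tau> < lcm_mon \<sigma> \<or> lcm_mon \<tau> = lcm_mon \<sigma> \<and> potential \<tau> < potential \<sigma>"
  using assms
proof (induction rule: trancl_induct)
  case (step \<tau> \<rho>)
  then show ?case 
    using reversed_edge_decreases[OF step.hyps(2)]
      order.strict_trans[of "lcm_mon \<rho>" "lcm_mon \<tau>" "lcm_mon \<sigma>"] by auto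
qed (rule reversed_edge_decreases)

lemma acyclic_reversed_bm_edges: "acyclic (reversed_edges G bm_edges)"
  unfolding acyclic_def using reversed_edges_decrease_trancl by blast

end


section \<open>The Taylor complex over the coefficient ring\<close>

context ordered_gens
begin

text \<open>
  The matrix of the Taylor differential with all monomials set to one, indexed by all subsets of
  \<open>G\<close>.
\<close>

definition bd_coeff :: "'v mon set \<Rightarrow> 'v mon set \<Rightarrow> 'k::comm_ring_1" where
  "bd_coeff \<sigma> \<tau> = (if (\<sigma>, \<tau>) \<in> taylor_edges G then incidence r \<sigma> \<tau> else 0)"

definition boundary :: "('v mon set \<Rightarrow> 'k::comm_ring_1) \<Rightarrow> 'v mon set \<Rightarrow> 'k" where
  "boundary x \<tau> = (\<Sum>\<sigma>\<in>Pow G. x \<sigma> * bd_coeff \<sigma> \<tau>)"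

definition removal_sign :: "'v mon set \<Rightarrow> 'v mon \<Rightarrow> 'k::comm_ring_1" where
  "removal_sign \<sigma> m = (-1) ^ card {m'\<in>\<sigma>. (m', m) \<in> r}"

lemma finite_Pow_gens: "finite (Pow G)"
  using finite_gens by simp

lemma bd_coeff_remove:
  assumes "\<sigma> \<subseteq> G" "m \<in> \<sigma>"
  shows "bd_coeff \<sigma> (\<sigma> - {m}) = removal_sign \<sigma> m"
proof -
  have "\<sigma> - (\<sigma> - {m}) = {m}" using assms(2) by blast
  moreover have "(\<sigma>, \<sigma> - {m}) \<in> taylor_edges G" using assms unfolding taylor_edges_iff by blast
  ultimately show ?thesis unfolding bd_coeff_def incidence_def removal_sign_def by simp
qed

lemma bd_coeff_nonzeroD:
  assumes "bd_coeff \<sigma> \<tau> \<noteq> (0 :: 'k::comm_ring_1)"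
  shows "(\<sigma>, \<tau>) \<in> taylor_edges G" "\<sigma> \<subseteq> G" "\<tau> \<subset> \<sigma>" "card \<sigma> = Suc (card \<tau>)"
  using assms unfolding bd_coeff_def taylor_edges_def by (auto split: if_splits)

lemma bd_coeff_square: "(\<sigma>, \<tau>) \<in> taylor_edges G \<Longrightarrow> bd_coeff \<sigma> \<tau> * bd_coeff \<sigma> \<tau> = (1 :: 'k::comm_ring_1)"
  unfolding bd_coeff_def incidence_def by (simp flip: power_add mult_2)

text \<open>
  If \<open>a\<close> dominates \<open>b\<close>, removing \<open>a\<close> shifts the position of \<open>b\<close> by one, whereas removing \<open>b\<close> does
  not affect the position of \<open>a\<close>.
\<close>

lemma removal_sign_swap:
  assumes "\<sigma> \<subseteq> G" "a \<in> \<sigma>" "b \<in> \<sigma>" "a \<noteq> b"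
  shows "removal_sign \<sigma> a * removal_sign (\<sigma> - {a}) b =
    - (removal_sign \<sigma> b * removal_sign (\<sigma> - {b}) a :: 'k::comm_ring_1)"
proof -
  have *: "removal_sign \<sigma> a * removal_sign (\<sigma> - {a}) b =
      - (removal_sign \<sigma> b * removal_sign (\<sigma> - {b}) a :: 'k)"
    if "a \<in> \<sigma>" "b \<in> \<sigma>" "(a, b) \<in> r" for a b
  proof -
    have fin: "finite \<sigma>" by (rule finite_gens_subset[OF assms(1)])
    have "{m'\<in>\<sigma>. (m', b) \<in> r} = insert a {m'\<in>\<sigma> - {a}. (m', b) \<in> r}"
      using that by blast
    then have "removal_sign \<sigma> b = - (removal_sign (\<sigma> - {a}) b :: 'k)"
      unfolding removal_sign_def using fin by (simp add: card_insert_if)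
    moreover have "{m'\<in>\<sigma>. (m', a) \<in> r} = {m'\<in>\<sigma> - {b}. (m', a) \<in> r}"
      using dom_asym[OF that(3)] by blast
    then have "removal_sign (\<sigma> - {b}) a = (removal_sign \<sigma> a :: 'k)" unfolding removal_sign_def by simp
    ultimately show ?thesis by simp
  qed
  consider "(a, b) \<in> r" | "(b, a) \<in> r" using dom_total[of a b] assms by blast
  then show ?thesis
  proof cases
    case 2
    then show ?thesis using *[of b a] assms by simp
  qed (use * assms in simp)
qed

lemma bd_coeff_squared_zero:
  "(\<Sum>\<rho>\<in>Pow G. bd_coeff \<sigma> \<rho> * bd_coeff \<rho> \<kappa>) = (0 :: 'k::comm_ring_1)"
proof (cases "\<exists>\<rho>. (\<sigma>, \<rho>) \<in> taylor_edges G \<and> (\<rho>, \<kappa>) \<in> taylor_edges G")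
  case True
  then obtain a b where ab: "\<sigma> \<subseteq> G" "a \<in> \<sigma>" "b \<in> \<sigma>" "a \<noteq> b" "\<kappa> = \<sigma> - {a} - {b}"
    unfolding taylor_edges_iff by blast
  have sw: "\<kappa> = \<sigma> - {b} - {a}" using ab(5) by blast
  have "\<rho> = \<sigma> - {a} \<or> \<rho> = \<sigma> - {b}"
    if "(\<sigma>, \<rho>) \<in> taylor_edges G" "(\<rho>, \<kappa>) \<in> taylor_edges G" for \<rho>
  proof -
    obtain c d where "c \<in> \<sigma>" "\<rho> = \<sigma> - {c}" "\<kappa> = \<rho> - {d}"
      using \<open>(\<sigma>, \<rho>) \<in> taylor_edges G\<close> \<open>(\<rho>, \<kappa>) \<in> taylor_edges G\<close> unfolding taylor_edges_iff by blast
    then have "c \<notin> \<kappa>" "c \<in> \<sigma>" by auto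
    then have "c = a \<or> c = b" using ab(5) by blast
    then show ?thesis using \<open>\<rho> = \<sigma> - {c}\<close> by blast
  qed
  then have "(\<Sum>\<rho>\<in>Pow G. bd_coeff \<sigma> \<rho> * bd_coeff \<rho> \<kappa> :: 'k) =
      (\<Sum>\<rho>\<in>{\<sigma> - {a}, \<sigma> - {b}}. bd_coeff \<sigma> \<rho> * bd_coeff \<rho> \<kappa>)"
    using ab(1) finite_Pow_gens by (intro sum.mono_neutral_right) (auto simp: bd_coeff_def)
  also have "\<dots> =
      bd_coeff \<sigma> (\<sigma> - {a}) * bd_coeff (\<sigma> - {a}) \<kappa> + bd_coeff \<sigma> (\<sigma> - {b}) * bd_coeff (\<sigma> - {b}) \<kappa>"
    using ab by (subst sum.insert) auto
  also have "\<dots> =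
      removal_sign \<sigma> a * removal_sign (\<sigma> - {a}) b + removal_sign \<sigma> b * removal_sign (\<sigma> - {b}) a"
  proof -
    have "bd_coeff (\<sigma> - {a}) \<kappa> = (removal_sign (\<sigma> - {a}) b :: 'k)"
      unfolding ab(5) using ab by (intro bd_coeff_remove) auto
    moreover have "bd_coeff (\<sigma> - {b}) \<kappa> = (removal_sign (\<sigma> - {b}) a :: 'k)"
      unfolding sw using ab by (intro bd_coeff_remove) auto
    ultimately show ?thesis using ab by (simp add: bd_coeff_remove)
  qed
  also have "\<dots> = 0" using removal_sign_swap[OF ab(1-4), where 'k='k] by simp
  finally show ?thesis .
qed (auto simp: bd_coeff_def intro!: sum.neutral)

lemma boundary_boundary: "boundary (boundary x) \<kappa> = (0 :: 'k::comm_ring_1)"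
proof -
  have "boundary (boundary x) \<kappa> = (\<Sum>\<rho>\<in>Pow G. \<Sum>\<sigma>\<in>Pow G. x \<sigma> * (bd_coeff \<sigma> \<rho> * bd_coeff \<rho> \<kappa>))"
    unfolding boundary_def by (simp add: sum_distrib_right mult.assoc)
  also have "\<dots> = (\<Sum>\<sigma>\<in>Pow G. x \<sigma> * (\<Sum>\<rho>\<in>Pow G. bd_coeff \<sigma> \<rho> * bd_coeff \<rho> \<kappa>))"
    by (subst sum.swap) (simp add: sum_distrib_left)
  finally show ?thesis by (simp add: bd_coeff_squared_zero)
qed

lemma boundary_diff: "boundary (\<lambda>\<sigma>. x \<sigma> - y \<sigma>) \<tau> = boundary x \<tau> - (boundary y \<tau> :: 'k::comm_ring_1)"
  unfolding boundary_def by (simp add: left_diff_distrib sum_subtractf)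

lemma boundary_cmult: "boundary (\<lambda>\<sigma>. c * x \<sigma>) \<tau> = c * (boundary x \<tau> :: 'k::comm_ring_1)"
  unfolding boundary_def by (simp add: sum_distrib_left mult.assoc)

lemma boundary_sum: "boundary (\<lambda>\<sigma>. \<Sum>i\<in>J. f i \<sigma>) \<tau> = (\<Sum>i\<in>J. boundary (f i) \<tau> :: 'k::comm_ring_1)"
  unfolding boundary_def by (subst sum.swap) (simp add: sum_distrib_right)

lemma boundary_delta:
  assumes "\<sigma> \<subseteq> G"
  shows "boundary (\<lambda>\<kappa>. if \<kappa> = \<sigma> then 1 else 0) \<tau> = (bd_coeff \<sigma> \<tau> :: 'k::comm_ring_1)"
proof -
  have "boundary (\<lambda>\<kappa>. if \<kappa> = \<sigma> then 1 else 0) \<tau> = (\<Sum>\<kappa>\<in>Pow G. if \<kappa> = \<sigma> then bd_coeff \<kappa> \<tau> else (0::'k))"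
    unfolding boundary_def by (intro sum.cong) auto
  then show ?thesis using assms finite_Pow_gens by (simp add: sum.delta)
qed

lemma boundary_eq_sum_cofacets:
  assumes "\<tau> \<subseteq> G"
  shows "boundary x \<tau> = (\<Sum>m\<in>G - \<tau>. x (insert m \<tau>) * (removal_sign (insert m \<tau>) m :: 'k::comm_ring_1))"
proof -
  have "boundary x \<tau> = (\<Sum>\<sigma>\<in>(\<lambda>m. insert m \<tau>) ` (G - \<tau>). x \<sigma> * bd_coeff \<sigma> \<tau>)"
    unfolding boundary_def
  proof (rule sum.mono_neutral_right)
    show "\<forall>\<sigma>\<in>Pow G - (\<lambda>m. insert m \<tau>) ` (G - \<tau>). x \<sigma> * bd_coeff \<sigma> \<tau> = 0"
    proof
      fix \<sigma> assume \<sigma>: "\<sigma> \<in> Pow G - (\<lambda>m. insert m \<tau>) ` (G - \<tau>)"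
      have "(\<sigma>, \<tau>) \<notin> taylor_edges G"
      proof
        assume "(\<sigma>, \<tau>) \<in> taylor_edges G"
        then obtain m where "m \<in> \<sigma>" "\<tau> = \<sigma> - {m}" unfolding taylor_edges_iff by blast
        then have "m \<in> G - \<tau>" "\<sigma> = insert m \<tau>" using \<sigma> by auto
        then show False using \<sigma> by blast
      qed
      then show "x \<sigma> * bd_coeff \<sigma> \<tau> = 0" unfolding bd_coeff_def by simp
    qed
  qed (use assms finite_Pow_gens in auto)
  also have "\<dots> = (\<Sum>m\<in>G - \<tau>. x (insert m \<tau>) * bd_coeff (insert m \<tau>) \<tau>)"
    by (subst sum.reindex) (auto simp: inj_on_def)
  also have "\<dots> = (\<Sum>m\<in>G - \<tau>. x (insert m \<tau>) * removal_sign (insert m \<tau>) m)"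
  proof (rule sum.cong)
    fix m assume m: "m \<in> G - \<tau>"
    then have "bd_coeff (insert m \<tau>) (insert m \<tau> - {m}) = (removal_sign (insert m \<tau>) m :: 'k)"
      using assms by (intro bd_coeff_remove) auto
    then show "x (insert m \<tau>) * bd_coeff (insert m \<tau>) \<tau> = x (insert m \<tau>) * removal_sign (insert m \<tau>) m"
      using m by simp
  qed simp
  finally show ?thesis .
qed

text \<open>
  The simplex on \<open>U\<close> is a cone over its smallest vertex \<open>m\<close>; adding \<open>m\<close> to all faces that do not
  contain it is a contracting homotopy. Since \<open>m\<close> is smallest, its presence does not affect the
  signs for the other vertices, and its own sign in a set with \<open>n + 1\<close> elements is \<open>(-1) ^ n\<close>.
\<close>

lemma simplex_exact:
  fixes z :: "'v mon set \<Rightarrow> 'k::comm_ring_1"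
  assumes "U \<subseteq> G" "U \<noteq> {}"
    and supp: "\<And>\<sigma>. z \<sigma> \<noteq> 0 \<Longrightarrow> \<sigma> \<subseteq> U \<and> card \<sigma> = n"
    and cycle: "\<And>\<tau>. boundary z \<tau> = 0"
  shows "\<exists>y. (\<forall>\<sigma>. y \<sigma> \<noteq> 0 \<longrightarrow> \<sigma> \<subseteq> U \<and> card \<sigma> = Suc n) \<and> boundary y = z"
proof -
  obtain m where m: "m \<in> U" "\<forall>m'\<in>U. m' \<noteq> m \<longrightarrow> (m', m) \<in> r"
    using ex_smallest[OF assms(1,2)] by blast
  define y where "y \<sigma> = (if m \<in> \<sigma> then (-1) ^ n * z (\<sigma> - {m}) else 0)" for \<sigma>
  have mG: "m \<in> G" using m(1) assms(1) by blast
  have removal_sign_m: "z \<tau> * removal_sign (insert m \<tau>) m = z \<tau> * (-1) ^ n" if "m \<notin> \<tau>" for \<tau>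
  proof (cases "z \<tau> = 0")
    case False
    then have "\<tau> \<subseteq> U" "card \<tau> = n" using supp by auto
    moreover have "{m'\<in>insert m \<tau>. (m', m) \<in> r} = \<tau>"
      using m(2) that \<open>\<tau> \<subseteq> U\<close> by (auto simp: dom_irrefl)
    ultimately show ?thesis unfolding removal_sign_def by simp
  qed simp
  have sq: "(-1) ^ n * ((-1) ^ n * c) = c" for c :: 'k
    by (simp flip: power_add mult.assoc mult_2)
  have "boundary y \<tau> = z \<tau>" for \<tau>
  proof -
    consider "\<not> \<tau> \<subseteq> G" | "\<tau> \<subseteq> G" "m \<notin> \<tau>" | "\<tau> \<subseteq> G" "m \<in> \<tau>" by blast
    then show ?thesis
    proof cases
      case 1
      then have "boundary y \<tau> = 0" unfolding boundary_def bd_coeff_def taylor_edges_def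
        by (intro sum.neutral) auto
      moreover have "z \<tau> = 0" using 1 supp[of \<tau>] assms(1) by blast
      ultimately show ?thesis by simp
    next
      case 2
      have "boundary y \<tau> = (\<Sum>a\<in>{m}. y (insert a \<tau>) * removal_sign (insert a \<tau>) a)"
        unfolding boundary_eq_sum_cofacets[OF 2(1)]
        using 2 mG finite_gens by (intro sum.mono_neutral_right) (auto simp: y_def)
      also have "\<dots> = (-1) ^ n * (z \<tau> * removal_sign (insert m \<tau>) m)"
        using 2(2) by (simp add: y_def mult.assoc)
      finally show ?thesis unfolding removal_sign_m[OF 2(2)] using sq by (simp add: mult.commute)
    next
      case 3
      define \<tau>' where "\<tau>' = \<tau> - {m}"
      have \<tau>': "\<tau>' \<subseteq> G" "m \<notin> \<tau>'" "insert m \<tau>' = \<tau>" "G - \<tau>' = insert m (G - \<tau>)"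
        using 3 mG unfolding \<tau>'_def by auto
      have "boundary z \<tau>' =
          z \<tau> * removal_sign \<tau> m + (\<Sum>a\<in>G - \<tau>. z (insert a \<tau>') * removal_sign (insert a \<tau>') a)"
        unfolding boundary_eq_sum_cofacets[OF \<tau>'(1)] \<tau>'(4)
        using 3(2) finite_gens \<tau>'(3) by (subst sum.insert) auto
      then have rest: "(\<Sum>a\<in>G - \<tau>. z (insert a \<tau>') * removal_sign (insert a \<tau>') a) =
          - (z \<tau> * removal_sign \<tau> m)"
        using cycle[of \<tau>'] by (simp add: eq_neg_iff_add_eq_0 add.commute)
      have "boundary y \<tau> = (\<Sum>a\<in>G - \<tau>. (-1) ^ n * (z (insert a \<tau>') * removal_sign (insert a \<tau>') a))"
        unfolding boundary_eq_sum_cofacets[OF 3(1)]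
      proof (rule sum.cong)
        fix a assume a: "a \<in> G - \<tau>"
        have e: "insert a \<tau> - {m} = insert a \<tau>'" using a 3(2) unfolding \<tau>'_def by auto
        have "z (insert a \<tau>') * removal_sign (insert a \<tau>) a =
            z (insert a \<tau>') * (removal_sign (insert a \<tau>') a :: 'k)"
        proof (cases "z (insert a \<tau>') = 0")
          case False
          then have "a \<in> U" using supp by blast
          moreover have "a \<noteq> m" using a 3(2) by blast
          ultimately have "(m, a) \<notin> r" using m(2) dom_asym by blast
          then have "{m'\<in>insert a \<tau>. (m', a) \<in> r} = {m'\<in>insert a \<tau>'. (m', a) \<in> r}"
            unfolding \<tau>'_def by auto
          then show ?thesis unfolding removal_sign_def by simp
        qed simp
        then show "y (insert a \<tau>) * removal_sign (insert a \<tau>) a =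
            (-1) ^ n * (z (insert a \<tau>') * removal_sign (insert a \<tau>') a)"
          unfolding y_def using 3(2) e by (simp add: mult.assoc)
      qed simp
      also have "\<dots> = - ((-1) ^ n * (z \<tau> * removal_sign \<tau> m))"
        unfolding sum_distrib_left[symmetric] rest by simp
      finally have b: "boundary y \<tau> = - ((-1) ^ n * (z \<tau> * removal_sign \<tau> m))" .
      show ?thesis
      proof (cases "z \<tau> = 0")
        case False
        then have t: "\<tau> \<subseteq> U" "card \<tau> = n" using supp by auto
        have "{m'\<in>\<tau>. (m', m) \<in> r} = \<tau>'"
          unfolding \<tau>'_def using m(2) t(1) by (auto simp: dom_irrefl)
        moreover have "n = Suc (card \<tau>')"
          unfolding \<tau>'_def using t(2) 3 finite_gens_subset[OF 3(1)] by (metis card.remove)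
        ultimately have "(-1) ^ n = - (removal_sign \<tau> m :: 'k)" unfolding removal_sign_def by simp
        then have s: "removal_sign \<tau> m = - ((-1) ^ n :: 'k)" by simp
        show ?thesis unfolding b s using sq[of "z \<tau>"] by (simp add: mult.commute mult.left_commute)
      qed (simp add: b)
    qed
  qed
  moreover have "\<sigma> \<subseteq> U \<and> card \<sigma> = Suc n" if "y \<sigma> \<noteq> 0" for \<sigma>
  proof -
    have s: "m \<in> \<sigma>" "z (\<sigma> - {m}) \<noteq> 0" using that unfolding y_def by (auto split: if_splits)
    have U: "\<sigma> - {m} \<subseteq> U" "card (\<sigma> - {m}) = n" using supp[OF s(2)] by auto
    then have "\<sigma> \<subseteq> U" using m(1) by blast
    moreover have "card \<sigma> = Suc n"
      using card.remove[OF finite_gens_subset s(1)] U(2) calculation assms(1) by simp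
    ultimately show ?thesis by blast
  qed
  ultimately show ?thesis by (intro exI[of _ y]) (simp add: fun_eq_iff)
qed

end


section \<open>Discrete Morse theory over the coefficient ring\<close>

locale acyclic_matching = ordered_gens G r for G :: "'v mon set" and r +
  fixes A :: "'v edges"
  assumes matching_subset: "A \<subseteq> taylor_edges G"
    and source_unique: "(\<sigma>, \<tau>) \<in> A \<Longrightarrow> (\<sigma>', \<tau>) \<in> A \<Longrightarrow> \<sigma> = \<sigma>'"
    and target_unique: "(\<sigma>, \<tau>) \<in> A \<Longrightarrow> (\<sigma>, \<tau>') \<in> A \<Longrightarrow> \<tau> = \<tau>'"
    and not_source_and_target: "(\<sigma>, \<tau>) \<in> A \<Longrightarrow> (\<tau>, \<rho>) \<in> A \<Longrightarrow> False"
    and acyclic: "acyclic (reversed_edges G A)"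
begin

abbreviation rev_graph where "rev_graph \<equiv> reversed_edges G A"
abbreviation crit where "crit \<equiv> critical G A"

lemma matchingD:
  assumes "(\<sigma>, \<tau>) \<in> A"
  shows "\<sigma> \<subseteq> G" "\<tau> \<subseteq> G" "card \<sigma> = Suc (card \<tau>)" "(\<sigma>, \<tau>) \<in> taylor_edges G"
    "\<sigma> \<notin> crit" "\<tau> \<notin> crit"
  using assms matching_subset unfolding taylor_edges_def critical_def by auto

lemma finite_rev: "finite rev_graph"
proof (rule finite_subset)
  show "rev_graph \<subseteq> Pow G \<times> Pow G"
    using matching_subset unfolding reversed_edges_def taylor_edges_def by auto
qed (simp add: finite_gens)

lemma wf_rev: "wf rev_graph"
  by (rule finite_acyclic_wf[OF finite_rev acyclic])

lemma wf_converse_rev: "wf (rev_graph\<inverse>)"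
  by (rule finite_acyclic_wf_converse[OF finite_rev acyclic])

text \<open>
  Together with \<open>bd_coeff\<close> this turns statements on gradient paths into matrix identities over all
  subsets of \<open>G\<close>; \<open>path_sum\<close> below is the inverse of the identity matrix minus \<open>step_coeff\<close>.
\<close>

definition step_coeff :: "'v mon set \<Rightarrow> 'v mon set \<Rightarrow> 'k::comm_ring_1" where
  "step_coeff \<rho> \<rho>' = (if (\<rho>, \<rho>') \<in> rev_graph then step_weight r A \<rho> \<rho>' else 0)"

lemma step_coeff_eq:
  "step_coeff \<rho> \<rho>' = (if (\<rho>', \<rho>) \<in> A then - bd_coeff \<rho>' \<rho> else if (\<rho>, \<rho>') \<in> A then 0
     else (bd_coeff \<rho> \<rho>' :: 'k::comm_ring_1))"
  using matching_subset not_source_and_target[of \<rho> \<rho>' \<rho>]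
  unfolding step_coeff_def bd_coeff_def reversed_edges_def step_weight_def by auto

lemma step_coeff_nonzeroD:
  assumes "step_coeff \<rho> \<rho>' \<noteq> (0 :: 'k::comm_ring_1)"
  obtains (up) "(\<rho>', \<rho>) \<in> A" "(\<rho>, \<rho>') \<in> rev_graph"
    | (down) "(\<rho>, \<rho>') \<in> taylor_edges G" "(\<rho>, \<rho>') \<notin> A" "(\<rho>, \<rho>') \<in> rev_graph"
  using assms unfolding step_coeff_def reversed_edges_def by (auto split: if_splits)

definition path_sum :: "'v mon set \<Rightarrow> 'v mon set \<Rightarrow> 'k::comm_ring_1" where
  "path_sum \<rho> \<tau> = (\<Sum>P\<in>gradient_paths G A \<rho> \<tau>. path_weight r A P)"

lemma gradient_paths_unfold:
  "gradient_paths G A \<rho> \<tau> = (if \<rho> = \<tau> then {[\<rho>]} else {}) \<union>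
     (\<Union>\<rho>'\<in>rev_graph `` {\<rho>}. (#) \<rho> ` gradient_paths G A \<rho>' \<tau>)"
proof (intro set_eqI iffI)
  fix P assume P: "P \<in> gradient_paths G A \<rho> \<tau>"
  show "P \<in> (if \<rho> = \<tau> then {[\<rho>]} else {}) \<union>
     (\<Union>\<rho>'\<in>rev_graph `` {\<rho>}. (#) \<rho> ` gradient_paths G A \<rho>' \<tau>)"
  proof (cases P)
    case (Cons \<sigma> Q)
    show ?thesis
    proof (cases "Q = []")
      case True
      then show ?thesis using P Cons unfolding gradient_paths_def by auto
    next
      case False
      then have "(\<rho>, hd Q) \<in> rev_graph" "Q \<in> gradient_paths G A (hd Q) \<tau>" "P = \<rho> # Q"
        using P Cons unfolding gradient_paths_def by (auto simp: successively_Cons)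
      then show ?thesis by blast
    qed
  qed (use P in \<open>simp add: gradient_paths_def\<close>)
next
  fix P assume "P \<in> (if \<rho> = \<tau> then {[\<rho>]} else {}) \<union>
     (\<Union>\<rho>'\<in>rev_graph `` {\<rho>}. (#) \<rho> ` gradient_paths G A \<rho>' \<tau>)"
  then show "P \<in> gradient_paths G A \<rho> \<tau>"
    unfolding gradient_paths_def by (auto simp: successively_Cons split: if_splits)
qed

lemma finite_rev_Image: "finite (rev_graph `` {\<rho>})"
  using finite_rev by (rule finite_Image)

lemma finite_gradient_paths: "finite (gradient_paths G A \<rho> \<tau>)"
proof (induction \<rho> rule: wf_induct_rule[OF wf_converse_rev])
  case (1 \<rho>)
  then show ?case by (subst gradient_paths_unfold) (auto intro: finite_rev_Image)
qed

lemma path_weight_Cons: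
  assumes "P \<in> gradient_paths G A \<rho>' \<tau>"
  shows "path_weight r A (\<rho> # P) = step_weight r A \<rho> \<rho>' * (path_weight r A P :: 'k::comm_ring_1)"
  using assms unfolding path_weight_def gradient_paths_def by (cases P) auto

text \<open>
  Splitting off the first step of a gradient path. With the acyclicity of the graph this recursion
  determines the path sums.
\<close>

lemma path_sum_unfold:
  "path_sum \<rho> \<tau> =
      (if \<rho> = \<tau> then 1 else 0) + (\<Sum>\<rho>'\<in>Pow G. step_coeff \<rho> \<rho>' * (path_sum \<rho>' \<tau> :: 'k::comm_ring_1))"
proof -
  let ?U = "\<Union>\<rho>'\<in>rev_graph `` {\<rho>}. (#) \<rho> ` gradient_paths G A \<rho>' \<tau>"
  let ?B = "if \<rho> = \<tau> then {[\<rho>]} else {}"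
  have "[] \<notin> gradient_paths G A \<rho>' \<tau>" for \<rho>' unfolding gradient_paths_def by simp
  then have "?B \<inter> ?U = {}" by auto
  then have "path_sum \<rho> \<tau> = (\<Sum>P\<in>?B. path_weight r A P) + (\<Sum>P\<in>?U. path_weight r A P :: 'k)"
    unfolding path_sum_def gradient_paths_unfold[of \<rho> \<tau>]
    by (intro sum.union_disjoint) (auto intro: finite_rev_Image finite_gradient_paths)
  moreover have "(\<Sum>P\<in>?B. path_weight r A P) = (if \<rho> = \<tau> then 1 else (0::'k))"
    by (simp add: path_weight_def)
  moreover have "(\<Sum>P\<in>?U. path_weight r A P :: 'k) =
      (\<Sum>\<rho>'\<in>rev_graph `` {\<rho>}. \<Sum>P\<in>(#) \<rho> ` gradient_paths G A \<rho>' \<tau>. path_weight r A P)"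
  proof (rule sum.UNION_disjoint[OF finite_rev_Image])
    show "\<forall>\<rho>'\<in>rev_graph `` {\<rho>}. finite ((#) \<rho> ` gradient_paths G A \<rho>' \<tau>)"
      by (simp add: finite_gradient_paths)
  qed (auto simp: gradient_paths_def)
  moreover have "(\<Sum>P\<in>(#) \<rho> ` gradient_paths G A \<rho>' \<tau>. path_weight r A P) =
      step_weight r A \<rho> \<rho>' * (path_sum \<rho>' \<tau> :: 'k)" for \<rho>'
    by (subst sum.reindex) (auto simp: path_sum_def sum_distrib_left path_weight_Cons intro!: sum.cong)
  moreover have "(\<Sum>\<rho>'\<in>rev_graph `` {\<rho>}. step_weight r A \<rho> \<rho>' * (path_sum \<rho>' \<tau> :: 'k)) =
      (\<Sum>\<rho>'\<in>Pow G. step_coeff \<rho> \<rho>' * path_sum \<rho>' \<tau>)"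
  proof (rule sum.mono_neutral_cong_left)
    show "rev_graph `` {\<rho>} \<subseteq> Pow G"
      using matching_subset unfolding reversed_edges_def taylor_edges_def by auto
  qed (auto simp: step_coeff_def finite_gens)
  ultimately show ?thesis by simp
qed

text \<open>
  A step up leads from a target to its source, which is not a target, so two steps up never follow
  each other, and a path can rise at most one level above its start. The last step into a critical
  set \<open>\<tau>\<close> is a step down, so a nontrivial path that starts no higher than \<open>\<tau>\<close> must start with a
  step up from the level of \<open>\<tau>\<close>.
\<close>

lemma path_sum_critical:
  assumes "\<tau> \<in> crit"
    and "card \<rho> < card \<tau> \<or> card \<rho> = card \<tau> \<and> (\<forall>\<sigma>. (\<sigma>, \<rho>) \<notin> A)"
  shows "path_sum \<rho> \<tau> = (if \<rho> = \<tau> then 1 else (0 :: 'k::comm_ring_1))"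
  using assms(2)
proof (induction \<rho> rule: wf_induct_rule[OF wf_converse_rev])
  case (1 \<rho>)
  have "step_coeff \<rho> \<rho>' * path_sum \<rho>' \<tau> = (0::'k)" for \<rho>'
  proof (cases "step_coeff \<rho> \<rho>' = (0::'k)")
    case False
    then have "path_sum \<rho>' \<tau> = (0::'k)"
    proof (cases rule: step_coeff_nonzeroD)
      case up
      have "\<forall>\<sigma>. (\<sigma>, \<rho>') \<notin> A" using not_source_and_target up(1) by blast
      moreover have "card \<rho>' = Suc (card \<rho>)" "\<rho>' \<noteq> \<tau>" using matchingD[OF up(1)] assms(1) by auto
      moreover have "card \<rho> < card \<tau>" using "1.prems" up(1) by blast
      ultimately show ?thesis using "1.IH"[of \<rho>'] up(2) by force
    next
      case down
      then have "card \<rho> = Suc (card \<rho>')" unfolding taylor_edges_def by simp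
      then have "card \<rho>' < card \<tau>" using "1.prems" by linarith
      then show ?thesis using "1.IH"[of \<rho>'] down(3) by force
    qed
    then show ?thesis by simp
  qed simp
  then show ?case using path_sum_unfold[of \<rho> \<tau>, where 'k='k] by simp
qed

abbreviation mcoeff where "mcoeff \<equiv> morse_coeff r G A"

lemma mcoeff_eq: "mcoeff \<sigma> \<tau> = (\<Sum>\<rho>\<in>Pow G. bd_coeff \<sigma> \<rho> * (path_sum \<rho> \<tau> :: 'k::comm_ring_1))"
  unfolding morse_coeff_def path_sum_def
  by (rule sum.mono_neutral_cong_left) (auto simp: bd_coeff_def finite_gens taylor_edges_def)

text \<open>
  The paths that begin by going down from \<open>\<sigma>\<close> to its target \<open>\<rho>\<close> have to return to \<open>\<sigma>\<close> at once.
  They come with the opposite sign and cancel all the other paths.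
\<close>

lemma mcoeff_source:
  assumes "(\<sigma>, \<rho>) \<in> A" "\<tau> \<in> crit" "card \<rho> = card \<tau>"
  shows "mcoeff \<sigma> \<tau> = (0 :: 'k::comm_ring_1)"
proof -
  have \<rho>: "\<rho> \<in> Pow G" and \<sigma>: "\<sigma> \<in> Pow G" and T: "(\<sigma>, \<rho>) \<in> taylor_edges G"
    and ne: "\<rho> \<noteq> \<tau>" "\<sigma> \<noteq> \<tau>" using matchingD[OF assms(1)] assms(2) by auto
  have "step_coeff \<rho> \<rho>' * path_sum \<rho>' \<tau> = (0::'k)" if "\<rho>' \<noteq> \<sigma>" for \<rho>'
  proof (cases "step_coeff \<rho> \<rho>' = (0::'k)")
    case False
    then have "path_sum \<rho>' \<tau> = (0::'k)"
    proof (cases rule: step_coeff_nonzeroD)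
      case up
      then show ?thesis using source_unique[OF assms(1)] that by blast
    next
      case down
      then have "card \<rho> = Suc (card \<rho>')" unfolding taylor_edges_def by simp
      then have "card \<rho>' < card \<tau>" using assms(3) by linarith
      then show ?thesis using path_sum_critical[OF assms(2), of \<rho>', where 'k='k] by auto
    qed
    then show ?thesis by simp
  qed simp
  then have "(\<Sum>\<rho>'\<in>Pow G. step_coeff \<rho> \<rho>' * path_sum \<rho>' \<tau>) = step_coeff \<rho> \<sigma> * (path_sum \<sigma> \<tau> :: 'k)"
    using \<sigma> finite_Pow_gens by (subst sum.remove[OF _ \<sigma>]) (auto intro!: sum.neutral)
  then have at_target: "path_sum \<rho> \<tau> = - bd_coeff \<sigma> \<rho> * (path_sum \<sigma> \<tau> :: 'k)"
    using path_sum_unfold[of \<rho> \<tau>, where 'k='k] ne(1) assms(1) by (simp add: step_coeff_eq)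
  have "(\<rho>', \<sigma>) \<notin> A" "(\<sigma>, \<rho>') \<in> A \<longleftrightarrow> \<rho>' = \<rho>" for \<rho>'
    using not_source_and_target assms(1) target_unique by blast+
  then have "step_coeff \<sigma> \<rho>' = (if \<rho>' = \<rho> then 0 else bd_coeff \<sigma> \<rho>' :: 'k)" for \<rho>'
    unfolding step_coeff_eq by simp
  then have "path_sum \<sigma> \<tau> = (\<Sum>\<rho>'\<in>Pow G. (if \<rho>' = \<rho> then 0 else bd_coeff \<sigma> \<rho>') * (path_sum \<rho>' \<tau> :: 'k))"
    using path_sum_unfold[of \<sigma> \<tau>, where 'k='k] ne(2) by simp
  also have "\<dots> = (\<Sum>\<rho>'\<in>Pow G - {\<rho>}. bd_coeff \<sigma> \<rho>' * path_sum \<rho>' \<tau>)"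
    using \<rho> finite_Pow_gens by (intro sum.mono_neutral_cong_right) auto
  finally have at_source: "(\<Sum>\<rho>'\<in>Pow G - {\<rho>}. bd_coeff \<sigma> \<rho>' * path_sum \<rho>' \<tau>) = (path_sum \<sigma> \<tau> :: 'k)"
    by simp
  have "mcoeff \<sigma> \<tau> = bd_coeff \<sigma> \<rho> * path_sum \<rho> \<tau> + (path_sum \<sigma> \<tau> :: 'k)"
    unfolding mcoeff_eq at_source[symmetric] by (rule sum.remove[OF finite_Pow_gens \<rho>])
  also have "\<dots> = path_sum \<sigma> \<tau> - (bd_coeff \<sigma> \<rho> * bd_coeff \<sigma> \<rho>) * path_sum \<sigma> \<tau>"
    unfolding at_target by (simp add: mult.assoc)
  finally show ?thesis unfolding bd_coeff_square[OF T] by simp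
qed

lemma sum_bd_coeff_mcoeff: "(\<Sum>\<rho>\<in>Pow G. bd_coeff \<sigma> \<rho> * mcoeff \<rho> \<tau>) = (0 :: 'k::comm_ring_1)"
proof -
  have "(\<Sum>\<rho>\<in>Pow G. bd_coeff \<sigma> \<rho> * mcoeff \<rho> \<tau>) =
      (\<Sum>\<rho>\<in>Pow G. \<Sum>\<kappa>\<in>Pow G. (bd_coeff \<sigma> \<rho> * bd_coeff \<rho> \<kappa>) * (path_sum \<kappa> \<tau> :: 'k))"
    unfolding mcoeff_eq by (simp add: sum_distrib_left mult.assoc)
  also have "\<dots> = (\<Sum>\<kappa>\<in>Pow G. (\<Sum>\<rho>\<in>Pow G. bd_coeff \<sigma> \<rho> * bd_coeff \<rho> \<kappa>) * path_sum \<kappa> \<tau>)"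
    by (subst sum.swap) (simp add: sum_distrib_right)
  finally show ?thesis by (simp add: bd_coeff_squared_zero)
qed

definition crit_card :: "nat \<Rightarrow> 'v mon set set" where
  "crit_card n = {\<kappa> \<in> crit. card \<kappa> = n}"

lemma crit_card_subset: "crit_card n \<subseteq> Pow G"
  unfolding crit_card_def critical_def by blast

lemma finite_crit_card: "finite (crit_card n)"
  using crit_card_subset finite_Pow_gens by (rule finite_subset)

text \<open>
  The projection of chains to critical sets by path sums is the identity on critical sets and
  kills the sources.
\<close>

lemma sum_path_sum_critical:
  assumes "\<tau> \<in> crit" "card \<tau> = n"
    and "\<And>\<rho>. x \<rho> \<noteq> (0 :: 'k::comm_ring_1) \<Longrightarrow> card \<rho> = n \<and> (\<forall>\<sigma>. (\<sigma>, \<rho>) \<notin> A)"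
  shows "(\<Sum>\<rho>\<in>Pow G. x \<rho> * path_sum \<rho> \<tau>) = x \<tau>"
proof -
  have "x \<rho> * path_sum \<rho> \<tau> = (if \<rho> = \<tau> then x \<rho> else 0)" for \<rho>
    using path_sum_critical[OF assms(1), of \<rho>, where 'k='k] assms(2,3) by (cases "x \<rho> = 0") auto
  moreover have "\<tau> \<in> Pow G" using assms(1) unfolding critical_def by blast
  ultimately show ?thesis using finite_Pow_gens by (simp add: sum.delta)
qed

lemma sum_swap_mcoeff:
  "(\<Sum>\<kappa>\<in>C. (\<Sum>\<rho>\<in>Pow G. x \<rho> * path_sum \<rho> \<kappa>) * mcoeff \<kappa> \<tau>) =
    (\<Sum>\<rho>\<in>Pow G. x \<rho> * (\<Sum>\<kappa>\<in>C. path_sum \<rho> \<kappa> * (mcoeff \<kappa> \<tau> :: 'k::comm_ring_1)))"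
  by (simp add: sum_distrib_left sum_distrib_right mult.assoc) (rule sum.swap)

text \<open>
  The projection by path sums is a chain map. Both sides vanish on sources and agree on critical
  sets. For the target \<open>\<rho>\<close> of \<open>\<sigma>\<close> the difference of the two sides has boundary sum zero over the
  facets of \<open>\<sigma>\<close>, and all facets other than \<open>\<rho>\<close> come later in the acyclic graph, so the induction
  hypothesis leaves only the term of \<open>\<rho>\<close>.
\<close>

lemma mcoeff_eq_sum_critical:
  assumes "\<tau> \<in> crit" "\<rho> \<subseteq> G" "card \<rho> = Suc (card \<tau>)"
  shows "mcoeff \<rho> \<tau> = (\<Sum>\<kappa>\<in>crit_card (Suc (card \<tau>)). path_sum \<rho> \<kappa> * (mcoeff \<kappa> \<tau> :: 'k::comm_ring_1))"
  using assms(2,3)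
proof (induction \<rho> rule: wf_induct_rule[OF wf_trancl[OF wf_converse_rev]])
  case (1 \<rho>)
  let ?C = "crit_card (Suc (card \<tau>))"
  define defect where "defect \<rho> = mcoeff \<rho> \<tau> - (\<Sum>\<kappa>\<in>?C. path_sum \<rho> \<kappa> * (mcoeff \<kappa> \<tau> :: 'k))" for \<rho>
  show ?case
  proof (cases "\<exists>\<sigma>. (\<sigma>, \<rho>) \<in> A")
    case False
    have "path_sum \<rho> \<kappa> = (if \<rho> = \<kappa> then 1 else (0::'k))" if "\<kappa> \<in> ?C" for \<kappa>
      using that path_sum_critical[of \<kappa> \<rho>, where 'k='k] 1(3) False unfolding crit_card_def by auto
    then have *: "(\<Sum>\<kappa>\<in>?C. path_sum \<rho> \<kappa> * (mcoeff \<kappa> \<tau> :: 'k)) = (if \<rho> \<in> ?C then mcoeff \<rho> \<tau> else 0)"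
      using finite_crit_card
        by (simp add: if_distrib[of "\<lambda>x. x * _"] sum.delta' cong: if_cong sum.cong)
    show ?thesis
    proof (cases "\<rho> \<in> ?C")
      case nc: False
      then have "\<rho> \<notin> crit" using 1(3) unfolding crit_card_def by simp
      then obtain \<rho>' where \<rho>': "(\<rho>, \<rho>') \<in> A" using 1(2) False unfolding critical_def by auto
      have "mcoeff \<rho> \<tau> = (0::'k)"
        using matchingD(3)[OF \<rho>'] 1(3) by (intro mcoeff_source[OF \<rho>' assms(1)]) simp
      then show ?thesis using * nc by simp
    qed (use * in simp)
  next
    case True
    then obtain \<sigma> where \<sigma>: "(\<sigma>, \<rho>) \<in> A" by blast
    have up_edge: "(\<rho>, \<sigma>) \<in> rev_graph" using \<sigma> unfolding reversed_edges_def by blast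
    have "(\<Sum>\<kappa>\<in>?C. (\<Sum>\<rho>'\<in>Pow G. bd_coeff \<sigma> \<rho>' * path_sum \<rho>' \<kappa>) * (mcoeff \<kappa> \<tau> :: 'k)) = 0"
    proof (rule sum.neutral, rule ballI)
      fix \<kappa> assume "\<kappa> \<in> ?C"
      then have "mcoeff \<sigma> \<kappa> = (0::'k)"
        using 1(3) unfolding crit_card_def by (intro mcoeff_source[OF \<sigma>]) auto
      then show "(\<Sum>\<rho>'\<in>Pow G. bd_coeff \<sigma> \<rho>' * path_sum \<rho>' \<kappa>) * (mcoeff \<kappa> \<tau> :: 'k) = 0"
        unfolding mcoeff_eq[of \<sigma>] by simp
    qed
    then have "(\<Sum>\<rho>'\<in>Pow G. bd_coeff \<sigma> \<rho>' * defect \<rho>') = 0"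
      unfolding defect_def right_diff_distrib sum_subtractf sum_swap_mcoeff sum_bd_coeff_mcoeff by simp
    moreover have "bd_coeff \<sigma> \<rho>' * defect \<rho>' = 0" if "\<rho>' \<noteq> \<rho>" for \<rho>'
    proof (cases "bd_coeff \<sigma> \<rho>' = (0::'k)")
      case False
      note T = bd_coeff_nonzeroD[OF False]
      have "(\<sigma>, \<rho>') \<in> rev_graph"
        using T(1) target_unique[OF \<sigma>, of \<rho>'] that unfolding reversed_edges_def by blast
      then have "(\<rho>, \<rho>') \<in> rev_graph\<^sup>+" using up_edge by auto
      then have "(\<rho>', \<rho>) \<in> (rev_graph\<inverse>)\<^sup>+" by (simp add: trancl_converse)
      moreover have "\<rho>' \<subseteq> G" "card \<rho>' = Suc (card \<tau>)"
        using T matchingD(3)[OF \<sigma>] 1(3) by auto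
      ultimately show ?thesis using 1(1)[of \<rho>'] unfolding defect_def by simp
    qed simp
    ultimately have "bd_coeff \<sigma> \<rho> * defect \<rho> = 0"
      using 1(2) finite_Pow_gens sum.remove[of "Pow G" \<rho> "\<lambda>\<rho>'. bd_coeff \<sigma> \<rho>' * defect \<rho>'"]
      by (simp add: sum.neutral)
    then have "(bd_coeff \<sigma> \<rho> * bd_coeff \<sigma> \<rho>) * defect \<rho> = 0" by (simp add: mult.assoc)
    then show ?thesis unfolding bd_coeff_square[OF matchingD(4)[OF \<sigma>]] defect_def by simp
  qed
qed

lemma mcoeff_mcoeff:
  assumes "\<tau> \<in> crit" "\<sigma> \<subseteq> G" "card \<sigma> = Suc (Suc (card \<tau>))"
  shows "(\<Sum>\<kappa>\<in>crit_card (Suc (card \<tau>)). mcoeff \<sigma> \<kappa> * mcoeff \<kappa> \<tau>) = (0 :: 'k::comm_ring_1)"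
proof -
  have "(\<Sum>\<kappa>\<in>crit_card (Suc (card \<tau>)). mcoeff \<sigma> \<kappa> * (mcoeff \<kappa> \<tau> :: 'k)) =
    (\<Sum>\<rho>\<in>Pow G. bd_coeff \<sigma> \<rho> * (\<Sum>\<kappa>\<in>crit_card (Suc (card \<tau>)). path_sum \<rho> \<kappa> * mcoeff \<kappa> \<tau>))"
    unfolding mcoeff_eq[of \<sigma>] by (rule sum_swap_mcoeff)
  also have "\<dots> = (\<Sum>\<rho>\<in>Pow G. bd_coeff \<sigma> \<rho> * mcoeff \<rho> \<tau>)"
  proof (rule sum.cong)
    fix \<rho> assume "\<rho> \<in> Pow G"
    then show "bd_coeff \<sigma> \<rho> * (\<Sum>\<kappa>\<in>crit_card (Suc (card \<tau>)). path_sum \<rho> \<kappa> * mcoeff \<kappa> \<tau>) =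
        bd_coeff \<sigma> \<rho> * (mcoeff \<rho> \<tau> :: 'k)"
      using bd_coeff_nonzeroD(4)[of \<sigma> \<rho>, where 'k='k] assms(3)
        mcoeff_eq_sum_critical[OF assms(1), of \<rho>, where 'k='k]
      by (cases "bd_coeff \<sigma> \<rho> = (0::'k)") auto
  qed simp
  finally show ?thesis unfolding sum_bd_coeff_mcoeff .
qed

text \<open>
  Among the sources in the support of \<open>s\<close> one is not reachable from the others. Its target is a
  facet of no other source in the support: from such a source one could step down to the target
  and up again.
\<close>

lemma boundary_source_injective:
  fixes s :: "'v mon set \<Rightarrow> 'k::comm_ring_1"
  assumes supp: "\<And>\<sigma>. s \<sigma> \<noteq> 0 \<Longrightarrow> \<exists>\<rho>. (\<sigma>, \<rho>) \<in> A" and cycle: "\<And>\<tau>. boundary s \<tau> = 0"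
  shows "s \<sigma> = 0"
proof (induction \<sigma> rule: wf_induct_rule[OF wf_trancl[OF wf_rev]])
  case (1 \<sigma>)
  show ?case
  proof (cases "\<exists>\<rho>. (\<sigma>, \<rho>) \<in> A")
    case True
    then obtain \<rho> where \<rho>: "(\<sigma>, \<rho>) \<in> A" by blast
    have "s \<sigma>' * bd_coeff \<sigma>' \<rho> = 0" if "\<sigma>' \<noteq> \<sigma>" for \<sigma>'
    proof (cases "bd_coeff \<sigma>' \<rho> = (0::'k)")
      case False
      then have "(\<sigma>', \<rho>) \<in> rev_graph"
        using bd_coeff_nonzeroD(1)[OF False] source_unique[OF \<rho>, of \<sigma>'] that
        unfolding reversed_edges_def by blast
      moreover have "(\<rho>, \<sigma>) \<in> rev_graph" using \<rho> unfolding reversed_edges_def by blast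
      ultimately have "s \<sigma>' = 0" by (intro 1) auto
      then show ?thesis by simp
    qed simp
    then have "s \<sigma> * bd_coeff \<sigma> \<rho> = 0"
      using cycle[of \<rho>] matchingD(1)[OF \<rho>] finite_Pow_gens
        sum.remove[of "Pow G" \<sigma> "\<lambda>\<sigma>'. s \<sigma>' * bd_coeff \<sigma>' \<rho>"]
      unfolding boundary_def by (simp add: sum.neutral)
    then have "s \<sigma> * (bd_coeff \<sigma> \<rho> * bd_coeff \<sigma> \<rho>) = 0" by (simp flip: mult.assoc)
    then show ?thesis unfolding bd_coeff_square[OF matchingD(4)[OF \<rho>]] by simp
  qed (use supp in blast)
qed

text \<open>
  Subtracting the boundary of \<open>t\<close> makes \<open>w\<close> vanish on the targets; this moves a chain off the
  matching.
\<close>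

definition clears ::
    "'v mon set \<Rightarrow> nat \<Rightarrow> ('v mon set \<Rightarrow> 'k::comm_ring_1) \<Rightarrow> ('v mon set \<Rightarrow> 'k) \<Rightarrow> bool" where
  "clears U m w t \<longleftrightarrow>
     (\<forall>\<sigma>. t \<sigma> \<noteq> 0 \<longrightarrow> (\<exists>\<tau>. (\<sigma>, \<tau>) \<in> A) \<and> \<sigma> \<subseteq> U \<and> card \<sigma> = Suc m) \<and>
     (\<forall>\<sigma> \<tau>. (\<sigma>, \<tau>) \<in> A \<longrightarrow> boundary t \<tau> = w \<tau>)"

text \<open>
  The matrix between sources and targets is triangular for the acyclic order. Subtracting \<open>\<sigma>\<close> with
  the right sign clears its target \<open>\<rho>\<close> at the expense of the other facets of \<open>\<sigma>\<close>, which come later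
  and are cleared by induction. Closedness of \<open>U\<close> under going up keeps everything inside \<open>U\<close>.
\<close>

lemma clear_target:
  assumes closed: "\<And>\<sigma> \<tau>. (\<sigma>, \<tau>) \<in> A \<Longrightarrow> \<tau> \<subseteq> U \<Longrightarrow> \<sigma> \<subseteq> U"
    and "\<rho> \<subseteq> U" "card \<rho> = m"
  shows "\<exists>t :: 'v mon set \<Rightarrow> 'k::comm_ring_1. clears U m (\<lambda>\<tau>. if \<tau> = \<rho> then 1 else 0) t"
  using assms(2,3)
proof (induction \<rho> rule: wf_induct_rule[OF wf_trancl[OF wf_converse_rev]])
  case (1 \<rho>)
  show ?case
  proof (cases "\<exists>\<sigma>. (\<sigma>, \<rho>) \<in> A")
    case False
    then show ?thesis by (intro exI[of _ "\<lambda>_. 0"]) (auto simp: boundary_def clears_def)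
  next
    case True
    then obtain \<sigma> where \<sigma>: "(\<sigma>, \<rho>) \<in> A" by blast
    note \<sigma>' = matchingD[OF \<sigma>]
    have \<sigma>U: "\<sigma> \<subseteq> U" using closed[OF \<sigma>] 1(2) by blast
    define F where "F = {\<rho>'\<in>Pow G. (\<sigma>, \<rho>') \<in> taylor_edges G \<and> \<rho>' \<noteq> \<rho>}"
    have finF: "finite F" unfolding F_def using finite_Pow_gens by simp
    have "\<forall>\<rho>'\<in>F. \<exists>t :: 'v mon set \<Rightarrow> 'k. clears U m (\<lambda>\<tau>. if \<tau> = \<rho>' then 1 else 0) t"
    proof
      fix \<rho>' assume \<rho>': "\<rho>' \<in> F"
      then have T: "(\<sigma>, \<rho>') \<in> taylor_edges G" unfolding F_def by blast
      have "(\<rho>, \<sigma>) \<in> rev_graph" using \<sigma> unfolding reversed_edges_def by blast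
      moreover have "(\<sigma>, \<rho>') \<in> rev_graph"
        using T target_unique[OF \<sigma>, of \<rho>'] \<rho>' unfolding reversed_edges_def F_def by blast
      ultimately have "(\<rho>, \<rho>') \<in> rev_graph\<^sup>+" by auto
      then have "(\<rho>', \<rho>) \<in> (rev_graph\<inverse>)\<^sup>+" by (simp add: trancl_converse)
      moreover have "\<rho>' \<subseteq> U" "card \<rho>' = m"
        using T \<sigma>U \<sigma>'(3) 1(3) unfolding taylor_edges_def by auto
      ultimately show "\<exists>t :: 'v mon set \<Rightarrow> 'k. clears U m (\<lambda>\<tau>. if \<tau> = \<rho>' then 1 else 0) t"
        by (rule 1(1))
    qed
    then obtain tt where tt: "\<forall>\<rho>'\<in>F. clears U m (\<lambda>\<tau>. if \<tau> =
        \<rho>' then 1 else 0) (tt \<rho>' :: 'v mon set \<Rightarrow> 'k)"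
      by (rule bchoice[THEN exE])
    have supp: "(\<exists>\<tau>. (\<kappa>, \<tau>) \<in> A) \<and> \<kappa> \<subseteq> U \<and> card \<kappa> = Suc m" if "\<rho>' \<in> F" "tt \<rho>' \<kappa> \<noteq> 0" for \<rho>' \<kappa>
      using tt that unfolding clears_def by blast
    have bdtt: "boundary (tt \<rho>') \<tau> = (if \<tau> = \<rho>' then 1 else 0)" if "\<rho>' \<in> F" "(\<kappa>, \<tau>) \<in> A" for \<rho>' \<kappa> \<tau>
      using tt that unfolding clears_def by blast
    define t where "t \<kappa> =
        bd_coeff \<sigma> \<rho> * ((if \<kappa> = \<sigma> then 1 else 0) - (\<Sum>\<rho>'\<in>F. bd_coeff \<sigma> \<rho>' * tt \<rho>' \<kappa>))" for \<kappa>
    have "(\<exists>\<tau>. (\<kappa>, \<tau>) \<in> A) \<and> \<kappa> \<subseteq> U \<and> card \<kappa> = Suc m" if "t \<kappa> \<noteq> 0" for \<kappa>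
    proof (cases "\<kappa> = \<sigma>")
      case True
      then show ?thesis using \<sigma> \<sigma>U \<sigma>'(3) 1(3) by auto
    next
      case False
      then have "(\<Sum>\<rho>'\<in>F. bd_coeff \<sigma> \<rho>' * tt \<rho>' \<kappa>) \<noteq> 0" using that unfolding t_def by auto
      then obtain \<rho>' where "\<rho>' \<in> F" "bd_coeff \<sigma> \<rho>' * tt \<rho>' \<kappa> \<noteq> 0" by (meson sum.neutral)
      then show ?thesis using supp[of \<rho>' \<kappa>] by fastforce
    qed
    moreover have "boundary t \<tau> = (if \<tau> = \<rho> then 1 else 0)" if \<tau>: "(\<kappa>, \<tau>) \<in> A" for \<kappa> \<tau>
    proof -
      have "(\<Sum>\<rho>'\<in>F. bd_coeff \<sigma> \<rho>' * boundary (tt \<rho>') \<tau>) = (\<Sum>\<rho>'\<in>F. if \<rho>' = \<tau> then bd_coeff \<sigma> \<rho>' else 0)"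
        using bdtt[OF _ \<tau>] by (intro sum.cong) auto
      also have "\<dots> = (if \<tau> \<in> F then bd_coeff \<sigma> \<tau> else 0)" using finF by (simp add: sum.delta)
      finally have "boundary t \<tau> = bd_coeff \<sigma> \<rho> * (bd_coeff \<sigma> \<tau> - (if \<tau> \<in> F then bd_coeff \<sigma> \<tau> else 0))"
        unfolding t_def boundary_cmult boundary_diff boundary_sum boundary_delta[OF \<sigma>'(1)] by simp
      also have "\<dots> = (if \<tau> = \<rho> then 1 else 0)"
      proof (cases "\<tau> = \<rho>")
        case True
        then show ?thesis using bd_coeff_square[OF \<sigma>'(4), where 'k='k] unfolding F_def by simp
      next
        case False
        then show ?thesis using bd_coeff_nonzeroD[of \<sigma> \<tau>, where 'k='k] unfolding F_def
          by (cases "bd_coeff \<sigma> \<tau> = (0::'k)") auto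
      qed
      finally show ?thesis .
    qed
    ultimately show ?thesis unfolding clears_def by (intro exI[of _ t]) blast
  qed
qed

lemma clear_targets:
  fixes w :: "'v mon set \<Rightarrow> 'k::comm_ring_1"
  assumes closed: "\<And>\<sigma> \<tau>. (\<sigma>, \<tau>) \<in> A \<Longrightarrow> \<tau> \<subseteq> U \<Longrightarrow> \<sigma> \<subseteq> U"
    and "U \<subseteq> G" and suppw: "\<And>\<rho>. w \<rho> \<noteq> 0 \<Longrightarrow> \<rho> \<subseteq> U \<and> card \<rho> = m"
  shows "\<exists>t. clears U m w t"
proof -
  define F where "F = {\<rho>\<in>Pow U. card \<rho> = m}"
  have finF: "finite F" unfolding F_def using finite_gens_subset[OF assms(2)] by simp
  have "\<forall>\<rho>\<in>F. \<exists>t :: 'v mon set \<Rightarrow> 'k. clears U m (\<lambda>\<tau>. if \<tau> = \<rho> then 1 else 0) t"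
    unfolding F_def by (auto intro: clear_target[OF closed])
  then obtain tt where tt: "\<forall>\<rho>\<in>F. clears U m (\<lambda>\<tau>. if \<tau> = \<rho> then 1 else 0) (tt \<rho> :: 'v mon set \<Rightarrow> 'k)"
    by (rule bchoice[THEN exE])
  have supp: "(\<exists>\<tau>. (\<kappa>, \<tau>) \<in> A) \<and> \<kappa> \<subseteq> U \<and> card \<kappa> = Suc m" if "\<rho> \<in> F" "tt \<rho> \<kappa> \<noteq> 0" for \<rho> \<kappa>
    using tt that unfolding clears_def by blast
  have bdtt: "boundary (tt \<rho>) \<tau> = (if \<tau> = \<rho> then 1 else 0)" if "\<rho> \<in> F" "(\<kappa>, \<tau>) \<in> A" for \<rho> \<kappa> \<tau>
    using tt that unfolding clears_def by blast
  define t where "t \<kappa> = (\<Sum>\<rho>\<in>F. w \<rho> * tt \<rho> \<kappa>)" for \<kappa>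
  have "(\<exists>\<tau>. (\<kappa>, \<tau>) \<in> A) \<and> \<kappa> \<subseteq> U \<and> card \<kappa> = Suc m" if "t \<kappa> \<noteq> 0" for \<kappa>
  proof -
    obtain \<rho> where "\<rho> \<in> F" "w \<rho> * tt \<rho> \<kappa> \<noteq> 0" using \<open>t \<kappa> \<noteq> 0\<close> unfolding t_def by (meson sum.neutral)
    then show ?thesis using supp[of \<rho> \<kappa>] by fastforce
  qed
  moreover have "boundary t \<tau> = w \<tau>" if \<tau>: "(\<kappa>, \<tau>) \<in> A" for \<kappa> \<tau>
  proof -
    have "boundary t \<tau> = (\<Sum>\<rho>\<in>F. w \<rho> * boundary (tt \<rho>) \<tau>)"
      unfolding t_def boundary_sum boundary_cmult ..
    also have "\<dots> = (\<Sum>\<rho>\<in>F. if \<rho> = \<tau> then w \<rho> else 0)"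
      using bdtt[OF _ \<tau>] by (intro sum.cong) auto
    also have "\<dots> = (if \<tau> \<in> F then w \<tau> else 0)" using finF by (simp add: sum.delta)
    finally show ?thesis using suppw[of \<tau>] unfolding F_def by auto
  qed
  ultimately show ?thesis unfolding clears_def by (intro exI[of _ t]) blast
qed


lemma path_sum_closed_support:
  assumes closed: "\<And>\<sigma> \<tau>. (\<sigma>, \<tau>) \<in> A \<Longrightarrow> \<tau> \<subseteq> U \<Longrightarrow> \<sigma> \<subseteq> U"
    and "\<rho> \<subseteq> U" "\<not> \<kappa> \<subseteq> U"
  shows "path_sum \<rho> \<kappa> = (0 :: 'k::comm_ring_1)"
  using assms(2)
proof (induction \<rho> rule: wf_induct_rule[OF wf_converse_rev])
  case (1 \<rho>)
  have "step_coeff \<rho> \<rho>' * path_sum \<rho>' \<kappa> = (0::'k)" for \<rho>'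
  proof (cases "step_coeff \<rho> \<rho>' = (0::'k)")
    case False
    then have "(\<rho>, \<rho>') \<in> rev_graph \<and> \<rho>' \<subseteq> U"
    proof (cases rule: step_coeff_nonzeroD)
      case up
      then show ?thesis using closed 1(2) by blast
    next
      case down
      then show ?thesis using 1(2) unfolding taylor_edges_def by blast
    qed
    then have "path_sum \<rho>' \<kappa> = (0::'k)" by (intro 1(1)) auto
    then show ?thesis by simp
  qed simp
  moreover have "\<rho> \<noteq> \<kappa>" using 1(2) assms(3) by blast
  ultimately show ?case using path_sum_unfold[of \<rho> \<kappa>, where 'k='k] by simp
qed

lemma sum_boundary_path_sum:
  "(\<Sum>\<rho>\<in>Pow G. boundary x \<rho> * path_sum \<rho> \<tau>) = (\<Sum>\<sigma>\<in>Pow G. x \<sigma> * (mcoeff \<sigma> \<tau> :: 'k::comm_ring_1))"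
  unfolding boundary_def mcoeff_eq sum_distrib_left sum_distrib_right mult.assoc by (rule sum.swap)

text \<open>
  Subtract from \<open>z\<close> a chain \<open>t\<close> of sources such that \<open>z - t\<close> has no boundary on the targets. The
  remaining boundary has no critical part either, because \<open>z\<close> is a Morse cycle and \<open>t\<close> projects to
  zero. So it is a chain of sources without boundary, hence zero.
\<close>

lemma morse_cycle_lift:
  fixes z :: "'v mon set \<Rightarrow> 'k::comm_ring_1"
  assumes closed: "\<And>\<sigma> \<tau>. (\<sigma>, \<tau>) \<in> A \<Longrightarrow> \<tau> \<subseteq> U \<Longrightarrow> \<sigma> \<subseteq> U" and "U \<subseteq> G"
    and supp: "\<And>\<sigma>. z \<sigma> \<noteq> 0 \<Longrightarrow> \<sigma> \<in> crit \<and> \<sigma> \<subseteq> U \<and> card \<sigma> = n"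
    and cycle: "\<And>\<tau>. \<tau> \<in> crit \<Longrightarrow> Suc (card \<tau>) = n \<Longrightarrow> (\<Sum>\<sigma>\<in>Pow G. z \<sigma> * mcoeff \<sigma> \<tau>) = 0"
  shows "\<exists>t. (\<forall>\<sigma>. t \<sigma> \<noteq> 0 \<longrightarrow> (\<exists>\<tau>. (\<sigma>, \<tau>) \<in> A) \<and> \<sigma> \<subseteq> U \<and> card \<sigma> = n) \<and>
    (\<forall>\<tau>. boundary (\<lambda>\<sigma>. z \<sigma> - t \<sigma>) \<tau> = 0)"
proof (cases n)
  case 0
  have "z \<sigma> * bd_coeff \<sigma> \<tau> = 0" for \<sigma> \<tau>
  proof (rule ccontr)
    assume "z \<sigma> * bd_coeff \<sigma> \<tau> \<noteq> 0"
    then have "z \<sigma> \<noteq> 0" "bd_coeff \<sigma> \<tau> \<noteq> (0::'k)" by auto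
    then show False using supp[of \<sigma>] bd_coeff_nonzeroD(4)[of \<sigma> \<tau>, where 'k='k] 0 by simp
  qed
  then show ?thesis by (intro exI[of _ "\<lambda>_. 0"]) (simp add: boundary_def)
next
  case (Suc m)
  have bdz: "\<rho> \<subseteq> U \<and> card \<rho> = m" if nz: "boundary z \<rho> \<noteq> 0" for \<rho>
  proof -
    obtain \<sigma> where "z \<sigma> * bd_coeff \<sigma> \<rho> \<noteq> 0" using nz unfolding boundary_def by (meson sum.neutral)
    then have "z \<sigma> \<noteq> 0" "bd_coeff \<sigma> \<rho> \<noteq> (0::'k)" by auto
    then show ?thesis using supp[of \<sigma>] bd_coeff_nonzeroD[of \<sigma> \<rho>, where 'k='k] Suc by auto
  qed
  have "\<exists>t. clears U m (boundary z) t"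
    by (rule clear_targets) (use closed assms(2) bdz in blast)+
  then obtain t where "clears U m (boundary z) t" ..
  then have t: "\<And>\<sigma>. t \<sigma> \<noteq> 0 \<Longrightarrow> (\<exists>\<tau>. (\<sigma>, \<tau>) \<in> A) \<and> \<sigma> \<subseteq> U \<and> card \<sigma> = n"
    and on_targets: "\<And>\<sigma> \<tau>. (\<sigma>, \<tau>) \<in> A \<Longrightarrow> boundary t \<tau> = boundary z \<tau>"
    unfolding clears_def Suc by auto
  define c where "c \<sigma> = z \<sigma> - t \<sigma>" for \<sigma>
  have suppc: "card \<sigma> = n" if "c \<sigma> \<noteq> 0" for \<sigma>
    using that supp[of \<sigma>] t[of \<sigma>] unfolding c_def by (cases "z \<sigma> = 0") auto
  have bdc: "card \<rho> = m \<and> (\<forall>\<sigma>. (\<sigma>, \<rho>) \<notin> A)" if nz: "boundary c \<rho> \<noteq> 0" for \<rho>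
  proof -
    obtain \<sigma> where "c \<sigma> * bd_coeff \<sigma> \<rho> \<noteq> 0" using nz unfolding boundary_def by (meson sum.neutral)
    then have "c \<sigma> \<noteq> 0" "bd_coeff \<sigma> \<rho> \<noteq> (0::'k)" by auto
    then have "card \<rho> = m" using suppc[of \<sigma>] bd_coeff_nonzeroD(4)[of \<sigma> \<rho>, where 'k='k] Suc by simp
    moreover have "\<forall>\<sigma>. (\<sigma>, \<rho>) \<notin> A"
      using on_targets nz unfolding c_def boundary_diff by (metis diff_self)
    ultimately show ?thesis by blast
  qed
  have "\<exists>\<tau>. (\<rho>, \<tau>) \<in> A" if nz: "boundary c \<rho> \<noteq> 0" for \<rho>
  proof (rule ccontr)
    assume no: "\<nexists>\<tau>. (\<rho>, \<tau>) \<in> A"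
    obtain \<sigma> where "c \<sigma> * bd_coeff \<sigma> \<rho> \<noteq> 0" using nz unfolding boundary_def by (meson sum.neutral)
    then have "bd_coeff \<sigma> \<rho> \<noteq> (0::'k)" by auto
    then have "\<rho> \<subseteq> G" using bd_coeff_nonzeroD(2,3)[of \<sigma> \<rho>, where 'k='k] by blast
    then have \<rho>: "\<rho> \<in> crit" "card \<rho> = m" using no bdc[OF nz] unfolding critical_def by auto
    have "t \<sigma> * mcoeff \<sigma> \<rho> = 0" for \<sigma>
    proof (cases "t \<sigma> = 0")
      case False
      then obtain \<tau> where \<tau>: "(\<sigma>, \<tau>) \<in> A" "card \<sigma> = n" using t by blast
      then have "mcoeff \<sigma> \<rho> = (0::'k)"
        using matchingD(3)[OF \<tau>(1)] \<rho> Suc by (intro mcoeff_source) auto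
      then show ?thesis by simp
    qed simp
    then have "(\<Sum>\<sigma>\<in>Pow G. c \<sigma> * mcoeff \<sigma> \<rho>) = 0"
      using cycle[OF \<rho>(1)] \<rho>(2) Suc unfolding c_def by (simp add: left_diff_distrib sum_subtractf)
    moreover have "(\<Sum>\<tau>\<in>Pow G. boundary c \<tau> * path_sum \<tau> \<rho>) = boundary c \<rho>"
      by (rule sum_path_sum_critical[OF \<rho>]) (rule bdc)
    ultimately have "boundary c \<rho> = 0" unfolding sum_boundary_path_sum by simp
    then show False using nz by blast
  qed
  then have "boundary c \<tau> = 0" for \<tau>
    by (rule boundary_source_injective) (simp_all add: boundary_boundary)
  then show ?thesis using t unfolding c_def by (intro exI[of _ t]) blast
qed

text \<open>
  The lift \<open>z - t\<close> of a Morse cycle \<open>z\<close> bounds in the simplex; projecting the bounding chain to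
  the critical sets gives a chain with Morse boundary \<open>z\<close>, as \<open>t\<close> projects to zero.
\<close>

theorem morse_strand_exact:
  fixes z :: "'v mon set \<Rightarrow> 'k::comm_ring_1"
  assumes closed: "\<And>\<sigma> \<tau>. (\<sigma>, \<tau>) \<in> A \<Longrightarrow> \<tau> \<subseteq> U \<Longrightarrow> \<sigma> \<subseteq> U" and "U \<subseteq> G" "U \<noteq> {}"
    and supp: "\<And>\<sigma>. z \<sigma> \<noteq> 0 \<Longrightarrow> \<sigma> \<in> crit \<and> \<sigma> \<subseteq> U \<and> card \<sigma> = n"
    and cycle: "\<And>\<tau>. \<tau> \<in> crit \<Longrightarrow> Suc (card \<tau>) = n \<Longrightarrow> (\<Sum>\<sigma>\<in>Pow G. z \<sigma> * mcoeff \<sigma> \<tau>) = 0"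
  shows "\<exists>y. (\<forall>\<sigma>. y \<sigma> \<noteq> 0 \<longrightarrow> \<sigma> \<in> crit \<and> \<sigma> \<subseteq> U \<and> card \<sigma> = Suc n) \<and>
    (\<forall>\<tau>\<in>crit. card \<tau> = n \<longrightarrow> (\<Sum>\<sigma>\<in>crit_card (Suc n). y \<sigma> * mcoeff \<sigma> \<tau>) = z \<tau>)"
proof -
  have "\<exists>t. (\<forall>\<sigma>. t \<sigma> \<noteq> 0 \<longrightarrow> (\<exists>\<tau>. (\<sigma>, \<tau>) \<in> A) \<and> \<sigma> \<subseteq> U \<and> card \<sigma> = n) \<and>
    (\<forall>\<tau>. boundary (\<lambda>\<sigma>. z \<sigma> - t \<sigma>) \<tau> = 0)"
    by (rule morse_cycle_lift) (use closed assms(2) supp cycle in blast)+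
  then obtain t where t: "\<And>\<sigma>. t \<sigma> \<noteq> 0 \<Longrightarrow> (\<exists>\<tau>. (\<sigma>, \<tau>) \<in> A) \<and> \<sigma> \<subseteq> U \<and> card \<sigma> = n"
    and bdc: "\<And>\<tau>. boundary (\<lambda>\<sigma>. z \<sigma> - t \<sigma>) \<tau> = 0"
    by blast
  define c where "c \<sigma> = z \<sigma> - t \<sigma>" for \<sigma>
  have suppc: "\<sigma> \<subseteq> U \<and> card \<sigma> = n \<and> (\<forall>\<rho>. (\<rho>, \<sigma>) \<notin> A)" if "c \<sigma> \<noteq> 0" for \<sigma>
  proof (cases "z \<sigma> = 0")
    case True
    then have "t \<sigma> \<noteq> 0" using that unfolding c_def by auto
    then show ?thesis using t not_source_and_target by blast
  next
    case False
    then show ?thesis using supp[OF False] matchingD(6) by blast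
  qed
  obtain x where x: "\<And>\<sigma>. x \<sigma> \<noteq> 0 \<Longrightarrow> \<sigma> \<subseteq> U \<and> card \<sigma> = Suc n" and bdx: "boundary x = c"
    using simplex_exact[OF assms(2,3), of c n] suppc bdc unfolding c_def by blast
  define y where "y \<kappa> = (if \<kappa> \<in> crit_card (Suc n) then \<Sum>\<rho>\<in>Pow G. x \<rho> * path_sum \<rho> \<kappa> else 0)" for \<kappa>
  have "\<kappa> \<in> crit \<and> \<kappa> \<subseteq> U \<and> card \<kappa> = Suc n" if nz: "y \<kappa> \<noteq> 0" for \<kappa>
  proof -
    have \<kappa>: "\<kappa> \<in> crit_card (Suc n)" and "(\<Sum>\<rho>\<in>Pow G. x \<rho> * path_sum \<rho> \<kappa>) \<noteq> 0"
      using nz unfolding y_def by (auto split: if_splits)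
    then obtain \<rho> where "x \<rho> * path_sum \<rho> \<kappa> \<noteq> 0" by (meson sum.neutral)
    then have "x \<rho> \<noteq> 0" "path_sum \<rho> \<kappa> \<noteq> (0::'k)" by auto
    then have "\<rho> \<subseteq> U" using x by blast
    have "\<kappa> \<subseteq> U"
    proof (rule ccontr)
      assume "\<not> \<kappa> \<subseteq> U"
      with closed \<open>\<rho> \<subseteq> U\<close> have "path_sum \<rho> \<kappa> = (0::'k)" by (rule path_sum_closed_support)
      then show False using \<open>path_sum \<rho> \<kappa> \<noteq> (0::'k)\<close> by blast
    qed
    then show ?thesis using \<kappa> unfolding crit_card_def by blast
  qed
  moreover have "(\<Sum>\<sigma>\<in>crit_card (Suc n). y \<sigma> * mcoeff \<sigma> \<tau>) = z \<tau>" if \<tau>: "\<tau> \<in> crit" "card \<tau> = n" for \<tau>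
  proof -
    have "(\<Sum>\<sigma>\<in>crit_card (Suc n). y \<sigma> * mcoeff \<sigma> \<tau>) =
        (\<Sum>\<kappa>\<in>crit_card (Suc n). (\<Sum>\<rho>\<in>Pow G. x \<rho> * path_sum \<rho> \<kappa>) * mcoeff \<kappa> \<tau>)"
      unfolding y_def by (intro sum.cong) auto
    also have "\<dots> = (\<Sum>\<rho>\<in>Pow G. x \<rho> * (\<Sum>\<kappa>\<in>crit_card (Suc n). path_sum \<rho> \<kappa> * mcoeff \<kappa> \<tau>))"
      by (rule sum_swap_mcoeff)
    also have "\<dots> = (\<Sum>\<rho>\<in>Pow G. x \<rho> * mcoeff \<rho> \<tau>)"
    proof (rule sum.cong)
      fix \<rho> assume "\<rho> \<in> Pow G"
      then show "x \<rho> * (\<Sum>\<kappa>\<in>crit_card (Suc n). path_sum \<rho> \<kappa> * mcoeff \<kappa> \<tau>) = x \<rho> * mcoeff \<rho> \<tau>"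
        using x[of \<rho>] mcoeff_eq_sum_critical[OF \<tau>(1), of \<rho>, where 'k='k] \<tau>(2)
        by (cases "x \<rho> = 0") auto
    qed simp
    also have "\<dots> = (\<Sum>\<rho>\<in>Pow G. c \<rho> * path_sum \<rho> \<tau>)" unfolding sum_boundary_path_sum[symmetric] bdx ..
    also have "\<dots> = c \<tau>" by (rule sum_path_sum_critical[OF \<tau>]) (use suppc in blast)
    also have "\<dots> = z \<tau>" using t[of \<tau>] \<tau>(1) matchingD(5) unfolding c_def by fastforce
    finally show ?thesis .
  qed
  ultimately show ?thesis by (intro exI[of _ y]) blast
qed

end


section \<open>The Morse complex over the polynomial ring\<close>

locale homogeneous_matching = acyclic_matching G r A for G :: "'v mon set" and r A +
  assumes homogeneous: "(\<sigma>, \<tau>) \<in> A \<Longrightarrow> lcm_mon \<sigma> = lcm_mon \<tau>"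
begin

definition below :: "'v mon \<Rightarrow> 'v mon set" where
  "below u = {m \<in> G. m \<le> u}"

lemma below_subset: "below u \<subseteq> G"
  unfolding below_def by blast

lemma subset_below_iff: "\<sigma> \<subseteq> G \<Longrightarrow> \<sigma> \<subseteq> below u \<longleftrightarrow> lcm_mon \<sigma> \<le> u"
  unfolding below_def using lcm_mon_le_iff[OF finite_gens_subset, of \<sigma> u] by blast

lemma below_closed:
  assumes "(\<sigma>, \<tau>) \<in> A" "\<tau> \<subseteq> below u"
  shows "\<sigma> \<subseteq> below u"
  using assms(2) homogeneous[OF assms(1)] matchingD(1,2)[OF assms(1)] by (simp add: subset_below_iff)

lemma crit_subset: "\<sigma> \<in> crit \<Longrightarrow> \<sigma> \<subseteq> G"
  unfolding critical_def by blast

lemma path_sum_nonzero_lcm: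
  assumes "\<rho> \<subseteq> G" "\<tau> \<subseteq> G" "path_sum \<rho> \<tau> \<noteq> (0 :: 'k::comm_ring_1)"
  shows "lcm_mon \<tau> \<le> lcm_mon \<rho>"
  using path_sum_closed_support[of "below (lcm_mon \<rho>)" \<rho> \<tau>, where 'k='k] below_closed assms
  by (auto simp: subset_below_iff)

text \<open>
  Along a gradient path the lcm never increases. If it agrees at both ends, already the first
  step, which removes an element of \<open>\<sigma>\<close>, preserves it.
\<close>

lemma mcoeff_nonzero_lcm:
  assumes "\<sigma> \<subseteq> G" "\<tau> \<subseteq> G" "mcoeff \<sigma> \<tau> \<noteq> (0 :: 'k::comm_ring_1)"
  shows "lcm_mon \<tau> \<le> lcm_mon \<sigma>" "lcm_mon \<tau> = lcm_mon \<sigma> \<Longrightarrow> bridges \<sigma> \<noteq> {}"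
proof -
  obtain \<rho> where "bd_coeff \<sigma> \<rho> * path_sum \<rho> \<tau> \<noteq> (0::'k)"
    using assms(3) unfolding mcoeff_eq by (meson sum.neutral)
  then have nz: "bd_coeff \<sigma> \<rho> \<noteq> (0::'k)" "path_sum \<rho> \<tau> \<noteq> (0::'k)" by auto
  obtain m where m: "m \<in> \<sigma>" "\<rho> = \<sigma> - {m}"
    using bd_coeff_nonzeroD(1)[OF nz(1)] unfolding taylor_edges_iff by blast
  have "\<rho> \<subseteq> G" using m(2) assms(1) by blast
  then have le: "lcm_mon \<tau> \<le> lcm_mon \<rho>" using path_sum_nonzero_lcm assms(2) nz(2) by blast
  have le': "lcm_mon \<rho> \<le> lcm_mon \<sigma>"
    using m finite_gens_subset[OF assms(1)] by (intro lcm_mon_mono) auto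
  show "lcm_mon \<tau> \<le> lcm_mon \<sigma>" using le le' by (rule order.trans)
  assume "lcm_mon \<tau> = lcm_mon \<sigma>"
  then have "lcm_mon \<rho> = lcm_mon \<sigma>" using le le' by (intro order.antisym) auto
  then show "bridges \<sigma> \<noteq> {}" using m unfolding bridges_def by blast
qed

text \<open>
  The component of \<open>f\<close> in multidegree \<open>u\<close>, where the basis element \<open>\<sigma>\<close> has degree \<open>lcm \<sigma>\<close>.
\<close>

definition strand ::
    "'v mon \<Rightarrow> ('v mon set \<Rightarrow> ('v, 'k::comm_ring_1) mpoly) \<Rightarrow> 'v mon set \<Rightarrow> 'k" where
  "strand u f \<sigma> = (if lcm_mon \<sigma> \<le> u then Poly_Mapping.lookup (f \<sigma>) (u - lcm_mon \<sigma>) else 0)"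

lemma strand_eqI:
  assumes "\<And>u. strand u f \<sigma> = strand u g \<sigma>"
  shows "f \<sigma> = g \<sigma>"
proof (rule poly_mapping_eqI)
  fix v
  have "lcm_mon \<sigma> \<le> v + lcm_mon \<sigma>" "v + lcm_mon \<sigma> - lcm_mon \<sigma> = v"
    by (auto simp: le_fun_def fun_eq_iff)
  then show "Poly_Mapping.lookup (f \<sigma>) v = Poly_Mapping.lookup (g \<sigma>) v"
    using assms[of "v + lcm_mon \<sigma>"] unfolding strand_def by simp
qed

lemma strand_nonzeroD:
  assumes "f \<in> morse_module G A n" "strand u f \<sigma> \<noteq> 0"
  shows "\<sigma> \<in> crit" "\<sigma> \<subseteq> below u" "card \<sigma> = n"
proof -
  have "f \<sigma> \<noteq> 0" and le: "lcm_mon \<sigma> \<le> u" using assms(2) unfolding strand_def by (auto split: if_splits)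
  then show *: "\<sigma> \<in> crit" "card \<sigma> = n" using assms(1) unfolding morse_module_def by auto
  show "\<sigma> \<subseteq> below u" using le subset_below_iff crit_subset[OF *(1)] by blast
qed

text \<open>
  The Morse differential is homogeneous: where its coefficient is nonzero, \<open>lcm \<tau>\<close> divides
  \<open>lcm \<sigma>\<close>, and the truncated subtraction of exponents is a true one.
\<close>

lemma strand_morse_diff:
  assumes "\<tau> \<in> crit"
  shows "strand u (morse_diff r G A f) \<tau> =
    (\<Sum>\<sigma>\<in>crit_card (Suc (card \<tau>)). strand u f \<sigma> * (mcoeff \<sigma> \<tau> :: 'k::comm_ring_1))"
proof -
  have "(if lcm_mon \<tau> \<le> u then Poly_Mapping.lookup
      (f \<sigma> * Poly_Mapping.single (lcm_mon \<sigma> - lcm_mon \<tau>) (mcoeff \<sigma> \<tau>)) (u - lcm_mon \<tau>) else 0) =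
      strand u f \<sigma> * mcoeff \<sigma> \<tau>" if "\<sigma> \<in> crit" for \<sigma>
  proof (cases "mcoeff \<sigma> \<tau> = (0::'k)")
    case False
    then have le: "lcm_mon \<tau> \<le> lcm_mon \<sigma>"
      using mcoeff_nonzero_lcm(1) crit_subset assms that by blast
    have "lcm_mon \<sigma> - lcm_mon \<tau> \<le> u - lcm_mon \<tau> \<longleftrightarrow> lcm_mon \<sigma> \<le> u" if "lcm_mon \<tau> \<le> u"
      using that le unfolding le_fun_def by (simp add: le_diff_iff)
    moreover have "u - lcm_mon \<tau> - (lcm_mon \<sigma> - lcm_mon \<tau>) = u - lcm_mon \<sigma>"
      using le unfolding le_fun_def by (simp add: fun_eq_iff)
    moreover have "lcm_mon \<tau> \<le> u" if "lcm_mon \<sigma> \<le> u" using le that by (rule order.trans)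
    ultimately show ?thesis by (auto simp: strand_def lookup_mult_single)
  qed simp
  note summand = this
  have "strand u (morse_diff r G A f) \<tau> = (\<Sum>\<sigma>\<in>crit_card (Suc (card \<tau>)).
      if lcm_mon \<tau> \<le> u then Poly_Mapping.lookup
      (f \<sigma> * Poly_Mapping.single (lcm_mon \<sigma> - lcm_mon \<tau>) (mcoeff \<sigma> \<tau>)) (u - lcm_mon \<tau>) else 0)"
    unfolding strand_def morse_diff_def crit_card_def
    using assms by (simp add: lookup_sum)
  also have "\<dots> = (\<Sum>\<sigma>\<in>crit_card (Suc (card \<tau>)). strand u f \<sigma> * mcoeff \<sigma> \<tau>)"
    by (intro sum.cong summand) (auto simp: crit_card_def)
  finally show ?thesis .
qed

lemma morse_diff_morse_diff: "morse_diff r G A (morse_diff r G A f) =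
  (\<lambda>_. 0 :: ('v, 'k::comm_ring_1) mpoly)"
proof
  fix \<tau>
  show "morse_diff r G A (morse_diff r G A f) \<tau> = 0"
  proof (cases "\<tau> \<in> crit")
    case True
    have "strand u (morse_diff r G A (morse_diff r G A f)) \<tau> = (0::'k)" for u
    proof -
      let ?C1 = "crit_card (Suc (card \<tau>))" and ?C2 = "crit_card (Suc (Suc (card \<tau>)))"
      have "strand u (morse_diff r G A (morse_diff r G A f)) \<tau> =
          (\<Sum>\<kappa>\<in>?C1. (\<Sum>\<sigma>\<in>?C2. strand u f \<sigma> * mcoeff \<sigma> \<kappa>) * (mcoeff \<kappa> \<tau> :: 'k))"
        unfolding strand_morse_diff[OF True]
        by (intro sum.cong) (auto simp: crit_card_def strand_morse_diff)
      also have "\<dots> = (\<Sum>\<sigma>\<in>?C2. strand u f \<sigma> * (\<Sum>\<kappa>\<in>?C1. mcoeff \<sigma> \<kappa> * mcoeff \<kappa> \<tau>))"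
        unfolding sum_distrib_left sum_distrib_right mult.assoc by (rule sum.swap)
      also have "\<dots> = 0"
        using mcoeff_mcoeff[OF True, where 'k='k] crit_subset unfolding crit_card_def
        by (intro sum.neutral) auto
      finally show ?thesis .
    qed
    moreover have "strand u (\<lambda>_. 0) \<tau> = (0::'k)" for u by (simp add: strand_def)
    ultimately show ?thesis
      using strand_eqI[of "morse_diff r G A (morse_diff r G A f)" \<tau> "\<lambda>_. 0"] by simp
  qed (simp add: morse_diff_def)
qed

lemma finite_strands:
  assumes "f \<in> morse_module G A n"
  shows "finite {u. \<exists>\<sigma>. strand u f \<sigma> \<noteq> 0}"
proof (rule finite_subset)
  show "{u. \<exists>\<sigma>. strand u f \<sigma> \<noteq> 0} \<subseteq> (\<Union>\<sigma>\<in>Pow G. (\<lambda>v. v + lcm_mon \<sigma>) ` Poly_Mapping.keys (f \<sigma>))"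
  proof
    fix u assume "u \<in> {u. \<exists>\<sigma>. strand u f \<sigma> \<noteq> 0}"
    then obtain \<sigma> where nz: "strand u f \<sigma> \<noteq> 0" by blast
    then have "lcm_mon \<sigma> \<le> u" "u - lcm_mon \<sigma> \<in> Poly_Mapping.keys (f \<sigma>)"
      unfolding strand_def by (auto simp: in_keys_iff split: if_splits)
    moreover from this have "u = u - lcm_mon \<sigma> + lcm_mon \<sigma>" by (simp add: le_fun_def fun_eq_iff)
    moreover have "\<sigma> \<in> Pow G" using strand_nonzeroD(1)[OF assms nz] crit_subset by blast
    ultimately show "u \<in> (\<Union>\<sigma>\<in>Pow G. (\<lambda>v. v + lcm_mon \<sigma>) ` Poly_Mapping.keys (f \<sigma>))" by blast
  qed
qed (simp add: finite_gens)

lemma glue_strands: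
  fixes Y :: "'v mon \<Rightarrow> 'v mon set \<Rightarrow> 'k::comm_ring_1"
  assumes "finite S" and zero: "\<And>u \<sigma>. u \<notin> S \<Longrightarrow> Y u \<sigma> = 0"
    and supp: "\<And>u \<sigma>. Y u \<sigma> \<noteq> 0 \<Longrightarrow> \<sigma> \<in> crit \<and> \<sigma> \<subseteq> below u \<and> card \<sigma> = n"
  shows "\<exists>g\<in>morse_module G A n. \<forall>u. strand u g = Y u"
proof -
  define g where "g \<sigma> = (\<Sum>u\<in>S. Poly_Mapping.single (u - lcm_mon \<sigma>) (Y u \<sigma>))" for \<sigma>
  have le: "lcm_mon \<sigma> \<le> u" if "Y u \<sigma> \<noteq> 0" for u \<sigma>
    using supp[OF that] crit_subset subset_below_iff by blast
  have "strand u g \<sigma> = Y u \<sigma>" for u \<sigma>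
  proof (cases "lcm_mon \<sigma> \<le> u")
    case True
    have "Poly_Mapping.lookup (Poly_Mapping.single (v - lcm_mon \<sigma>) (Y v \<sigma>)) (u - lcm_mon \<sigma>) =
        (if v = u then Y v \<sigma> else 0)" for v
    proof (cases "Y v \<sigma> = 0")
      case False
      have "v = u" if "v - lcm_mon \<sigma> = u - lcm_mon \<sigma>"
      proof
        fix x
        have "v x - lcm_mon \<sigma> x = u x - lcm_mon \<sigma> x" using fun_cong[OF that, of x] by simp
        moreover have "lcm_mon \<sigma> x \<le> v x" "lcm_mon \<sigma> x \<le> u x"
          using le[OF False] True by (auto simp: le_fun_def)
        ultimately show "v x = u x" by simp
      qed
      then show ?thesis by (auto simp: lookup_single when_def)
    qed auto
    then show ?thesis
      using True assms(1) zero unfolding strand_def g_def by (simp add: lookup_sum sum.delta)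
  next
    case False
    then show ?thesis using le unfolding strand_def by auto
  qed
  moreover have "g \<in> morse_module G A n"
    unfolding morse_module_def
  proof (intro CollectI allI impI)
    fix \<sigma> assume "g \<sigma> \<noteq> 0"
    then obtain u where "Poly_Mapping.single (u - lcm_mon \<sigma>) (Y u \<sigma>) \<noteq> 0"
      unfolding g_def by (meson sum.neutral)
    then have "Y u \<sigma> \<noteq> 0" by auto
    then show "\<sigma> \<in> crit \<and> card \<sigma> = n" using supp by blast
  qed
  ultimately show ?thesis by (intro bexI[of _ g]) (auto simp: fun_eq_iff)
qed

text \<open>
  A multidegree \<open>u\<close> in which no generator divides \<open>u\<close> has to be excluded: there the simplex is
  empty and the empty set does not bound. For \<open>n = 0\<close> there is no cycle condition.
\<close>

lemma morse_exact:
  fixes f :: "'v mon set \<Rightarrow> ('v, 'k::comm_ring_1) mpoly"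
  assumes f: "f \<in> morse_module G A n"
    and nonempty: "\<And>u \<sigma>. strand u f \<sigma> \<noteq> 0 \<Longrightarrow> below u \<noteq> {}"
    and cycle: "n = 0 \<or> morse_diff r G A f = (\<lambda>_. 0)"
  shows "f \<in> morse_diff r G A ` morse_module G A (Suc n)"
proof -
  \<comment> \<open>The last condition makes the chosen family finitely supported, so that it can be glued.\<close>
  define lifts where "lifts u y \<longleftrightarrow>
    (\<forall>\<sigma>. y \<sigma> \<noteq> 0 \<longrightarrow> \<sigma> \<in> crit \<and> \<sigma> \<subseteq> below u \<and> card \<sigma> = Suc n) \<and>
    (\<forall>\<tau>\<in>crit. card \<tau> = n \<longrightarrow> (\<Sum>\<sigma>\<in>crit_card (Suc n). y \<sigma> * mcoeff \<sigma> \<tau>) = strand u f \<tau>) \<and>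
    ((\<forall>\<sigma>. strand u f \<sigma> = 0) \<longrightarrow> (\<forall>\<sigma>. y \<sigma> = 0))" for u and y :: "'v mon set \<Rightarrow> 'k"
  have "\<exists>y. lifts u y" for u
  proof (cases "\<forall>\<sigma>. strand u f \<sigma> = 0")
    case True
    then show ?thesis by (intro exI[of _ "\<lambda>_. 0"]) (simp add: lifts_def)
  next
    case False
    then have "below u \<noteq> {}" using nonempty by blast
    moreover have "(\<Sum>\<sigma>\<in>Pow G. strand u f \<sigma> * mcoeff \<sigma> \<tau>) = (0::'k)"
      if \<tau>: "\<tau> \<in> crit" "Suc (card \<tau>) = n" for \<tau>
    proof -
      have "strand u f \<sigma> = 0" if "\<sigma> \<notin> crit_card n" for \<sigma>
        using strand_nonzeroD[OF f, of u \<sigma>] that unfolding crit_card_def by blast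
      then have "(\<Sum>\<sigma>\<in>Pow G. strand u f \<sigma> * mcoeff \<sigma> \<tau>) =
          (\<Sum>\<sigma>\<in>crit_card n. strand u f \<sigma> * (mcoeff \<sigma> \<tau> :: 'k))"
        using finite_Pow_gens crit_card_subset by (intro sum.mono_neutral_right) auto
      also have "\<dots> = strand u (morse_diff r G A f) \<tau>" unfolding strand_morse_diff[OF \<tau>(1)] \<tau>(2) ..
      also have "\<dots> = 0" using cycle \<tau>(2) by (auto simp: strand_def)
      finally show ?thesis .
    qed
    ultimately have "\<exists>y. (\<forall>\<sigma>. y \<sigma> \<noteq> 0 \<longrightarrow> \<sigma> \<in> crit \<and> \<sigma> \<subseteq> below u \<and> card \<sigma> = Suc n) \<and>
      (\<forall>\<tau>\<in>crit. card \<tau> = n \<longrightarrow> (\<Sum>\<sigma>\<in>crit_card (Suc n). y \<sigma> * mcoeff \<sigma> \<tau>) = strand u f \<tau>)"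
      using strand_nonzeroD[OF f, of u]
      by (intro morse_strand_exact[OF below_closed below_subset]) blast+
    then show ?thesis using False unfolding lifts_def by blast
  qed
  then obtain Y where Y: "\<And>u. lifts u (Y u)" using choice[of lifts] by blast
  then have
    supp: "\<And>u \<sigma>. Y u \<sigma> \<noteq> 0 \<Longrightarrow> \<sigma> \<in> crit \<and> \<sigma> \<subseteq> below u \<and> card \<sigma> = Suc n" and
    hit: "\<And>u \<tau>. \<tau> \<in> crit \<Longrightarrow> card \<tau> = n \<Longrightarrow>
      (\<Sum>\<sigma>\<in>crit_card (Suc n). Y u \<sigma> * mcoeff \<sigma> \<tau>) = strand u f \<tau>" and
    zero: "\<And>u \<sigma>. \<forall>\<sigma>. strand u f \<sigma> = 0 \<Longrightarrow> Y u \<sigma> = 0"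
    unfolding lifts_def by blast+
  define S where "S = {u. \<exists>\<sigma>. strand u f \<sigma> \<noteq> 0}"
  have "Y u \<sigma> = 0" if "u \<notin> S" for u \<sigma> using zero[of u] that unfolding S_def by simp
  then obtain g where g: "g \<in> morse_module G A (Suc n)" "\<And>u. strand u g = Y u"
    using glue_strands[of S Y "Suc n"] finite_strands[OF f] supp unfolding S_def by blast
  have "f \<tau> = morse_diff r G A g \<tau>" for \<tau>
  proof (cases "\<tau> \<in> crit")
    case True
    show ?thesis
    proof (rule strand_eqI)
      fix u
      show "strand u f \<tau> = strand u (morse_diff r G A g) \<tau>"
      proof (cases "card \<tau> = n")
        case True
        then show ?thesis using hit[OF \<open>\<tau> \<in> crit\<close>] by (simp add: strand_morse_diff[OF \<open>\<tau> \<in> crit\<close>] g(2))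
      next
        case False
        then have "strand u f \<tau> = 0" using strand_nonzeroD(3)[OF f] by blast
        moreover have "Y u \<sigma> = 0" if "\<sigma> \<in> crit_card (Suc (card \<tau>))" for \<sigma>
          using supp[of u \<sigma>] that False unfolding crit_card_def by auto
        ultimately show ?thesis by (simp add: strand_morse_diff[OF \<open>\<tau> \<in> crit\<close>] g(2))
      qed
    qed
  next
    case False
    then show ?thesis using f unfolding morse_module_def morse_diff_def by auto
  qed
  then show ?thesis using g(1) by blast
qed

text \<open>
  Since the empty set is critical, the coordinate at the empty set maps the module in degree zero
  onto the ring; an element of the ring lies in \<open>I\<close> iff no multidegree without dividing generator
  occurs in it.
\<close>

theorem morse_resolution:
  fixes I :: "('v, 'k::comm_ring_1) mpoly set"
  assumes mem_gens: "\<And>p. p \<in> I \<longleftrightarrow> (\<forall>u\<in>Poly_Mapping.keys p. \<exists>g\<in>G. g \<le> u)"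
    and empty: "{} \<in> crit"
  shows "resolves_quotient I (morse_module G A) (morse_diff r G A)"
proof -
  have mem_I: "p \<in> I \<longleftrightarrow> (\<forall>u\<in>Poly_Mapping.keys p. below u \<noteq> {})" for p
    unfolding mem_gens below_def by blast
  have lcm0: "lcm_mon {} = (0 :: 'v mon)" by (simp add: lcm_mon_def zero_fun_def)
  have strand0: "strand u f {} = Poly_Mapping.lookup (f {}) u" for u and f :: "_ \<Rightarrow> ('v, 'k) mpoly"
    by (simp add: strand_def lcm0 le_fun_def fun_diff_def)
  have below_nonempty: "below u \<noteq> {}"
    if "f \<in> morse_module G A (Suc n)" "strand u f \<sigma> \<noteq> 0" for u \<sigma> n and f :: "_ \<Rightarrow> ('v, 'k) mpoly"
    using strand_nonzeroD[OF that] by auto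
  have "\<exists>f\<in>morse_module G A 0. f {} - s \<in> I" for s
    using empty mem_I[of 0]
    by (intro bexI[of _ "\<lambda>\<sigma>. if \<sigma> = {} then s else 0"]) (auto simp: morse_module_def)
  moreover have "f {} \<in> I \<longleftrightarrow> f \<in> morse_diff r G A ` morse_module G A 1"
    if f: "f \<in> morse_module G A 0" for f
  proof
    assume "f {} \<in> I"
    have "below u \<noteq> {}" if nz: "strand u f \<sigma> \<noteq> 0" for u \<sigma>
    proof -
      have "\<sigma> = {}"
        using strand_nonzeroD(1,3)[OF f nz] crit_subset finite_gens_subset by auto
      then show ?thesis using nz \<open>f {} \<in> I\<close> mem_I[of "f {}"] by (simp add: strand0 in_keys_iff)
    qed
    then show "f \<in> morse_diff r G A ` morse_module G A 1"
      using morse_exact[OF f] by simp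
  next
    assume "f \<in> morse_diff r G A ` morse_module G A 1"
    then obtain g where g: "g \<in> morse_module G A (Suc 0)" "f = morse_diff r G A g" by auto
    show "f {} \<in> I"
      unfolding mem_I
    proof
      fix u assume "u \<in> Poly_Mapping.keys (f {})"
      then have "strand u (morse_diff r G A g) {} \<noteq> 0"
        unfolding strand0 g(2) by (simp add: in_keys_iff)
      then obtain \<sigma> where "strand u g \<sigma> * mcoeff \<sigma> {} \<noteq> 0"
        unfolding strand_morse_diff[OF empty] by (meson sum.neutral)
      then have "strand u g \<sigma> \<noteq> 0" by auto
      then show "below u \<noteq> {}" using below_nonempty[OF g(1)] by blast
    qed
  qed
  moreover have "morse_diff r G A f = (\<lambda>_. 0) \<longleftrightarrow>
      f \<in> morse_diff r G A ` morse_module G A (Suc (Suc i))"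
    if f: "f \<in> morse_module G A (Suc i)" for f :: "_ \<Rightarrow> ('v, 'k) mpoly" and i
    using morse_exact[OF f] below_nonempty[OF f] morse_diff_morse_diff by blast
  ultimately show ?thesis unfolding resolves_quotient_def by blast
qed

text \<open>
  Only coefficients between critical sets with equal lcm could lie outside the maximal ideal; they
  vanish, as a gradient path between such sets starts by removing a bridge.
\<close>

theorem morse_minimal:
  assumes "\<And>\<sigma>. \<sigma> \<in> crit \<Longrightarrow> bridges \<sigma> = {}"
  shows "minimal_complex
    (morse_module G A :: nat \<Rightarrow> ('v mon set \<Rightarrow> ('v, 'k::comm_ring_1) mpoly) set) (morse_diff r G A)"
proof -
  have zero: "0 \<in> (max_ideal :: ('v, 'k) mpoly set)"
    using max_ideal_sum_mult[of "{}"] by simp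
  have "morse_diff r G A f \<tau> \<in> max_ideal" for f :: "_ \<Rightarrow> ('v, 'k) mpoly" and \<tau>
  proof (cases "\<tau> \<in> crit")
    case True
    have "Poly_Mapping.single (lcm_mon \<sigma> - lcm_mon \<tau>) (mcoeff \<sigma> \<tau>) \<in> (max_ideal :: ('v, 'k) mpoly set)"
      if \<sigma>: "\<sigma> \<in> crit" for \<sigma>
    proof (cases "mcoeff \<sigma> \<tau> = (0::'k)")
      case False
      then have le: "lcm_mon \<tau> \<le> lcm_mon \<sigma>" "lcm_mon \<tau> \<noteq> lcm_mon \<sigma>"
        using mcoeff_nonzero_lcm[of \<sigma> \<tau>] crit_subset True \<sigma> assms by blast+
      have "lcm_mon \<sigma> - lcm_mon \<tau> \<noteq> 0"
      proof
        assume "lcm_mon \<sigma> - lcm_mon \<tau> = 0"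
        then have "lcm_mon \<sigma> \<le> lcm_mon \<tau>" by (auto simp: le_fun_def fun_eq_iff)
        then show False using le by (auto dest: order.antisym)
      qed
      then show ?thesis by (rule single_mem_max_ideal)
    qed (simp add: zero)
    then show ?thesis using True unfolding morse_diff_def
      by (auto intro: max_ideal_sum_mult)
  qed (simp add: morse_diff_def zero)
  then show ?thesis unfolding minimal_complex_def by blast
qed

end


section \<open>Minimal Barile-Macchia resolutions\<close>

lemma (in bridge_friendly_gens) homogeneous_matching_bm_edges: "homogeneous_matching G r bm_edges"
proof unfold_locales
  show "bm_edges \<subseteq> taylor_edges G" by (rule bm_edges_subset_taylor)
  show "acyclic (reversed_edges G bm_edges)" by (rule acyclic_reversed_bm_edges)
  fix \<sigma> \<tau> assume \<sigma>\<tau>: "(\<sigma>, \<tau>) \<in> bm_edges"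
  show "\<sigma> = \<sigma>'" if "(\<sigma>', \<tau>) \<in> bm_edges" for \<sigma>' using bm_edges_inj \<sigma>\<tau> that by blast
  show "\<tau> = \<tau>'" if "(\<sigma>, \<tau>') \<in> bm_edges" for \<tau>' using \<sigma>\<tau> that unfolding bm_edges_def by blast
  show False if "(\<tau>, \<rho>) \<in> bm_edges" for \<rho>
    using bm_edges_not_source_and_target \<sigma>\<tau> that by blast
  show "lcm_mon \<sigma> = lcm_mon \<tau>" using \<sigma>\<tau> by (auto elim: bm_edgesE)
qed

text \<open>
  The unit ideal has to be excluded: its only generator is a bridge of the singleton, but the
  algorithm ignores sets with fewer than three elements, so the empty set and the singleton remain
  critical with equal lcm.
\<close>

theorem bridge_friendly_minimal_barile_macchia:
  fixes I :: "('v, 'k::comm_ring_1) mpoly set"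
  assumes "finite B" "I = ideal_gen (monomial ` B)" "1 \<notin> I" "bridge_friendly I"
  shows "has_minimal_barile_macchia_resolution I"
proof -
  define G where "G = min_gens I"
  obtain r where r: "strict_linear_order_on G r"
    "\<And>\<sigma>. \<sigma> \<subseteq> G \<Longrightarrow> potentially_type2 r G \<sigma> \<Longrightarrow> type2 r G \<sigma>"
    using assms(4) unfolding bridge_friendly_def G_def by blast
  interpret bridge_friendly_gens G r
  proof
    show "finite G" unfolding G_def assms(2) min_gens_monomial_ideal using assms(1) by simp
    show "strict_linear_order_on G r" by (rule r)
    show "0 \<notin> G"
      using assms(3) unfolding G_def min_gens_def monomial_def by auto
    show "a = b" if "a \<in> G" "b \<in> G" "a \<le> b" for a b
      using that unfolding G_def min_gens_def by blast
    show "type2 r G \<sigma>" if "\<sigma> \<subseteq> G" "potentially_type2 r G \<sigma>" for \<sigma>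
      using that by (rule r(2))
  qed
  note hm = homogeneous_matching_bm_edges
  have "p \<in> I \<longleftrightarrow> (\<forall>u\<in>Poly_Mapping.keys p. \<exists>g\<in>G. g \<le> u)" for p
    unfolding G_def using assms(1,2) by (rule mem_ideal_iff_min_gens)
  then have "resolves_quotient I (morse_module G bm_edges) (morse_diff r G bm_edges)"
    by (rule homogeneous_matching.morse_resolution[OF hm]) (rule empty_critical)
  moreover have "minimal_complex
    (morse_module G bm_edges :: nat \<Rightarrow> ('v mon set \<Rightarrow> ('v, 'k) mpoly) set) (morse_diff r G bm_edges)"
    by (rule homogeneous_matching.morse_minimal[OF hm]) (rule critical_no_bridges)
  ultimately show ?thesis
    unfolding has_minimal_barile_macchia_resolution_def G_def[symmetric]
    using r(1) bm_matching_bm_edges by blast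
qed

theorem theorem5p4:
  fixes E :: "'v::finite set set"
  assumes "rooted_hypertree E"
  shows "bridge_friendly (edge_ideal E :: ('v, 'k::field) mpoly set) \<and>
         has_minimal_barile_macchia_resolution (edge_ideal E :: ('v, 'k) mpoly set)"
proof
  show friendly: "bridge_friendly (edge_ideal E :: ('v, 'k) mpoly set)"
    using assms by (rule bridge_friendly_edge_ideal)
  have "e \<noteq> {}" if "e \<in> E" for e
    using assms that
    unfolding rooted_hypertree_def hypertree_rooted_at_def host_graph_def induced_connected_def
      by blast
  then have "\<exists>x. edge_mon e x = 1" if "e \<in> E" for e
    using that by (auto simp: edge_mon_def)
  then have "\<not> edge_mon e \<le> 0" if "e \<in> E" for e
    using that by (metis le_funD not_one_le_zero zero_fun_apply)
  then have "1 \<notin> (edge_ideal E :: ('v, 'k) mpoly set)"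
    unfolding edge_ideal_eq mem_monomial_ideal_iff by auto
  then show "has_minimal_barile_macchia_resolution (edge_ideal E :: ('v, 'k) mpoly set)"
    using friendly edge_ideal_eq
      by (intro bridge_friendly_minimal_barile_macchia[of "edge_mon ` E"]) auto
qed

end
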